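(* Let $\{\mathbf{X}_t\}_{t\in\mathbb{Z}}$ be a $d$-dimensional weakly stationary, zero-mean time series whose spectral measure is absolutely continuous with density matrix $\mathbf{f}(\omega)$, $\omega\in[-\pi,\pi]$, which has constant rank $r$, $1\le r\le d$. Assume there is a finite constant $M$ with $\|\mathbf{f}(\omega)\|\le M$ for all $\omega\in[-\pi,\pi]$, and that $\mathbf{f}=\frac{1}{2\pi}\boldsymbol{\phi}\boldsymbol{\phi}^*$ for some $d\times r$ matrix function $\boldsymbol{\phi}\in H^2$ whose Moore--Penrose inverse $\boldsymbol{\psi}$ also belongs to $H^2$. Then $\{\mathbf{X}_t\}$ is regular, and a fundamental white noise process of it is given by \[ \boldsymbol{\xi}_t=\int_{-\pi}^{\pi}e^{it\omega}\boldsymbol{\psi}(\omega)\,d\mathbf{Z}_\omega=\sum_{k=0}^{\infty}\boldsymbol{\gamma}(k)\mathbf{X}_{t-k}\qquad(t\in\mathbb{Z}), \] where $\boldsymbol{\psi}(\omega)=\sum_{k=0}^\infty\boldsymbol{\gamma}(k)e^{-ik\omega}$, $\boldsymbol{\gamma}(k)=\frac{1}{2\pi}\int_{-\pi}^{\pi}e^{ik\omega}\boldsymbol{\psi}(\omega)\,d\omega$, is the ($L^2$-convergent) Fourier series of $\boldsymbol{\psi}$. Moreover, the coefficients $\{\mathbf{b}(j)\}$ of the corresponding Wold representation $\mathbf{X}_t=\sum_{j=0}^\infty\mathbf{b}(j)\boldsymbol{\xi}_{t-j}$ are given by the $L^2$-convergent Fourier series \[ \boldsymbol{\phi}(\omega)=\sum_{j=0}^\infty\mathbf{b}(j)e^{-ij\omega},\qquad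 \mathbf{b}(j)=\frac{1}{2\pi}\int_{-\pi}^{\pi}e^{ij\omega}\boldsymbol{\phi}(\omega)\,d\omega . \]
   Context: $\{\mathbf{X}_t\}$ takes values in $\mathbb{C}^d$, components in $L^2(\Omega,\mathcal{F},P)$, $E\mathbf{X}_t=0$, $E(\mathbf{X}_{t+h}\mathbf{X}_t^* )=\mathbf{C}(h)=\int_{-\pi}^{\pi}e^{ih\omega}d\mathbf{F}(\omega)$ with $d\mathbf{F}=\mathbf{f}\,d\omega$. The past until time $n$ is $H^-_n=\overline{\mathrm{span}}\{X^\ell_t:\ell=1,\dots,d,\ t\le n\}$; the process is regular if $\bigcap_n H^-_n=\{0\}$. A regular process has a Wold representation $\mathbf{X}_t=\sum_{j\ge0}\mathbf{b}(j)\boldsymbol{\xi}_{t-j}$, $\mathbf{b}(j)\in\mathbb{C}^{d\times r}$, where $\{\boldsymbol{\xi}_t\}$ is an $r$-dimensional orthonormal white noise ($E\boldsymbol{\xi}_t=0$, $E\boldsymbol{\xi}_s\boldsymbol{\xi}_t^*=\delta_{st}I_r$) with $H^-_n(\boldsymbol{\xi})=H^-_n(\mathbf{X})$ for all $n$; such $\{\boldsymbol{\xi}_t\}$ is called a fundamental process. Convention: a (matrix) function on $[-\pi,\pi]$ is in $H^2$ (resp. $H^\infty$) if its entries are in $L^2$ (resp. $L^\infty$) and have Fourier series containing only nonnegative powers of $e^{-i\omega}$, i.e. of the form $\sum_{j\ge0}c_je^{-ij\omega}$. $\|\cdot\|$ is the spectral norm. The Moore--Penrose inverse of $\boldsymbol{\phi}(\omega)=\mathbf{V}(\omega)\mathbf{S}(\omega)\mathbf{U}^*(\omega)$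 (SVD with $\mathbf{V}$ a $d\times r$ matrix with orthonormal columns, $\mathbf{U}$ $r\times r$ unitary, $\mathbf{S}$ diagonal positive) is $\boldsymbol{\psi}=\mathbf{U}\mathbf{S}^{-1}\mathbf{V}^*$, so $\boldsymbol{\psi}\boldsymbol{\phi}=I_r$ a.e. $\mathbf{Z}_\omega$ is the orthogonal-increment process of the Cramér representation $\mathbf{X}_t=\int_{-\pi}^{\pi}e^{it\omega}d\mathbf{Z}_\omega$. *)

theory Defs
  imports "HOL-Analysis.Analysis" "HOL-Probability.Probability"
begin

definition cadj :: "complex^'n^'m \<Rightarrow> complex^'m^'n" where
  "cadj A = (\<chi> i j. cnj (A $ j $ i))"

definition cmscale :: "complex \<Rightarrow> complex^'n^'m \<Rightarrow> complex^'n^'m" where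
  "cmscale c A = (\<chi> i j. c * A $ i $ j)"

definition spec_norm :: "complex^'n^'m \<Rightarrow> real" where
  "spec_norm A = onorm (\<lambda>x. A *v x)"

text \<open>Moore--Penrose inverse: the unique matrix satisfying the four Penrose equations.
  (For a matrix with full column rank this coincides with U S^{-1} V^* from the SVD.)\<close>
definition is_MP_inverse :: "complex^'r^'d \<Rightarrow> complex^'d^'r \<Rightarrow> bool" where
  "is_MP_inverse A B \<longleftrightarrow> A ** B ** A = A \<and> B ** A ** B = B
     \<and> cadj (A ** B) = A ** B \<and> cadj (B ** A) = B ** A"

definition MP_inverse :: "complex^'r^'d \<Rightarrow> complex^'d^'r" where
  "MP_inverse A = (THE B. is_MP_inverse A B)"

definition L2_fun :: "(real \<Rightarrow> complex) \<Rightarrow> bool" where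
  "L2_fun g \<longleftrightarrow> g \<in> borel_measurable lborel
     \<and> set_integrable lborel {-pi..pi} (\<lambda>\<omega>. (cmod (g \<omega>))\<^sup>2)"

text \<open>Scalar H^2: in L^2 and Fourier series contains only nonnegative powers of e^{-i omega},
  i.e. the coefficients of e^{i k omega}, k > 0, vanish.\<close>
definition H2_fun :: "(real \<Rightarrow> complex) \<Rightarrow> bool" where
  "H2_fun g \<longleftrightarrow> L2_fun g \<and>
     (\<forall>k::int. k > 0 \<longrightarrow>
        (LINT \<omega>:{-pi..pi}|lborel. exp (- (\<i> * of_int k * of_real \<omega>)) * g \<omega>) = 0)"

definition H2_mat :: "(real \<Rightarrow> complex^'n^'m) \<Rightarrow> bool" where
  "H2_mat g \<longleftrightarrow> (\<forall>i j. H2_fun (\<lambda>\<omega>. g \<omega> $ i $ j))"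

text \<open>Fourier coefficient (1/2pi) int e^{i j omega} g(omega) d omega of a matrix function,
  i.e. the coefficient of e^{-i j omega}.\<close>
definition fcoef :: "(real \<Rightarrow> complex^'n^'m) \<Rightarrow> nat \<Rightarrow> complex^'n^'m" where
  "fcoef g j = (\<chi> a b. complex_of_real (1 / (2 * pi)) *
      (LINT \<omega>:{-pi..pi}|lborel. exp (\<i> * of_nat j * of_real \<omega>) * g \<omega> $ a $ b))"

definition L2_fourier_series :: "(real \<Rightarrow> complex^'n^'m) \<Rightarrow> (nat \<Rightarrow> complex^'n^'m) \<Rightarrow> bool" where
  "L2_fourier_series g c \<longleftrightarrow>
     (\<forall>N. set_integrable lborel {-pi..pi}
        (\<lambda>\<omega>. (norm (g \<omega> - (\<Sum>j<N. cmscale (exp (- (\<i> * of_nat j * of_real \<omega>))) (c j))))\<^sup>2))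
   \<and> ((\<lambda>N. LINT \<omega>:{-pi..pi}|lborel.
        (norm (g \<omega> - (\<Sum>j<N. cmscale (exp (- (\<i> * of_nat j * of_real \<omega>))) (c j))))\<^sup>2)
       \<longlonglongrightarrow> 0)"

definition L2_rv :: "'a measure \<Rightarrow> ('a \<Rightarrow> complex) \<Rightarrow> bool" where
  "L2_rv M Y \<longleftrightarrow> Y \<in> borel_measurable M \<and> integrable M (\<lambda>x. (cmod (Y x))\<^sup>2)"

definition L2_rvec :: "'a measure \<Rightarrow> ('a \<Rightarrow> complex^'k) \<Rightarrow> bool" where
  "L2_rvec M Y \<longleftrightarrow> (\<forall>l. L2_rv M (\<lambda>x. Y x $ l))"

text \<open>The past H^-_n(X): closed linear span in L^2 of the components X^l_t, t \<le> n.
  Y belongs to it iff Y is in L^2 and can be approximated arbitrarily well in L^2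
  by finite linear combinations of such components.\<close>
definition in_past :: "'a measure \<Rightarrow> (int \<Rightarrow> 'a \<Rightarrow> complex^'k) \<Rightarrow> int \<Rightarrow> ('a \<Rightarrow> complex) \<Rightarrow> bool" where
  "in_past M X n Y \<longleftrightarrow> L2_rv M Y \<and>
     (\<forall>\<epsilon>>0. \<exists>S c. finite S \<and> (\<forall>p\<in>S. fst p \<le> n) \<and>
        (\<integral>x. (cmod (Y x - (\<Sum>p\<in>S. c p * X (fst p) x $ snd p)))\<^sup>2 \<partial>M) < \<epsilon>)"

definition regular_process :: "'a measure \<Rightarrow> (int \<Rightarrow> 'a \<Rightarrow> complex^'k) \<Rightarrow> bool" where
  "regular_process M X \<longleftrightarrow>
     (\<forall>Y. (\<forall>n. in_past M X n Y) \<longrightarrow> (AE x in M. Y x = 0))"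

definition orthonormal_white_noise :: "'a measure \<Rightarrow> (int \<Rightarrow> 'a \<Rightarrow> complex^'r) \<Rightarrow> bool" where
  "orthonormal_white_noise M \<xi> \<longleftrightarrow>
     (\<forall>t. L2_rvec M (\<xi> t)) \<and>
     (\<forall>t l. (\<integral>x. \<xi> t x $ l \<partial>M) = 0) \<and>
     (\<forall>s t i j. (\<integral>x. \<xi> s x $ i * cnj (\<xi> t x $ j) \<partial>M) = (if s = t \<and> i = j then 1 else 0))"

definition fundamental_process ::
  "'a measure \<Rightarrow> (int \<Rightarrow> 'a \<Rightarrow> complex^'d) \<Rightarrow> (int \<Rightarrow> 'a \<Rightarrow> complex^'r) \<Rightarrow> bool" where
  "fundamental_process M X \<xi> \<longleftrightarrow> orthonormal_white_noise M \<xi> \<and>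
     (\<forall>n Y. in_past M \<xi> n Y \<longleftrightarrow> in_past M X n Y)"

definition L2_converges :: "'a measure \<Rightarrow> (nat \<Rightarrow> 'a \<Rightarrow> complex^'k) \<Rightarrow> ('a \<Rightarrow> complex^'k) \<Rightarrow> bool" where
  "L2_converges M S Y \<longleftrightarrow>
     (\<forall>N. integrable M (\<lambda>x. (norm (Y x - S N x))\<^sup>2)) \<and>
     ((\<lambda>N. \<integral>x. (norm (Y x - S N x))\<^sup>2 \<partial>M) \<longlonglongrightarrow> 0)"

text \<open>Stochastic integral int g(omega) dZ_omega w.r.t. the orthogonal-increment process of the
  Cramer representation of X (spectral density f), for an r x d matrix function g that is
  square integrable w.r.t. dF = f d omega.  It is characterised via the Kolmogorov isometry:
  for a trigonometric polynomial p(omega) = sum_s A_s e^{i s omega} one has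
  int p dZ = sum_s A_s X_s, and int g dZ is the L^2(P)-limit of int p_n dZ for trigonometric
  polynomials p_n \<rightarrow> g in L^2(dF).\<close>
definition stoch_int ::
  "'a measure \<Rightarrow> (int \<Rightarrow> 'a \<Rightarrow> complex^'d) \<Rightarrow> (real \<Rightarrow> complex^'d^'d)
     \<Rightarrow> (real \<Rightarrow> complex^'d^'r) \<Rightarrow> ('a \<Rightarrow> complex^'r) \<Rightarrow> bool" where
  "stoch_int M X f g Y \<longleftrightarrow> L2_rvec M Y \<and>
     set_integrable lborel {-pi..pi} (\<lambda>\<omega>. Re (trace (g \<omega> ** f \<omega> ** cadj (g \<omega>)))) \<and>
     (\<forall>\<epsilon>>0. \<exists>S A. finite S \<and>
        set_integrable lborel {-pi..pi}
          (\<lambda>\<omega>. let D = g \<omega> - (\<Sum>s\<in>S. cmscale (exp (\<i> * of_int s * of_real \<omega>)) (A s))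
               in Re (trace (D ** f \<omega> ** cadj D))) \<and>
        (LINT \<omega>:{-pi..pi}|lborel.
            let D = g \<omega> - (\<Sum>s\<in>S. cmscale (exp (\<i> * of_int s * of_real \<omega>)) (A s))
            in Re (trace (D ** f \<omega> ** cadj D))) < \<epsilon> \<and>
        integrable M (\<lambda>x. (norm (Y x - (\<Sum>s\<in>S. A s *v X s x)))\<^sup>2) \<and>
        (\<integral>x. (norm (Y x - (\<Sum>s\<in>S. A s *v X s x)))\<^sup>2 \<partial>M) < \<epsilon>)"

end

theory Submission
  imports Defs
begin

text \<open>
  Since \<open>f = \<phi> \<phi>\<^sup>* / 2\<pi>\<close>, the map sending \<open>X\<^sup>i\<^sub>t\<close> to \<open>e\<^sup>i\<^sup>t\<^sup>\<omega>\<close> times the \<open>i\<close>-th row of \<open>\<phi>\<close> extends, up to the factor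
  \<open>2\<pi>\<close>, to an isometry of the closed span of \<open>X\<close> into \<open>L\<^sup>2\<close> row vectors. Constant rank forces \<open>\<psi> \<phi> = I\<close> almost
  everywhere, and \<open>\<phi>\<close> is bounded because \<open>f\<close> is; hence multiplying the Fourier partial sums of \<open>\<psi>\<close> by \<open>\<phi>\<close>
  gives an \<open>L\<^sup>2\<close>-convergent sequence with limit \<open>I\<close>. So the partial sums of \<open>\<Sum> \<gamma>(k) X\<^sub>t\<^sub>-\<^sub>k\<close> are Cauchy, and the
  limits \<open>\<xi>\<^sub>t\<close> correspond to \<open>e\<^sup>i\<^sup>t\<^sup>\<omega> I\<close>, which makes them an orthonormal white noise. The Wold error
  \<open>X\<^sub>t - \<Sum> b(j) \<xi>\<^sub>t\<^sub>-\<^sub>j\<close> corresponds to the Fourier remainder of \<open>\<phi>\<close>, so it tends to 0. The two one-sided series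
  show that \<open>X\<close> and \<open>\<xi>\<close> have the same past, and the remote past of a white noise is trivial.
\<close>

section \<open>Square-integrable functions\<close>

text \<open>\<open>H2_mat\<close> only says that certain integrals vanish, so convergence of the
  one-sided Fourier series has to be earned: Bessel and completeness give some L^2 limit, and
  uniqueness of Fourier coefficients is what identifies it with the given function. Uniqueness is
  proved for integrable functions by widening the class of test functions from characters to
  indicators of Borel sets.

  The bound on \<open>f\<close> decides in which sense the products converge. An L^2 error times a
  merely L^2 factor tends to 0 only in L^1, and from this no L^2 limit of random variables could be
  drawn; with bounded \<phi> the products converge in L^2.

  The isometry is handled as a relation, not as a map. The variables of \<open>X\<close> may be
  linearly dependent and functions are not identified when equal almost everywhere, so a map on
  linear combinations would first have to be shown well defined. For the relation the norm identity
  does this work: a pair whose one side is null has a null other side.\<close>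

definition square_integrable :: "'a measure \<Rightarrow> ('a \<Rightarrow> 'b::euclidean_space) \<Rightarrow> bool" where
  "square_integrable M f \<longleftrightarrow> f \<in> borel_measurable M \<and> integrable M (\<lambda>x. (norm (f x))\<^sup>2)"

text \<open>A seminorm on functions, used for scalars, vectors and matrices alike; on the last two
  \<open>norm\<close> is the Euclidean (Frobenius) norm. The Bochner integral of a non-integrable
  function is 0, so the value is informative only together with
  \<open>square_integrable\<close>.\<close>

definition l2norm :: "'a measure \<Rightarrow> ('a \<Rightarrow> 'b::euclidean_space) \<Rightarrow> real" where
  "l2norm M f = sqrt (\<integral>x. (norm (f x))\<^sup>2 \<partial>M)"

lemma l2norm_nonneg [simp]: "0 \<le> l2norm M f"
  by (simp add: l2norm_def)

lemma l2norm_power2: "(l2norm M f)\<^sup>2 = (\<integral>x. (norm (f x))\<^sup>2 \<partial>M)"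
  by (simp add: l2norm_def)

lemma l2norm_tendsto_0_iff:
  "((\<lambda>n. l2norm M (F n)) \<longlongrightarrow> 0) net \<longleftrightarrow> ((\<lambda>n. \<integral>x. (norm (F n x))\<^sup>2 \<partial>M) \<longlongrightarrow> 0) net"
proof
  assume "((\<lambda>n. l2norm M (F n)) \<longlongrightarrow> 0) net"
  then have "((\<lambda>n. (l2norm M (F n))\<^sup>2) \<longlongrightarrow> 0\<^sup>2) net"
    by (intro tendsto_intros)
  then show "((\<lambda>n. \<integral>x. (norm (F n x))\<^sup>2 \<partial>M) \<longlongrightarrow> 0) net"
    by (simp add: l2norm_power2)
next
  assume "((\<lambda>n. \<integral>x. (norm (F n x))\<^sup>2 \<partial>M) \<longlongrightarrow> 0) net"
  then have "((\<lambda>n. sqrt (\<integral>x. (norm (F n x))\<^sup>2 \<partial>M)) \<longlongrightarrow> sqrt 0) net"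
    by (intro tendsto_intros)
  then show "((\<lambda>n. l2norm M (F n)) \<longlongrightarrow> 0) net"
    by (simp add: l2norm_def)
qed

lemma square_integrable_measurable:
  "square_integrable M f \<Longrightarrow> f \<in> borel_measurable M"
  by (simp add: square_integrable_def)

lemma square_integrableD: "square_integrable M f \<Longrightarrow> integrable M (\<lambda>x. (norm (f x))\<^sup>2)"
  by (simp add: square_integrable_def)

lemma square_integrable_bound:
  assumes "square_integrable M f" "g \<in> borel_measurable M"
    and "AE x in M. norm (g x) \<le> C * norm (f x)"
  shows "square_integrable M g"
proof -
  have "integrable M (\<lambda>x. C\<^sup>2 * (norm (f x))\<^sup>2)"
    using assms(1) by (simp add: square_integrable_def)
  moreover have "AE x in M. norm ((norm (g x))\<^sup>2) \<le> norm (C\<^sup>2 * (norm (f x))\<^sup>2)"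
    using assms(3)
  proof eventually_elim
    case (elim x)
    then have "(norm (g x))\<^sup>2 \<le> (C * norm (f x))\<^sup>2"
      by (rule power_mono) simp
    then show ?case
      by (simp add: power_mult_distrib)
  qed
  ultimately have "integrable M (\<lambda>x. (norm (g x))\<^sup>2)"
    by (rule_tac Bochner_Integration.integrable_bound[where f = "\<lambda>x. C\<^sup>2 * (norm (f x))\<^sup>2"]) (use assms(2) in simp_all)
  then show ?thesis
    using assms(2) by (simp add: square_integrable_def)
qed

lemma l2norm_bound:
  assumes "square_integrable M f" "g \<in> borel_measurable M" "0 \<le> C"
    and "AE x in M. norm (g x) \<le> C * norm (f x)"
  shows "l2norm M g \<le> C * l2norm M f"
proof -
  have g: "square_integrable M g"
    using square_integrable_bound[OF assms(1,2,4)] .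
  have "(l2norm M g)\<^sup>2 \<le> (\<integral>x. C\<^sup>2 * (norm (f x))\<^sup>2 \<partial>M)"
    unfolding l2norm_power2
  proof (rule integral_mono_AE)
    show "AE x in M. (norm (g x))\<^sup>2 \<le> C\<^sup>2 * (norm (f x))\<^sup>2"
      using assms(4) by eventually_elim (metis norm_ge_zero power_mono power_mult_distrib)
  qed (use g assms(1) in \<open>auto simp: square_integrable_def\<close>)
  also have "\<dots> = (C * l2norm M f)\<^sup>2"
    by (simp add: l2norm_power2 power_mult_distrib)
  finally show ?thesis
    using assms(3) by (rule_tac power2_le_imp_le) simp_all
qed

lemma square_integrable_zero [simp]: "square_integrable M (\<lambda>x. 0)"
  by (simp add: square_integrable_def)

lemma square_integrable_add:
  assumes "square_integrable M f" "square_integrable M g"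
  shows "square_integrable M (\<lambda>x. f x + g x)"
proof -
  have [measurable]: "f \<in> borel_measurable M" "g \<in> borel_measurable M"
    using assms by (auto simp: square_integrable_def)
  have "integrable M (\<lambda>x. 2 * (norm (f x))\<^sup>2 + 2 * (norm (g x))\<^sup>2)"
    using assms by (auto simp: square_integrable_def)
  moreover have "(norm (f x + g x))\<^sup>2 \<le> 2 * (norm (f x))\<^sup>2 + 2 * (norm (g x))\<^sup>2" for x
  proof -
    have "(norm (f x + g x))\<^sup>2 \<le> (norm (f x) + norm (g x))\<^sup>2"
      by (intro power_mono norm_triangle_ineq) auto
    also have "\<dots> \<le> 2 * (norm (f x))\<^sup>2 + 2 * (norm (g x))\<^sup>2"
      using sum_squares_bound[of "norm (f x)" "norm (g x)"] by (simp add: power2_sum)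
    finally show ?thesis .
  qed
  ultimately have "integrable M (\<lambda>x. (norm (f x + g x))\<^sup>2)"
    by (rule_tac Bochner_Integration.integrable_bound[where f = "\<lambda>x. 2 * (norm (f x))\<^sup>2 + 2 * (norm (g x))\<^sup>2"]) auto
  then show ?thesis
    by (simp add: square_integrable_def)
qed

lemma square_integrable_uminus:
  "square_integrable M f \<Longrightarrow> square_integrable M (\<lambda>x. - f x)"
  by (simp add: square_integrable_def)

lemma square_integrable_diff:
  assumes "square_integrable M f" "square_integrable M g"
  shows "square_integrable M (\<lambda>x. f x - g x)"
  using square_integrable_add[OF assms(1) square_integrable_uminus[OF assms(2)]] by simp

lemma square_integrable_sum:
  "(\<And>i. i \<in> I \<Longrightarrow> square_integrable M (f i)) \<Longrightarrow> square_integrable M (\<lambda>x. \<Sum>i\<in>I. f i x)"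
  by (induction I rule: infinite_finite_induct) (auto intro: square_integrable_add)

lemma square_integrable_cmult:
  fixes f :: "'a \<Rightarrow> complex"
  shows "square_integrable M f \<Longrightarrow> square_integrable M (\<lambda>x. c * f x)"
  by (rule square_integrable_bound[where C = "norm c"]) (auto simp: norm_mult square_integrable_def)

lemma square_integrable_norm_mult:
  assumes "square_integrable M f" "square_integrable M g"
  shows "integrable M (\<lambda>x. norm (f x) * norm (g x))"
proof -
  have [measurable]: "f \<in> borel_measurable M" "g \<in> borel_measurable M"
    using assms by (auto simp: square_integrable_def)
  have "integrable M (\<lambda>x. (norm (f x))\<^sup>2 + (norm (g x))\<^sup>2)"
    using assms by (auto simp: square_integrable_def)
  moreover have "norm (f x) * norm (g x) \<le> (norm (f x))\<^sup>2 + (norm (g x))\<^sup>2" for x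
  proof -
    have "0 \<le> norm (f x) * norm (g x)"
      by simp
    then show ?thesis
      using sum_squares_bound[of "norm (f x)" "norm (g x)"] by linarith
  qed
  ultimately show ?thesis
    by (rule_tac Bochner_Integration.integrable_bound[where f = "\<lambda>x. (norm (f x))\<^sup>2 + (norm (g x))\<^sup>2"]) auto
qed

section \<open>The Cauchy--Schwarz and Minkowski inequalities\<close>

lemma nn_integral_power2_norm:
  "square_integrable M f \<Longrightarrow> (\<integral>\<^sup>+x. (ennreal (norm (f x)))\<^sup>2 \<partial>M) = ennreal ((l2norm M f)\<^sup>2)"
  by (simp add: ennreal_power nn_integral_eq_integral square_integrableD l2norm_power2)

text \<open>Cauchy--Schwarz, taken from its version for extended nonnegative integrals; all three
  integrals are finite, so the inequality can be read back in the reals.\<close>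

lemma integral_norm_mult_le:
  assumes "square_integrable M f" "square_integrable M g"
  shows "(\<integral>x. norm (f x) * norm (g x) \<partial>M) \<le> l2norm M f * l2norm M g"
proof -
  have [measurable]: "f \<in> borel_measurable M" "g \<in> borel_measurable M"
    using assms by (auto simp: square_integrable_def)
  have "(ennreal (\<integral>x. norm (f x) * norm (g x) \<partial>M))\<^sup>2
      = (\<integral>\<^sup>+x. ennreal (norm (f x)) * ennreal (norm (g x)) \<partial>M)\<^sup>2"
    using square_integrable_norm_mult[OF assms]
    by (simp add: nn_integral_eq_integral flip: ennreal_mult)
  also have "\<dots> \<le> ennreal ((l2norm M f)\<^sup>2) * ennreal ((l2norm M g)\<^sup>2)"
    unfolding nn_integral_power2_norm[OF assms(1), symmetric] nn_integral_power2_norm[OF assms(2), symmetric]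
    by (rule Cauchy_Schwarz_nn_integral) auto
  also have "\<dots> = ennreal ((l2norm M f * l2norm M g)\<^sup>2)"
    by (simp add: power_mult_distrib ennreal_mult)
  finally have "(\<integral>x. norm (f x) * norm (g x) \<partial>M)\<^sup>2 \<le> (l2norm M f * l2norm M g)\<^sup>2"
    by (simp add: ennreal_power)
  then show ?thesis
    by (rule power2_le_imp_le) simp
qed

text \<open>Minkowski: expand the square pointwise and bound the cross term by
  Cauchy--Schwarz.\<close>

lemma l2norm_triangle:
  assumes "square_integrable M f" "square_integrable M g"
  shows "l2norm M (\<lambda>x. f x + g x) \<le> l2norm M f + l2norm M g"
proof -
  note int = square_integrableD[OF assms(1)] square_integrableD[OF assms(2)]
    square_integrable_norm_mult[OF assms] square_integrableD[OF square_integrable_add[OF assms]]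
  have "(l2norm M (\<lambda>x. f x + g x))\<^sup>2
      \<le> (\<integral>x. (norm (f x))\<^sup>2 + 2 * (norm (f x) * norm (g x)) + (norm (g x))\<^sup>2 \<partial>M)"
    unfolding l2norm_power2
  proof (rule integral_mono)
    fix x
    have "(norm (f x + g x))\<^sup>2 \<le> (norm (f x) + norm (g x))\<^sup>2"
      by (intro power_mono norm_triangle_ineq) auto
    then show "(norm (f x + g x))\<^sup>2 \<le> (norm (f x))\<^sup>2 + 2 * (norm (f x) * norm (g x)) + (norm (g x))\<^sup>2"
      by (simp add: power2_sum)
  qed (use int in auto)
  also have "\<dots> = (l2norm M f)\<^sup>2 + 2 * (\<integral>x. norm (f x) * norm (g x) \<partial>M) + (l2norm M g)\<^sup>2"
    using int by (simp add: l2norm_power2)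
  also have "\<dots> \<le> (l2norm M f + l2norm M g)\<^sup>2"
    using integral_norm_mult_le[OF assms] by (simp add: power2_sum)
  finally show ?thesis
    by (rule power2_le_imp_le) simp
qed

lemma l2norm_commute: "l2norm M (\<lambda>x. f x - g x) = l2norm M (\<lambda>x. g x - f x)"
  by (simp add: l2norm_def norm_minus_commute)

lemma l2norm_triangle_diff:
  assumes "square_integrable M f" "square_integrable M g" "square_integrable M h"
  shows "l2norm M (\<lambda>x. f x - h x) \<le> l2norm M (\<lambda>x. f x - g x) + l2norm M (\<lambda>x. g x - h x)"
  using l2norm_triangle[OF square_integrable_diff[OF assms(1,2)] square_integrable_diff[OF assms(2,3)]]
  by simp

text \<open>The reverse triangle inequality, from the triangle inequality with the zero function as
  third point.\<close>

lemma l2norm_diff_le: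
  assumes "square_integrable M f" "square_integrable M g"
  shows "\<bar>l2norm M f - l2norm M g\<bar> \<le> l2norm M (\<lambda>x. f x - g x)"
  using l2norm_triangle_diff[OF assms square_integrable_zero]
    l2norm_triangle_diff[OF assms(2,1) square_integrable_zero]
  by (simp add: l2norm_commute[of M g f])

lemma l2norm_cmult:
  fixes f :: "'a \<Rightarrow> complex"
  shows "l2norm M (\<lambda>x. c * f x) = cmod c * l2norm M f"
  by (simp add: l2norm_def norm_mult power_mult_distrib real_sqrt_mult)

section \<open>Completeness over a finite measure\<close>

lemma (in finite_measure) square_integrable_imp_integrable_norm:
  assumes "square_integrable M f"
  shows "integrable M f" "(\<integral>x. norm (f x) \<partial>M) \<le> sqrt (measure M (space M)) * l2norm M f"
proof -
  have one: "square_integrable M (\<lambda>_. 1::real)"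
    by (simp add: square_integrable_def)
  have [measurable]: "f \<in> borel_measurable M"
    using assms by (auto simp: square_integrable_def)
  show "integrable M f"
    using square_integrable_norm_mult[OF assms one] by (simp add: integrable_norm_iff)
  show "(\<integral>x. norm (f x) \<partial>M) \<le> sqrt (measure M (space M)) * l2norm M f"
    using integral_norm_mult_le[OF assms one] by (simp add: l2norm_def mult.commute)
qed

text \<open>Riesz--Fischer. A subsequence with increments below \<open>(1/2)^k\<close> in L^2 has
  summable increments in L^1 because the measure is finite, hence converges almost everywhere; Fatou
  then turns the Cauchy bounds into bounds on the distance to the limit.\<close>

lemma (in finite_measure) l2_complete:
  fixes F :: "nat \<Rightarrow> 'a \<Rightarrow> 'b::euclidean_space"
  assumes F: "\<And>n. square_integrable M (F n)"
    and Cauchy: "\<And>e. 0 < e \<Longrightarrow> \<exists>N. \<forall>m\<ge>N. \<forall>n\<ge>N. l2norm M (\<lambda>x. F m x - F n x) < e"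
  obtains f where "square_integrable M f" "(\<lambda>n. l2norm M (\<lambda>x. f x - F n x)) \<longlonglongrightarrow> 0"
proof -
  have [measurable]: "F n \<in> borel_measurable M" for n
    using F by (auto simp: square_integrable_def)
  have "\<forall>k. \<exists>N. \<forall>m\<ge>N. \<forall>n\<ge>N. l2norm M (\<lambda>x. F m x - F n x) < (1/2)^k"
    using Cauchy by simp
  then obtain N0 where N0: "\<And>k m n. m \<ge> N0 k \<Longrightarrow> n \<ge> N0 k \<Longrightarrow> l2norm M (\<lambda>x. F m x - F n x) < (1/2)^k"
    by metis
  \<comment> \<open>The cumulative sum gives monotonicity and \<open>N0 k \<le> r k\<close> at once;
    the summand \<open>k\<close> makes \<open>r\<close> tend to infinity even if all
    \<open>N0 k\<close> are 0.\<close>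
  define r where "r k = (\<Sum>i\<le>k. N0 i) + k" for k
  have r_N0: "r k \<ge> N0 k" for k
    using member_le_sum[of k "{..k}" N0] by (simp add: r_def)
  have r_mono: "r k \<le> r (Suc k)" for k
    by (simp add: r_def)
  define G where "G k x = F (r (Suc k)) x - F (r k) x" for k x
  have G: "square_integrable M (G k)" for k
    unfolding G_def by (intro square_integrable_diff F)
  have [measurable]: "G k \<in> borel_measurable M" for k
    using G by (auto simp: square_integrable_def)
  define c where "c = sqrt (measure M (space M))"
  have Gn: "(\<integral>x. norm (G k x) \<partial>M) \<le> c * (1/2)^k" for k
  proof -
    have "l2norm M (G k) \<le> (1/2)^k"
      unfolding G_def using N0[of k "r (Suc k)" "r k"] r_N0[of k] r_mono[of k] by simp
    then show ?thesis
      using square_integrable_imp_integrable_norm(2)[OF G[of k]]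
        mult_left_mono[of "l2norm M (G k)" "(1/2)^k" c]
      by (simp add: c_def)
  qed
  have "(\<integral>\<^sup>+x. (\<Sum>k. ennreal (norm (G k x))) \<partial>M) = (\<Sum>k. \<integral>\<^sup>+x. ennreal (norm (G k x)) \<partial>M)"
    by (rule nn_integral_suminf) auto
  also have "\<dots> \<le> (\<Sum>k. ennreal (c * (1/2)^k))"
  proof (intro suminf_le)
    fix k
    show "(\<integral>\<^sup>+x. ennreal (norm (G k x)) \<partial>M) \<le> ennreal (c * (1/2)^k)"
      using Gn[of k] square_integrable_imp_integrable_norm(1)[OF G[of k]]
      by (simp add: nn_integral_eq_integral ennreal_leI)
  qed auto
  also have "\<dots> = ennreal (\<Sum>k. c * (1/2)^k)"
    by (rule suminf_ennreal2) (auto simp: c_def intro!: summable_mult summable_geometric)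
  finally have "(\<integral>\<^sup>+x. (\<Sum>k. ennreal (norm (G k x))) \<partial>M) \<noteq> \<infinity>"
    by (auto simp: top_unique)
  then have "AE x in M. (\<Sum>k. ennreal (norm (G k x))) \<noteq> \<infinity>"
    by (intro nn_integral_noteq_infinite) auto
  then have conv: "AE x in M. convergent (\<lambda>k. F (r k) x)"
  proof eventually_elim
    case (elim x)
    then have "summable (\<lambda>k. norm (G k x))"
      by (intro summable_suminf_not_top) auto
    then have "summable (\<lambda>k. G k x)"
      by (rule summable_norm_cancel)
    then have "convergent (\<lambda>n. \<Sum>k<n. G k x)"
      by (simp add: summable_iff_convergent)
    moreover have "(\<Sum>k<n. G k x) = F (r n) x - F (r 0) x" for n
      unfolding G_def by (rule sum_lessThan_telescope)
    ultimately have "convergent (\<lambda>n. (F (r n) x - F (r 0) x) + F (r 0) x)"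
      by (intro convergent_add convergent_const) simp
    then show ?case
      by simp
  qed
  \<comment> \<open>\<open>lim\<close> is total, so \<open>f\<close> is measurable everywhere; its
    value matters only where the subsequence converges.\<close>
  define f where "f x = lim (\<lambda>k. F (r k) x)" for x
  have [measurable]: "f \<in> borel_measurable M"
    unfolding f_def by measurable
  have lim: "AE x in M. (\<lambda>k. F (r k) x) \<longlonglongrightarrow> f x"
    using conv by eventually_elim (simp add: f_def convergent_LIMSEQ_iff)
  have r_ge: "r k \<ge> k" for k
    by (simp add: r_def)
  \<comment> \<open>With \<open>n\<close> fixed, a bound on the distances from \<open>F n\<close> to
    all late members survives the passage along the subsequence to \<open>f\<close>.\<close>
  have Fatou: "(\<integral>\<^sup>+x. ennreal ((norm (f x - F n x))\<^sup>2) \<partial>M) \<le> ennreal (e\<^sup>2)"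
    if e: "\<And>m. m \<ge> N \<Longrightarrow> l2norm M (\<lambda>x. F m x - F n x) \<le> e" for N n e
  proof -
    have "(\<integral>\<^sup>+x. ennreal ((norm (f x - F n x))\<^sup>2) \<partial>M)
        = (\<integral>\<^sup>+x. liminf (\<lambda>k. ennreal ((norm (F (r k) x - F n x))\<^sup>2)) \<partial>M)"
    proof (rule nn_integral_cong_AE)
      show "AE x in M. ennreal ((norm (f x - F n x))\<^sup>2) = liminf (\<lambda>k. ennreal ((norm (F (r k) x - F n x))\<^sup>2))"
        using lim
      proof eventually_elim
        case (elim x)
        then have "(\<lambda>k. ennreal ((norm (F (r k) x - F n x))\<^sup>2)) \<longlonglongrightarrow> ennreal ((norm (f x - F n x))\<^sup>2)"
          by (intro tendsto_intros tendsto_ennrealI)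
        then show ?case
          by (rule lim_imp_Liminf[symmetric, rotated]) simp
      qed
    qed
    also have "\<dots> \<le> liminf (\<lambda>k. \<integral>\<^sup>+x. ennreal ((norm (F (r k) x - F n x))\<^sup>2) \<partial>M)"
      by (rule nn_integral_liminf) auto
    also have "\<dots> \<le> ennreal (e\<^sup>2)"
    proof (rule Liminf_le)
      show "\<forall>\<^sub>F k in sequentially. (\<integral>\<^sup>+x. ennreal ((norm (F (r k) x - F n x))\<^sup>2) \<partial>M) \<le> ennreal (e\<^sup>2)"
        using eventually_ge_at_top[of N]
      proof eventually_elim
        case (elim k)
        have "(\<integral>\<^sup>+x. ennreal ((norm (F (r k) x - F n x))\<^sup>2) \<partial>M) = ennreal ((l2norm M (\<lambda>x. F (r k) x - F n x))\<^sup>2)"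
          by (simp add: l2norm_power2 nn_integral_eq_integral square_integrableD[OF square_integrable_diff[OF F F]])
        also have "\<dots> \<le> ennreal (e\<^sup>2)"
          using e[of "r k"] r_ge[of k] elim by (intro ennreal_leI power_mono) auto
        finally show ?case .
      qed
    qed simp
    finally show ?thesis .
  qed
  have sq: "square_integrable M (\<lambda>x. f x - F n x) \<and> l2norm M (\<lambda>x. f x - F n x) \<le> e"
    if e: "\<And>m. m \<ge> N \<Longrightarrow> l2norm M (\<lambda>x. F m x - F n x) \<le> e" for N n e
  proof
    have Fa: "(\<integral>\<^sup>+x. ennreal ((norm (f x - F n x))\<^sup>2) \<partial>M) \<le> ennreal (e\<^sup>2)"
      by (rule Fatou[of N]) (rule e)
    have fin: "integrable M (\<lambda>x. (norm (f x - F n x))\<^sup>2)"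
    proof (rule integrableI_bounded)
      have "(\<integral>\<^sup>+x. ennreal ((norm (f x - F n x))\<^sup>2) \<partial>M) < \<infinity>"
        using le_less_trans[OF Fa ennreal_less_top] by simp
      then show "(\<integral>\<^sup>+x. ennreal (norm ((norm (f x - F n x))\<^sup>2)) \<partial>M) < \<infinity>"
        by simp
    qed auto
    then show "square_integrable M (\<lambda>x. f x - F n x)"
      by (simp add: square_integrable_def)
    have "0 \<le> e"
      using e[of N] l2norm_nonneg order_trans by blast
    have "ennreal ((l2norm M (\<lambda>x. f x - F n x))\<^sup>2) \<le> ennreal (e\<^sup>2)"
      using Fa fin by (simp add: l2norm_power2 nn_integral_eq_integral)
    then have "(l2norm M (\<lambda>x. f x - F n x))\<^sup>2 \<le> e\<^sup>2"
      by (metis ennreal_le_iff zero_le_power2)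
    then show "l2norm M (\<lambda>x. f x - F n x) \<le> e"
      using \<open>0 \<le> e\<close> by (rule power2_le_imp_le)
  qed
  \<comment> \<open>One member at finite distance from \<open>f\<close> is enough to put
    \<open>f\<close> itself into L^2.\<close>
  obtain N where "\<And>m. m \<ge> N \<Longrightarrow> l2norm M (\<lambda>x. F m x - F N x) \<le> 1"
    using Cauchy[of 1] by (meson less_imp_le order_refl zero_less_one)
  then have "square_integrable M (\<lambda>x. f x - F N x)"
    using sq[of N N 1] by blast
  from square_integrable_add[OF this F[of N]] have "square_integrable M f"
    by simp
  moreover have "(\<lambda>n. l2norm M (\<lambda>x. f x - F n x)) \<longlonglongrightarrow> 0"
  proof (rule LIMSEQ_I)
    fix e :: real assume "0 < e"
    then obtain N where N: "\<And>m n. m \<ge> N \<Longrightarrow> n \<ge> N \<Longrightarrow> l2norm M (\<lambda>x. F m x - F n x) < e / 2"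
      using Cauchy[of "e / 2"] by auto
    have "norm (l2norm M (\<lambda>x. f x - F n x) - 0) < e" if "n \<ge> N" for n
    proof -
      have "l2norm M (\<lambda>x. f x - F n x) \<le> e / 2"
        using sq[of N n "e / 2"] N[OF _ that] by (simp add: less_imp_le)
      then show ?thesis
        using \<open>0 < e\<close> by simp
    qed
    then show "\<exists>N. \<forall>n\<ge>N. norm (l2norm M (\<lambda>x. f x - F n x) - 0) < e"
      by blast
  qed
  ultimately show ?thesis
    by (rule that)
qed

section \<open>Uniqueness of Fourier coefficients\<close>

text \<open>As a finite measure space of its own the interval falls under the L^2 lemmas above. The
  measure is not normalised: its total mass 2 pi is the source of the factors 2 pi below.\<close>

definition circ :: "real measure" where
  "circ = restrict_space lborel {-pi..pi}"

definition fchar :: "int \<Rightarrow> real \<Rightarrow> complex" where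
  "fchar k \<omega> = exp (\<i> * of_int k * of_real \<omega>)"

lemma space_circ [simp]: "space circ = {-pi..pi}"
  by (simp add: circ_def space_restrict_space)

lemma integrable_circ:
  fixes f :: "real \<Rightarrow> 'b::{banach, second_countable_topology}"
  shows "integrable circ f \<longleftrightarrow> set_integrable lborel {-pi..pi} f"
  unfolding circ_def by (simp add: set_integrable_eq)

lemma integral_circ:
  fixes f :: "real \<Rightarrow> 'b::{banach, second_countable_topology}"
  shows "integral\<^sup>L circ f = (LINT \<omega>:{-pi..pi}|lborel. f \<omega>)"
  unfolding circ_def set_lebesgue_integral_def by (simp add: integral_restrict_space)

lemma measurable_circ: "f \<in> borel_measurable lborel \<Longrightarrow> f \<in> borel_measurable circ"
  unfolding circ_def by (rule measurable_restrict_space1) simp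

lemma AE_circ: "(AE \<omega> in circ. P \<omega>) \<longleftrightarrow> (AE \<omega> in lborel. \<omega> \<in> {-pi..pi} \<longrightarrow> P \<omega>)"
  unfolding circ_def by (subst AE_restrict_space_iff) auto

interpretation circ: finite_measure circ
  by (rule finite_measureI) (simp add: circ_def emeasure_restrict_space space_restrict_space)

lemma measure_circ: "measure circ {-pi..pi} = 2 * pi"
  by (simp add: circ_def measure_restrict_space)

lemma fchar_0 [simp]: "fchar 0 \<omega> = 1"
  by (simp add: fchar_def)

lemma fchar_add: "fchar (j + k) \<omega> = fchar j \<omega> * fchar k \<omega>"
  by (simp add: fchar_def algebra_simps exp_add)

lemma norm_fchar [simp]: "cmod (fchar k \<omega>) = 1"
proof -
  have "fchar k \<omega> = exp (\<i> * of_real (of_int k * \<omega>))"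
    by (simp add: fchar_def mult.assoc)
  then show ?thesis
    using norm_exp_i_times by simp
qed

lemma cnj_fchar [simp]: "cnj (fchar k \<omega>) = fchar (- k) \<omega>"
  by (simp add: fchar_def exp_cnj)

lemma fchar_measurable [measurable]: "fchar k \<in> borel_measurable borel"
  unfolding fchar_def by measurable

lemma fchar_measurable_circ [measurable]: "fchar k \<in> borel_measurable circ"
  by (rule measurable_circ) simp

lemma integrable_fchar_mult:
  "integrable circ g \<Longrightarrow> integrable circ (\<lambda>\<omega>. fchar k \<omega> * g \<omega>)"
  by (rule Bochner_Integration.integrable_bound[where f = g]) (auto simp: norm_mult)

lemma integral_fchar: "(\<integral>\<omega>. fchar k \<omega> \<partial>circ) = (if k = 0 then of_real (2 * pi) else 0)"
proof (cases "k = 0")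
  case True
  then show ?thesis
    by (simp add: measure_circ scaleR_conv_of_real)
next
  case False
  define F where "F \<omega> = fchar k \<omega> / (\<i> * of_int k)" for \<omega>
  have "(F has_vector_derivative fchar k \<omega>) (at \<omega> within {-pi..pi})" for \<omega>
  proof -
    have "((\<lambda>z. exp (\<i> * of_int k * z) / (\<i> * of_int k)) has_field_derivative exp (\<i> * of_int k * of_real \<omega>))
            (at (of_real \<omega>))"
      using False by (auto intro!: derivative_eq_intros)
    then have "((\<lambda>\<omega>. exp (\<i> * of_int k * of_real \<omega>) / (\<i> * of_int k)) has_vector_derivative
            exp (\<i> * of_int k * of_real \<omega>)) (at \<omega>)"
      by (rule has_vector_derivative_real_field)
    then show ?thesis
      unfolding F_def[abs_def] fchar_def by (rule has_vector_derivative_at_within)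
  qed
  moreover have "continuous_on {-pi..pi} (fchar k)"
    unfolding fchar_def by (intro continuous_intros)
  ultimately have "(\<integral>\<omega>. fchar k \<omega> \<partial>circ) = F pi - F (-pi)"
    unfolding integral_circ set_lebesgue_integral_def
    by (intro integral_FTC_Icc) auto
  also have "fchar k pi = fchar k (-pi)"
  proof -
    have "fchar k \<omega> = cis (of_int k * \<omega>)" for \<omega>
      by (simp add: fchar_def cis_conv_exp mult.assoc)
    then show ?thesis
      by (simp add: complex_eq_iff mult.commute[of _ pi])
  qed
  then have "F pi - F (-pi) = 0"
    by (simp add: F_def)
  finally show ?thesis
    using False by simp
qed

section \<open>From vanishing coefficients to vanishing almost everywhere\<close>

text \<open>This class is stable under multiplication by characters, so the composition of a polynomial function with \<open>cis\<close>
  can be treated by induction on the polynomial, without expanding it as a trigonometric polynomial.\<close>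

definition null_fourier :: "(real \<Rightarrow> complex) \<Rightarrow> bool" where
  "null_fourier g \<longleftrightarrow> integrable circ g \<and> (\<forall>k. (\<integral>\<omega>. fchar k \<omega> * g \<omega> \<partial>circ) = 0)"

lemma null_fourier_fchar: "null_fourier g \<Longrightarrow> null_fourier (\<lambda>\<omega>. fchar k \<omega> * g \<omega>)"
  unfolding null_fourier_def
  by (auto simp: integrable_fchar_mult simp flip: mult.assoc fchar_add)

lemma null_fourier_add:
  "null_fourier f \<Longrightarrow> null_fourier g \<Longrightarrow> null_fourier (\<lambda>\<omega>. f \<omega> + g \<omega>)"
  unfolding null_fourier_def by (auto simp: distrib_left integrable_fchar_mult)

lemma null_fourier_cmult: "null_fourier f \<Longrightarrow> null_fourier (\<lambda>\<omega>. c * f \<omega>)"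
  unfolding null_fourier_def by (auto simp: mult.left_commute[of _ c])

lemma cis_fchar: "cis \<omega> = fchar 1 \<omega>"
  by (simp add: fchar_def cis_conv_exp)

text \<open>On the unit circle a real-linear form is a combination of the characters 1 and -1, under
  which the class is stable. In the product case the induction hypothesis for \<open>p\<close> is
  used at \<open>g\<close> already multiplied by \<open>q\<close>, hence the generalisation over
  \<open>g\<close>.\<close>

lemma null_fourier_polynomial:
  assumes "real_polynomial_function p" "null_fourier g"
  shows "null_fourier (\<lambda>\<omega>. of_real (p (cis \<omega>)) * g \<omega>)"
  using assms
proof (induction p arbitrary: g rule: real_polynomial_function.induct)
  case (linear p)
  then interpret bounded_linear p by simp
  \<comment> \<open>Substitute cos = (z + 1/z)/2 and sin = (z - 1/z)/(2i) with z =
    \<open>cis \<omega>\<close> into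
    \<open>cos \<omega> * p 1 + sin \<omega> * p \<i>\<close>.\<close>
  have p: "of_real (p (cis \<omega>)) = (of_real (p 1) / 2 + of_real (p \<i>) / (2 * \<i>)) * fchar 1 \<omega>
      + (of_real (p 1) / 2 - of_real (p \<i>) / (2 * \<i>)) * fchar (-1) \<omega>" for \<omega>
  proof -
    have "cis \<omega> = cos \<omega> *\<^sub>R 1 + sin \<omega> *\<^sub>R \<i>"
      by (simp add: complex_eq_iff)
    then have 1: "p (cis \<omega>) = cos \<omega> * p 1 + sin \<omega> * p \<i>"
      by (metis add scale real_scaleR_def)
    have 2: "fchar 1 \<omega> = of_real (cos \<omega>) + \<i> * of_real (sin \<omega>)"
      by (simp add: cis_fchar[symmetric] complex_eq_iff)
    have 3: "fchar (-1) \<omega> = of_real (cos \<omega>) - \<i> * of_real (sin \<omega>)"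
      using cnj_fchar[of 1 \<omega>] by (simp add: cis_fchar[symmetric] complex_eq_iff)
    show ?thesis
      unfolding 1 2 3 by (simp add: field_simps)
  qed
  show ?case
    unfolding p distrib_right mult.assoc
    by (intro null_fourier_add null_fourier_cmult null_fourier_fchar linear.prems)
next
  case (const c)
  then show ?case
    by (intro null_fourier_cmult)
next
  case (add p q)
  then show ?case
    by (simp add: distrib_right null_fourier_add)
next
  case (mult p q)
  then show ?case
    by (simp add: mult.assoc)
qed

text \<open>Stone--Weierstrass on the circle: replacing \<open>F\<close> by a polynomial within
  \<open>e\<close> changes the integral by at most \<open>e\<close> times the L^1 norm of
  \<open>g\<close>.\<close>

lemma null_fourier_continuous:
  fixes F :: "complex \<Rightarrow> real"
  assumes F: "continuous_on UNIV F" and g: "null_fourier g"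
  shows "(\<integral>\<omega>. of_real (F (cis \<omega>)) * g \<omega> \<partial>circ) = 0"
proof -
  have gi: "integrable circ g"
    using g by (simp add: null_fourier_def)
  have cism: "cis \<in> borel_measurable circ"
    using fchar_measurable_circ[of 1] by (simp add: cis_fchar[abs_def])
  have meas: "(\<lambda>\<omega>. H (cis \<omega>)) \<in> borel_measurable circ" if "continuous_on UNIV H" for H :: "complex \<Rightarrow> real"
    by (rule borel_measurable_continuous_on[OF that cism])
  define I where "I = (\<integral>\<omega>. norm (g \<omega>) \<partial>circ)"
  have I: "I \<ge> 0"
    by (simp add: I_def)
  have bound: "cmod (\<integral>\<omega>. of_real (F (cis \<omega>)) * g \<omega> \<partial>circ) \<le> e * I" if "0 < e" for e
  proof -
    obtain p where p: "real_polynomial_function p" "\<And>z. z \<in> sphere 0 1 \<Longrightarrow> \<bar>F z - p z\<bar> < e"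
      using Stone_Weierstrass_real_polynomial_function[of "sphere 0 1" F e] F \<open>0 < e\<close>
      by (metis compact_sphere continuous_on_subset subset_UNIV)
    have pc: "continuous_on UNIV p"
      using p(1) continuous_on_polymonial_function real_polynomial_function_eq by blast
    have pe: "\<bar>F (cis \<omega>) - p (cis \<omega>)\<bar> \<le> e" for \<omega>
      using p(2)[of "cis \<omega>"] by simp
    have np: "null_fourier (\<lambda>\<omega>. of_real (p (cis \<omega>)) * g \<omega>)"
      using p(1) g by (rule null_fourier_polynomial)
    then have ip: "integrable circ (\<lambda>\<omega>. of_real (p (cis \<omega>)) * g \<omega>)"
        and zp: "(\<integral>\<omega>. of_real (p (cis \<omega>)) * g \<omega> \<partial>circ) = 0"
      using fchar_0 by (auto simp: null_fourier_def dest: spec[of _ 0])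
    have [measurable]: "(\<lambda>\<omega>. F (cis \<omega>)) \<in> borel_measurable circ" "(\<lambda>\<omega>. p (cis \<omega>)) \<in> borel_measurable circ"
      "g \<in> borel_measurable circ"
      using meas F pc gi by auto
    have "integrable circ (\<lambda>\<omega>. e * norm (g \<omega>))"
      using gi by simp
    then have id: "integrable circ (\<lambda>\<omega>. of_real (F (cis \<omega>) - p (cis \<omega>)) * g \<omega>)"
    proof (rule Bochner_Integration.integrable_bound)
      show "AE \<omega> in circ. norm (of_real (F (cis \<omega>) - p (cis \<omega>)) * g \<omega>) \<le> norm (e * norm (g \<omega>))"
        using pe \<open>0 < e\<close> by (intro AE_I2) (simp add: norm_mult mult_right_mono del: of_real_diff)
    qed measurable
    have "(\<integral>\<omega>. of_real (F (cis \<omega>)) * g \<omega> \<partial>circ)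
        = (\<integral>\<omega>. of_real (F (cis \<omega>) - p (cis \<omega>)) * g \<omega> + of_real (p (cis \<omega>)) * g \<omega> \<partial>circ)"
      by (simp add: algebra_simps)
    also have "\<dots> = (\<integral>\<omega>. of_real (F (cis \<omega>) - p (cis \<omega>)) * g \<omega> \<partial>circ)"
      using zp by (subst Bochner_Integration.integral_add[OF id ip]) simp
    also have "cmod \<dots> \<le> (\<integral>\<omega>. norm (of_real (F (cis \<omega>) - p (cis \<omega>)) * g \<omega>) \<partial>circ)"
      by (rule integral_norm_bound)
    also have "\<dots> \<le> (\<integral>\<omega>. e * norm (g \<omega>) \<partial>circ)"
      by (rule integral_mono[OF integrable_norm[OF id]]) (use gi pe in \<open>auto simp: norm_mult mult_right_mono simp del: of_real_diff\<close>)
    finally show ?thesis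
      by (simp add: I_def)
  qed
  have "cmod (\<integral>\<omega>. of_real (F (cis \<omega>)) * g \<omega> \<partial>circ) \<le> 0"
  proof (rule field_le_epsilon)
    fix e :: real assume "0 < e"
    \<comment> \<open>Dividing by \<open>I + 1\<close> instead of \<open>I\<close> also covers a
      function of L^1 norm 0.\<close>
    have "cmod (\<integral>\<omega>. of_real (F (cis \<omega>)) * g \<omega> \<partial>circ) \<le> e / (I + 1) * I"
      using I \<open>0 < e\<close> by (intro bound) simp
    also have "\<dots> \<le> 0 + e"
      using I \<open>0 < e\<close> by (simp add: field_simps)
    finally show "cmod (\<integral>\<omega>. of_real (F (cis \<omega>)) * g \<omega> \<partial>circ) \<le> 0 + e" .
  qed
  then show ?thesis
    by simp
qed

lemma null_fourier_closed:
  assumes C: "closed C" and g: "null_fourier g"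
  shows "(\<integral>\<omega>. indicator C (cis \<omega>) *\<^sub>R g \<omega> \<partial>circ) = 0"
\<comment> \<open>\<open>infdist\<close> to the empty set is 0, so the approximants below would be
  constantly 1 there.\<close>
proof (cases "C = {}")
  case True
  then show ?thesis by simp
next
  case False
  \<comment> \<open>Continuous tents over \<open>C\<close>: equal to 1 on \<open>C\<close>, and
    eventually 0 at each other point, whose distance to the closed set is positive.\<close>
  define F where "F n z = max 0 (1 - real n * infdist z C)" for n z
  have gi: "integrable circ g"
    using g by (simp add: null_fourier_def)
  have cism [measurable]: "cis \<in> borel_measurable circ"
    using fchar_measurable_circ[of 1] by (simp add: cis_fchar[abs_def])
  have [measurable]: "g \<in> borel_measurable circ" "C \<in> sets borel"
    using gi C by auto
  have Fc: "continuous_on UNIV (F n)" for n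
    unfolding F_def[abs_def] by (intro continuous_intros)
  have Fm [measurable]: "(\<lambda>\<omega>. F n (cis \<omega>)) \<in> borel_measurable circ" for n
    by (rule borel_measurable_continuous_on[OF Fc cism])
  have lim: "(\<lambda>n. F n z) \<longlonglongrightarrow> indicator C z" for z
  proof (cases "z \<in> C")
    case True
    then show ?thesis
      by (simp add: F_def)
  next
    case z: False
    then have pos: "infdist z C > 0"
      using C False by (metis in_closed_iff_infdist_zero infdist_nonneg less_eq_real_def)
    then obtain N where N: "1 < real N * infdist z C"
      using reals_Archimedean3 by blast
    have "F n z = 0" if "n \<ge> N" for n
    proof -
      have "real N * infdist z C \<le> real n * infdist z C"
        using that pos by (intro mult_right_mono) auto
      then show ?thesis
        using N by (simp add: F_def)
    qed
    then have "\<forall>\<^sub>F n in sequentially. F n z = 0"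
      using eventually_sequentially by blast
    then show ?thesis
      using z by (simp add: tendsto_eventually)
  qed
  have "(\<lambda>n. \<integral>\<omega>. F n (cis \<omega>) *\<^sub>R g \<omega> \<partial>circ) \<longlonglongrightarrow> (\<integral>\<omega>. indicator C (cis \<omega>) *\<^sub>R g \<omega> \<partial>circ)"
  proof (rule integral_dominated_convergence)
    show "integrable circ (\<lambda>\<omega>. norm (g \<omega>))"
      using gi by simp
    show "AE \<omega> in circ. (\<lambda>n. F n (cis \<omega>) *\<^sub>R g \<omega>) \<longlonglongrightarrow> indicator C (cis \<omega>) *\<^sub>R g \<omega>"
      by (intro AE_I2 tendsto_intros lim)
    have "\<bar>F n z\<bar> \<le> 1" for n z
      using infdist_nonneg[of z C] by (auto simp: F_def)
    then show "AE \<omega> in circ. norm (F n (cis \<omega>) *\<^sub>R g \<omega>) \<le> norm (g \<omega>)" for n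
      by (intro AE_I2) (simp add: mult_left_le_one_le)
  qed measurable
  moreover have "(\<integral>\<omega>. F n (cis \<omega>) *\<^sub>R g \<omega> \<partial>circ) = 0" for n
    using null_fourier_continuous[OF Fc g] by (simp add: scaleR_conv_of_real)
  ultimately show ?thesis
    by (simp add: LIMSEQ_const_iff)
qed

text \<open>Both -pi and pi are sent to -1, so one argument has to lie in the open interval while
  the other may be an endpoint.\<close>

lemma inj_cis: "cis a = cis b \<Longrightarrow> -pi < a \<Longrightarrow> a < pi \<Longrightarrow> -pi \<le> b \<Longrightarrow> b \<le> pi \<Longrightarrow> a = b"
proof -
  assume ab: "cis a = cis b" "-pi < a" "a < pi" "-pi \<le> b" "b \<le> pi"
  have Arg: "Arg (cis t) = t" if "-pi < t" "t \<le> pi" for t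
    using that by (intro cis_Arg_unique) simp_all
  show "a = b"
  proof (cases "b = -pi")
    case True
    have "cis (-pi) = cis pi"
      by (simp add: complex_eq_iff)
    then have "Arg (cis a) = Arg (cis pi)"
      unfolding ab(1) True by (rule arg_cong)
    then have "a = pi"
      unfolding Arg[OF ab(2) less_imp_le[OF ab(3)]] using Arg[of pi] by simp
    then show ?thesis
      using ab(3) by simp
  next
    case False
    then have "-pi < b"
      using ab(4) by simp
    have "Arg (cis a) = Arg (cis b)"
      unfolding ab(1) ..
    then show ?thesis
      unfolding Arg[OF ab(2) less_imp_le[OF ab(3)]] Arg[OF \<open>-pi < b\<close> ab(5)] .
  qed
qed

text \<open>Induction over Borel sets generated by compact intervals. An interval is traded for the
  closed arc it covers on the circle, to which \<open>null_fourier_closed\<close> applies.\<close>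

lemma null_fourier_borel:
  assumes "A \<in> sets borel" and g: "null_fourier g"
  shows "(\<integral>\<omega>. indicator A \<omega> *\<^sub>R g \<omega> \<partial>circ) = 0"
  using assms(1)
proof (induction rule: borel_set_induct)
  case empty
  then show ?case by simp
next
  case (interval a b)
  define C where "C = cis ` ({a..b} \<inter> {-pi..pi})"
  have "compact ({a..b} \<inter> {-pi..pi})"
    by (intro compact_Int_closed) auto
  then have "closed C"
    unfolding C_def by (intro compact_imp_closed compact_continuous_image continuous_intros)
  \<comment> \<open>At the two endpoints \<open>cis \<omega> \<in> C\<close> need not imply that
    \<omega> is in the interval, since they share their image; they form a null set.\<close>
  have "AE \<omega> in lborel. \<omega> \<noteq> -pi \<and> \<omega> \<noteq> pi"
    using AE_lborel_singleton[of "-pi"] AE_lborel_singleton[of pi] by (rule AE_conjI)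
  then have "AE \<omega> in circ. indicator {a..b} \<omega> *\<^sub>R g \<omega> = indicator C (cis \<omega>) *\<^sub>R g \<omega>"
    unfolding AE_circ
  proof eventually_elim
    case (elim \<omega>)
    show ?case
    proof
      assume \<omega>: "\<omega> \<in> {-pi..pi}"
      have inj: "\<omega> = \<omega>'" if "cis \<omega> = cis \<omega>'" "\<omega>' \<in> {-pi..pi}" for \<omega>'
      proof (rule inj_cis[OF that(1)])
        show "-pi < \<omega>" "\<omega> < pi" "-pi \<le> \<omega>'" "\<omega>' \<le> pi"
          using elim \<omega> that(2) by auto
      qed
      have "cis \<omega> \<in> C \<longleftrightarrow> \<omega> \<in> {a..b}"
      proof
        assume "cis \<omega> \<in> C"
        then obtain \<omega>' where "cis \<omega> = cis \<omega>'" "\<omega>' \<in> {a..b}" "\<omega>' \<in> {-pi..pi}"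
          unfolding C_def by (elim imageE IntE)
        then show "\<omega> \<in> {a..b}"
          using inj[of \<omega>'] by metis
      qed (use \<omega> in \<open>auto simp: C_def\<close>)
      then show "indicator {a..b} \<omega> *\<^sub>R g \<omega> = indicator C (cis \<omega>) *\<^sub>R g \<omega>"
        by (simp add: indicator_def)
    qed
  qed
  moreover have "g \<in> borel_measurable circ" "cis \<in> borel_measurable circ" "C \<in> sets borel"
    using g fchar_measurable_circ[of 1] \<open>closed C\<close> by (auto simp: null_fourier_def cis_fchar[abs_def])
  moreover have "(\<lambda>x::real. x) \<in> borel_measurable circ"
    by (rule measurable_circ) simp
  moreover from calculation have "(\<lambda>\<omega>. indicator C (cis \<omega>) :: real) \<in> borel_measurable circ"
    by (rule_tac measurable_compose[of cis circ borel]) auto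
  ultimately have "(\<integral>\<omega>. indicator {a..b} \<omega> *\<^sub>R g \<omega> \<partial>circ) = (\<integral>\<omega>. indicator C (cis \<omega>) *\<^sub>R g \<omega> \<partial>circ)"
    by (intro integral_cong_AE borel_measurable_scaleR) auto
  then show ?case
    using null_fourier_closed[OF \<open>closed C\<close> g] by simp
next
  case (compl A)
  \<comment> \<open>The coefficient at 0 says that the integral of \<open>g\<close> vanishes, which
    settles complements.\<close>
  have gi: "integrable circ g" and g0: "integral\<^sup>L circ g = 0"
    using g fchar_0 by (auto simp: null_fourier_def dest: spec[of _ 0])
  have "A \<inter> {-pi..pi} \<in> sets circ"
    using compl by (auto simp: circ_def sets_restrict_space)
  then have "integrable circ (\<lambda>\<omega>. indicator (A \<inter> {-pi..pi}) \<omega> *\<^sub>R g \<omega>)"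
    using gi by (rule integrable_mult_indicator)
  then have "integrable circ (\<lambda>\<omega>. indicator A \<omega> *\<^sub>R g \<omega>)"
    by (subst (asm) Bochner_Integration.integrable_cong[where g = "\<lambda>\<omega>. indicator A \<omega> *\<^sub>R g \<omega>"])
      (auto simp: indicator_def)
  then have "(\<integral>\<omega>. g \<omega> - indicator A \<omega> *\<^sub>R g \<omega> \<partial>circ) = 0"
    using gi g0 compl by simp
  moreover have "indicator (- A) \<omega> *\<^sub>R g \<omega> = g \<omega> - indicator A \<omega> *\<^sub>R g \<omega>" for \<omega>
    by (simp add: indicator_def)
  ultimately show ?case
    by simp
next
  case (union A)
  have gi: "integrable circ g"
    using g by (simp add: null_fourier_def)
  have eq: "(\<integral>\<omega>. indicator B \<omega> *\<^sub>R g \<omega> \<partial>circ) = set_lebesgue_integral circ (B \<inter> {-pi..pi}) g" for B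
    unfolding set_lebesgue_integral_def by (rule Bochner_Integration.integral_cong) (auto simp: indicator_def)
  have meas: "A i \<inter> {-pi..pi} \<in> sets circ" for i
    using union by (auto simp: circ_def sets_restrict_space)
  have "(LINT \<omega>:(\<Union>i. A i \<inter> {-pi..pi})|circ. g \<omega>) = (\<Sum>i. LINT \<omega>:(A i \<inter> {-pi..pi})|circ. g \<omega>)"
  proof (rule lebesgue_integral_countable_add)
    show "set_integrable circ (\<Union>i. A i \<inter> {-pi..pi}) g"
      unfolding set_integrable_def
      by (intro integrable_mult_indicator sets.countable_nat_UN gi) (use meas in auto)
  qed (use meas union.hyps(1) in \<open>auto simp: disjoint_family_on_def\<close>)
  then show ?case
    using union by (simp add: eq)
qed

text \<open>Uniqueness of Fourier coefficients: a function whose integral over every measurable set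
  is 0 is null.\<close>

lemma null_fourier_AE_0:
  assumes "null_fourier g"
  shows "AE \<omega> in circ. g \<omega> = 0"
proof (rule circ.density_zero)
  show "integrable circ g"
    using assms by (simp add: null_fourier_def)
  fix A assume "A \<in> sets circ"
  then have "A \<in> sets borel"
    by (auto simp: circ_def sets_restrict_space)
  then show "set_lebesgue_integral circ A g = 0"
    unfolding set_lebesgue_integral_def using assms by (rule null_fourier_borel)
qed

section \<open>Fourier series in \<open>H\<^sup>2\<close>\<close>

lemma square_integrable_fchar: "square_integrable circ (fchar k)"
  unfolding square_integrable_def by simp

lemma square_integrable_fchar_mult:
  assumes "square_integrable circ g"
  shows "square_integrable circ (\<lambda>\<omega>. fchar t \<omega> * g \<omega>)"
proof (rule square_integrable_bound[OF assms, where C = 1])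
  show "(\<lambda>\<omega>. fchar t \<omega> * g \<omega>) \<in> borel_measurable circ"
    using square_integrable_measurable[OF assms] by measurable
qed (simp add: norm_mult)

lemma circ_integral_norm_le:
  assumes "square_integrable circ f"
  shows "(\<integral>\<omega>. norm (f \<omega>) \<partial>circ) \<le> sqrt (2 * pi) * l2norm circ f"
  using circ.square_integrable_imp_integrable_norm(2)[OF assms] by (simp add: measure_circ)

text \<open>Characters have modulus 1 and the measure is finite, so each Fourier coefficient is
  continuous for the L^2 seminorm. This gives access to the coefficients of an abstract
  limit.\<close>

lemma integral_fchar_diff_tendsto_0:
  assumes h: "square_integrable circ h" and S: "\<And>n. square_integrable circ (S n)"
    and lim: "(\<lambda>n. l2norm circ (\<lambda>\<omega>. h \<omega> - S n \<omega>)) \<longlonglongrightarrow> 0"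
  shows "(\<lambda>n. \<integral>\<omega>. fchar k \<omega> * S n \<omega> \<partial>circ) \<longlonglongrightarrow> (\<integral>\<omega>. fchar k \<omega> * h \<omega> \<partial>circ)"
proof -
  note int = integrable_fchar_mult[OF circ.square_integrable_imp_integrable_norm(1)]
  have "(\<lambda>n. sqrt (2 * pi) * l2norm circ (\<lambda>\<omega>. h \<omega> - S n \<omega>)) \<longlonglongrightarrow> 0"
    using tendsto_mult_left[OF lim, of "sqrt (2 * pi)"] by simp
  then have "(\<lambda>n. (\<integral>\<omega>. fchar k \<omega> * h \<omega> \<partial>circ) - (\<integral>\<omega>. fchar k \<omega> * S n \<omega> \<partial>circ)) \<longlonglongrightarrow> 0"
  proof (rule Lim_null_comparison[rotated], intro always_eventually allI)
    fix n
    have "(\<integral>\<omega>. fchar k \<omega> * h \<omega> \<partial>circ) - (\<integral>\<omega>. fchar k \<omega> * S n \<omega> \<partial>circ)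
        = (\<integral>\<omega>. fchar k \<omega> * (h \<omega> - S n \<omega>) \<partial>circ)"
      unfolding right_diff_distrib by (rule Bochner_Integration.integral_diff[symmetric]) (intro int h S)+
    also have "norm \<dots> \<le> (\<integral>\<omega>. norm (fchar k \<omega> * (h \<omega> - S n \<omega>)) \<partial>circ)"
      by (rule integral_norm_bound)
    also have "\<dots> \<le> sqrt (2 * pi) * l2norm circ (\<lambda>\<omega>. h \<omega> - S n \<omega>)"
      using circ_integral_norm_le[OF square_integrable_diff[OF h S[of n]]] by (simp add: norm_mult)
    finally show "norm ((\<integral>\<omega>. fchar k \<omega> * h \<omega> \<partial>circ) - (\<integral>\<omega>. fchar k \<omega> * S n \<omega> \<partial>circ))
        \<le> sqrt (2 * pi) * l2norm circ (\<lambda>\<omega>. h \<omega> - S n \<omega>)" .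
  qed
  from tendsto_diff[OF tendsto_const[of "\<integral>\<omega>. fchar k \<omega> * h \<omega> \<partial>circ"] this] show ?thesis
    by simp
qed

lemma trig_integral_fchar:
  assumes "finite J"
  shows "(\<integral>\<omega>. fchar k \<omega> * (\<Sum>j\<in>J. c j * fchar (- int j) \<omega>) \<partial>circ)
    = (\<Sum>j\<in>J. if k = int j then of_real (2 * pi) * c j else 0)"
proof -
  have "fchar k \<omega> * (\<Sum>j\<in>J. c j * fchar (- int j) \<omega>) = (\<Sum>j\<in>J. c j * fchar (k - int j) \<omega>)" for \<omega>
    unfolding sum_distrib_left
  proof (intro sum.cong refl)
    fix j
    have "fchar (k - int j) \<omega> = fchar k \<omega> * fchar (- int j) \<omega>"
      using fchar_add[of k "- int j"] by simp
    then show "fchar k \<omega> * (c j * fchar (- int j) \<omega>) = c j * fchar (k - int j) \<omega>"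
      by simp
  qed
  moreover have "integrable circ (fchar k)" for k
    using circ.square_integrable_imp_integrable_norm(1)[OF square_integrable_fchar] .
  ultimately show ?thesis
    by (auto simp: integral_fchar mult_ac intro!: sum.cong)
qed

text \<open>Parseval for finite sums. The index set is arbitrary because both Bessel's inequality
  and the blocks \<open>{n..<m}\<close> of the Cauchy estimate rely on it.\<close>

lemma trig_l2norm:
  fixes c :: "nat \<Rightarrow> complex"
  assumes "finite J"
  shows "(l2norm circ (\<lambda>\<omega>. \<Sum>j\<in>J. c j * fchar (- int j) \<omega>))\<^sup>2 = 2 * pi * (\<Sum>j\<in>J. (cmod (c j))\<^sup>2)"
proof -
  define T where "T \<omega> = (\<Sum>j\<in>J. c j * fchar (- int j) \<omega>)" for \<omega>
  have sT: "square_integrable circ T"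
    unfolding T_def by (intro square_integrable_sum square_integrable_cmult square_integrable_fchar)
  have "complex_of_real ((l2norm circ T)\<^sup>2) = (\<integral>\<omega>. complex_of_real ((cmod (T \<omega>))\<^sup>2) \<partial>circ)"
    unfolding l2norm_power2 by (rule integral_of_real[OF square_integrableD[OF sT], symmetric])
  also have "\<dots> = (\<integral>\<omega>. (\<Sum>k\<in>J. cnj (c k) * (fchar (int k) \<omega> * T \<omega>)) \<partial>circ)"
  proof (intro Bochner_Integration.integral_cong refl)
    fix \<omega>
    have "complex_of_real ((cmod (T \<omega>))\<^sup>2) = cnj (T \<omega>) * T \<omega>"
      by (metis complex_norm_square mult.commute of_real_power)
    also have "cnj (T \<omega>) = (\<Sum>k\<in>J. cnj (c k) * fchar (int k) \<omega>)"
      by (simp add: T_def)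
    finally show "complex_of_real ((cmod (T \<omega>))\<^sup>2) = (\<Sum>k\<in>J. cnj (c k) * (fchar (int k) \<omega> * T \<omega>))"
      by (simp add: sum_distrib_right mult.assoc)
  qed
  also have "\<dots> = (\<Sum>k\<in>J. cnj (c k) * (\<integral>\<omega>. fchar (int k) \<omega> * T \<omega> \<partial>circ))"
  proof -
    have "integrable circ (\<lambda>\<omega>. fchar (int k) \<omega> * T \<omega>)" for k
      by (intro integrable_fchar_mult circ.square_integrable_imp_integrable_norm(1) sT)
    then show ?thesis
      by simp
  qed
  also have "\<dots> = (\<Sum>k\<in>J. of_real (2 * pi * (cmod (c k))\<^sup>2))"
  proof (rule sum.cong[OF refl])
    fix k assume "k \<in> J"
    then have "(\<integral>\<omega>. fchar (int k) \<omega> * T \<omega> \<partial>circ) = of_real (2 * pi) * c k"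
      unfolding T_def trig_integral_fchar[OF assms] using assms by simp
    then show "cnj (c k) * (\<integral>\<omega>. fchar (int k) \<omega> * T \<omega> \<partial>circ) = of_real (2 * pi * (cmod (c k))\<^sup>2)"
      by (simp only: of_real_mult complex_norm_square mult_ac)
  qed
  finally have "(l2norm circ T)\<^sup>2 = (\<Sum>k\<in>J. 2 * pi * (cmod (c k))\<^sup>2)"
    unfolding of_real_sum[symmetric] of_real_eq_iff .
  then show ?thesis
    by (simp add: T_def[abs_def] sum_distrib_left)
qed

text \<open>Expand the squared distance from \<open>g\<close> to the trigonometric sum
  \<open>T\<close>: the inner product of \<open>g\<close> with \<open>T\<close> and the squared norm
  of \<open>T\<close> are the same number.\<close>

lemma bessel_inequality:
  assumes g: "square_integrable circ g"
    and c: "\<And>j. of_real (2 * pi) * c j = (\<integral>\<omega>. fchar (int j) \<omega> * g \<omega> \<partial>circ)"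
    and J: "finite J"
  shows "2 * pi * (\<Sum>j\<in>J. (cmod (c j))\<^sup>2) \<le> (l2norm circ g)\<^sup>2"
proof -
  define T where "T \<omega> = (\<Sum>j\<in>J. c j * fchar (- int j) \<omega>)" for \<omega>
  have sT: "square_integrable circ T"
    unfolding T_def by (intro square_integrable_sum square_integrable_cmult square_integrable_fchar)
  have gi: "integrable circ (\<lambda>\<omega>. fchar k \<omega> * g \<omega>)" for k
    by (intro integrable_fchar_mult circ.square_integrable_imp_integrable_norm(1) g)
  have gT: "g \<omega> * cnj (T \<omega>) = (\<Sum>j\<in>J. cnj (c j) * (fchar (int j) \<omega> * g \<omega>))" for \<omega>
    by (simp add: T_def sum_distrib_left mult_ac)
  have iT: "integrable circ (\<lambda>\<omega>. g \<omega> * cnj (T \<omega>))"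
    unfolding gT using gi by simp
  have "(\<integral>\<omega>. g \<omega> * cnj (T \<omega>) \<partial>circ) = (\<Sum>j\<in>J. cnj (c j) * (of_real (2 * pi) * c j))"
    unfolding gT using gi by (simp add: c[symmetric] del: of_real_mult)
  also have "\<dots> = (\<Sum>j\<in>J. of_real (2 * pi * (cmod (c j))\<^sup>2))"
    by (intro sum.cong refl) (simp only: of_real_mult complex_norm_square mult_ac)
  also have "\<dots> = of_real (2 * pi * (\<Sum>j\<in>J. (cmod (c j))\<^sup>2))"
    by (simp add: sum_distrib_left)
  finally have gTi: "Re (\<integral>\<omega>. g \<omega> * cnj (T \<omega>) \<partial>circ) = 2 * pi * (\<Sum>j\<in>J. (cmod (c j))\<^sup>2)"
    by (metis Re_complex_of_real)
  have "0 \<le> (\<integral>\<omega>. (cmod (g \<omega> - T \<omega>))\<^sup>2 \<partial>circ)"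
    by simp
  also have "\<dots> = (\<integral>\<omega>. (cmod (g \<omega>))\<^sup>2 - 2 * Re (g \<omega> * cnj (T \<omega>)) + (cmod (T \<omega>))\<^sup>2 \<partial>circ)"
    by (intro Bochner_Integration.integral_cong refl) (simp add: cmod_power2, simp add: power2_eq_square algebra_simps)
  also have "\<dots> = (l2norm circ g)\<^sup>2 - 2 * (2 * pi * (\<Sum>j\<in>J. (cmod (c j))\<^sup>2)) + (l2norm circ T)\<^sup>2"
    using square_integrableD[OF g] square_integrableD[OF sT] iT gTi
    by (simp add: l2norm_power2 integral_Re[OF iT] integrable_Re[OF iT] del: complex_cnj_cancel_iff times_complex.sel)
  also have "(l2norm circ T)\<^sup>2 = 2 * pi * (\<Sum>j\<in>J. (cmod (c j))\<^sup>2)"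
    using trig_l2norm[OF J] by (simp add: T_def[abs_def])
  finally show ?thesis
    by simp
qed

text \<open>Bessel makes the partial sums Cauchy, completeness yields a limit, and the limit has all
  coefficients of \<open>g\<close>: those of nonnegative powers of
  \<open>exp (- \<i> * \<omega>)\<close> by construction, the others because \<open>neg\<close>
  makes them 0 on both sides. Uniqueness concludes.\<close>

lemma fourier_series_H2:
  assumes g: "square_integrable circ g"
    and neg: "\<And>k::int. k > 0 \<Longrightarrow> (\<integral>\<omega>. fchar (-k) \<omega> * g \<omega> \<partial>circ) = 0"
    and c: "\<And>j. of_real (2 * pi) * c j = (\<integral>\<omega>. fchar (int j) \<omega> * g \<omega> \<partial>circ)"
  shows "(\<lambda>N. l2norm circ (\<lambda>\<omega>. g \<omega> - (\<Sum>j<N. c j * fchar (- int j) \<omega>))) \<longlonglongrightarrow> 0"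
proof -
  define S where "S N \<omega> = (\<Sum>j<N. c j * fchar (- int j) \<omega>)" for N \<omega>
  have S: "square_integrable circ (S N)" for N
    unfolding S_def by (intro square_integrable_sum square_integrable_cmult square_integrable_fchar)
  have sum: "summable (\<lambda>j. (cmod (c j))\<^sup>2)"
  proof (rule summableI_nonneg_bounded)
    show "(\<Sum>j<n. (cmod (c j))\<^sup>2) \<le> (l2norm circ g)\<^sup>2 / (2 * pi)" for n
      using bessel_inequality[OF g c, of "{..<n}"] by (simp add: field_simps)
  qed simp
  have Cauchy: "\<exists>N. \<forall>m\<ge>N. \<forall>n. (\<Sum>j=m..<n. (cmod (c j))\<^sup>2) < e" if "0 < e" for e
  proof -
    obtain N where "\<And>m n. m \<ge> N \<Longrightarrow> norm (\<Sum>j=m..<n. (cmod (c j))\<^sup>2) < e"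
      using sum \<open>0 < e\<close> unfolding summable_Cauchy by blast
    then have "(\<Sum>j=m..<n. (cmod (c j))\<^sup>2) < e" if "m \<ge> N" for m n
      using that by (metis abs_ge_self le_less_trans real_norm_def)
    then show ?thesis
      by blast
  qed
  have dist: "(l2norm circ (\<lambda>\<omega>. S m \<omega> - S n \<omega>))\<^sup>2 = 2 * pi * (\<Sum>j=n..<m. (cmod (c j))\<^sup>2)" if "n \<le> m" for m n
  proof -
    have "S m \<omega> - S n \<omega> = (\<Sum>j=n..<m. c j * fchar (- int j) \<omega>)" for \<omega>
      using that by (simp add: S_def lessThan_atLeast0 sum_diff_nat_ivl)
    then show ?thesis
      using trig_l2norm[of "{n..<m}" c] by simp
  qed
  obtain h where h: "square_integrable circ h" and lim: "(\<lambda>n. l2norm circ (\<lambda>\<omega>. h \<omega> - S n \<omega>)) \<longlonglongrightarrow> 0"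
  proof (rule circ.l2_complete[of S, OF S])
    fix e :: real assume "0 < e"
    \<comment> \<open>The divisor 2 pi offsets the factor in Parseval's identity.\<close>
    then obtain N where N: "\<And>m n. m \<ge> N \<Longrightarrow> (\<Sum>j=m..<n. (cmod (c j))\<^sup>2) < e\<^sup>2 / (2 * pi)"
      using Cauchy[of "e\<^sup>2 / (2 * pi)"] by auto
    have le: "l2norm circ (\<lambda>\<omega>. S m \<omega> - S n \<omega>) < e" if "N \<le> n" "n \<le> m" for m n
    proof -
      have "(l2norm circ (\<lambda>\<omega>. S m \<omega> - S n \<omega>))\<^sup>2 < e\<^sup>2"
        unfolding dist[OF that(2)] using N[OF that(1), of m] by (simp add: field_simps)
      then show ?thesis
        using \<open>0 < e\<close> by (intro power2_less_imp_less[of _ e]) auto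
    qed
    show "\<exists>N. \<forall>m\<ge>N. \<forall>n\<ge>N. l2norm circ (\<lambda>\<omega>. S m \<omega> - S n \<omega>) < e"
    proof (intro exI allI impI)
      fix m n assume mn: "N \<le> m" "N \<le> n"
      show "l2norm circ (\<lambda>\<omega>. S m \<omega> - S n \<omega>) < e"
      proof (cases "n \<le> m")
        case True
        then show ?thesis
          using le mn by simp
      next
        case False
        then show ?thesis
          using le[of m n] mn by (simp add: l2norm_commute[of circ "S m"])
      qed
    qed
  qed
  have coeff: "(\<integral>\<omega>. fchar k \<omega> * h \<omega> \<partial>circ) = (\<integral>\<omega>. fchar k \<omega> * g \<omega> \<partial>circ)" for k
  proof -
    \<comment> \<open>Each coefficient of the partial sums is eventually constant, from the index at
      which term \<open>k\<close> has been included. For negative \<open>k\<close> the threshold is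
      0 and no term contributes.\<close>
    have "(\<integral>\<omega>. fchar k \<omega> * S n \<omega> \<partial>circ) = (\<integral>\<omega>. fchar k \<omega> * g \<omega> \<partial>circ)" if "n > nat k" for n
    proof (cases "k \<ge> 0")
      case True
      then have k: "int (nat k) = k"
        by simp
      have "(\<integral>\<omega>. fchar k \<omega> * S n \<omega> \<partial>circ) = (\<Sum>j<n. if nat k = j then of_real (2 * pi) * c j else 0)"
        unfolding S_def trig_integral_fchar[OF finite_lessThan] using True by (intro sum.cong) auto
      also have "\<dots> = of_real (2 * pi) * c (nat k)"
        using that by simp
      finally show ?thesis
        unfolding c k .
    next
      case False
      then have "(\<integral>\<omega>. fchar k \<omega> * S n \<omega> \<partial>circ) = 0"
        unfolding S_def trig_integral_fchar[OF finite_lessThan] by (intro sum.neutral) auto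
      then show ?thesis
        using neg[of "-k"] False by simp
    qed
    then have "\<forall>\<^sub>F n in sequentially. (\<integral>\<omega>. fchar k \<omega> * S n \<omega> \<partial>circ) = (\<integral>\<omega>. fchar k \<omega> * g \<omega> \<partial>circ)"
      using eventually_gt_at_top[of "nat k"] by (rule eventually_mono[rotated])
    from LIMSEQ_unique[OF integral_fchar_diff_tendsto_0[OF h S lim] tendsto_eventually[OF this]] show ?thesis .
  qed
  have gi: "integrable circ (\<lambda>\<omega>. fchar k \<omega> * g \<omega>)" and hi: "integrable circ (\<lambda>\<omega>. fchar k \<omega> * h \<omega>)" for k
    by (intro integrable_fchar_mult circ.square_integrable_imp_integrable_norm(1) g h)+
  have "null_fourier (\<lambda>\<omega>. g \<omega> - h \<omega>)"
    unfolding null_fourier_def right_diff_distrib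
    using gi hi coeff circ.square_integrable_imp_integrable_norm(1)[OF square_integrable_diff[OF g h]] by simp
  then have "AE \<omega> in circ. g \<omega> - h \<omega> = 0"
    by (rule null_fourier_AE_0)
  then have AE: "AE \<omega> in circ. g \<omega> = h \<omega>"
    by simp
  have "l2norm circ (\<lambda>\<omega>. g \<omega> - S n \<omega>) = l2norm circ (\<lambda>\<omega>. h \<omega> - S n \<omega>)" for n
    unfolding l2norm_def
  proof (intro arg_cong[of _ _ sqrt] integral_cong_AE)
    show "AE \<omega> in circ. (cmod (g \<omega> - S n \<omega>))\<^sup>2 = (cmod (h \<omega> - S n \<omega>))\<^sup>2"
      using AE by eventually_elim simp
  qed (use square_integrableD[OF square_integrable_diff[OF g S]] square_integrableD[OF square_integrable_diff[OF h S]] in auto)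
  then show ?thesis
    using lim by (simp add: S_def)
qed

section \<open>Moore--Penrose inverses and matrix Fourier series\<close>

lemma cadj_mult: "cadj (A ** B) = cadj B ** cadj A"
  by (simp add: cadj_def matrix_matrix_mult_def vec_eq_iff mult.commute)

lemma cadj_cadj [simp]: "cadj (cadj A) = A"
  by (simp add: cadj_def vec_eq_iff)

lemma cadj_mat_1 [simp]: "cadj (mat 1) = mat 1"
  by (simp add: cadj_def mat_def vec_eq_iff)

text \<open>The squared length of \<open>A *v x\<close> is the inner product of \<open>x\<close>
  with \<open>(cadj A ** A) *v x\<close>.\<close>

lemma gram_kernel:
  fixes A :: "complex^'r^'d"
  assumes "(cadj A ** A) *v x = 0"
  shows "A *v x = 0"
proof -
  define y where "y = A *v x"
  have "cadj A *v y = 0"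
    using assms by (simp add: y_def matrix_vector_mul_assoc)
  then have z: "(\<Sum>i\<in>UNIV. cnj (A $ i $ j) * y $ i) = 0" for j
    by (simp add: vec_eq_iff matrix_vector_mult_def cadj_def)
  have "complex_of_real (\<Sum>i\<in>UNIV. (cmod (y $ i))\<^sup>2) = (\<Sum>i\<in>UNIV. cnj (y $ i) * y $ i)"
    unfolding of_real_sum by (intro sum.cong refl) (simp only: complex_norm_square mult.commute)
  also have "\<dots> = (\<Sum>i\<in>UNIV. \<Sum>j\<in>UNIV. cnj (x $ j) * (cnj (A $ i $ j) * y $ i))"
  proof (intro sum.cong refl)
    fix i
    have "cnj (y $ i) = (\<Sum>j\<in>UNIV. cnj (x $ j) * cnj (A $ i $ j))"
      by (simp add: y_def matrix_vector_mult_def mult.commute)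
    then show "cnj (y $ i) * y $ i = (\<Sum>j\<in>UNIV. cnj (x $ j) * (cnj (A $ i $ j) * y $ i))"
      by (simp add: sum_distrib_right mult.assoc)
  qed
  also have "\<dots> = (\<Sum>j\<in>UNIV. cnj (x $ j) * (\<Sum>i\<in>UNIV. cnj (A $ i $ j) * y $ i))"
    unfolding sum_distrib_left by (rule sum.swap)
  also have "\<dots> = 0"
    by (simp add: z)
  finally have "(\<Sum>i\<in>UNIV. (cmod (y $ i))\<^sup>2) = 0"
    by (simp only: of_real_eq_0_iff)
  then have "y = 0"
    by (simp add: sum_nonneg_eq_0_iff vec_eq_iff)
  then show ?thesis
    by (simp add: y_def)
qed

text \<open>\<open>MP_inverse\<close> is a definite description, so both a solution of the Penrose
  equations and its uniqueness are required. Left invertibility makes the Gram matrix invertible,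
  and this supplies the solution.\<close>

lemma MP_inverse_left_inverse:
  fixes A :: "complex^'r^'d"
  assumes L: "L ** A = mat 1"
  shows "MP_inverse A ** A = mat 1"
proof -
  define G where "G = cadj A ** A"
  have "x = 0" if "G *v x = 0" for x
  proof -
    have "A *v x = 0"
      using that unfolding G_def by (rule gram_kernel)
    then have "(L ** A) *v x = 0"
      by (simp flip: matrix_vector_mul_assoc)
    then show "x = 0"
      by (simp add: L)
  qed
  then obtain K where KG: "K ** G = mat 1"
    using matrix_left_invertible_ker[of G] by blast
  then have GK: "G ** K = mat 1"
    by (simp add: matrix_left_right_inverse)
  have hG: "cadj G = G"
    by (simp add: G_def cadj_mult)
  \<comment> \<open>Taking adjoints in \<open>G ** K = mat 1\<close> makes \<open>cadj K\<close> a
    left inverse of the Hermitian \<open>G\<close>; inverses being unique, \<open>K\<close> is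
    Hermitian.\<close>
  have "cadj K ** G = mat 1"
    using arg_cong[OF GK, of cadj] by (simp add: cadj_mult hG)
  then have hK: "cadj K = K"
    by (metis GK matrix_mul_assoc matrix_mul_lid matrix_mul_rid)
  \<comment> \<open>The classical formula for full column rank: inverse Gram matrix times
    adjoint.\<close>
  define B where "B = K ** cadj A"
  have BA: "B ** A = mat 1"
    using KG by (simp add: B_def G_def matrix_mul_assoc)
  have AB: "cadj (A ** B) = A ** B"
    by (simp add: B_def cadj_mult hK matrix_mul_assoc)
  have mp: "is_MP_inverse A B"
    unfolding is_MP_inverse_def using BA AB by (simp add: matrix_mul_assoc[symmetric])
  have "C = B" if C: "is_MP_inverse A C" for C
  proof -
    have "B ** (A ** C ** A) = B ** A"
      using C by (simp add: is_MP_inverse_def)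
    then have CA: "C ** A = mat 1"
      by (simp add: matrix_mul_assoc BA)
    \<comment> \<open>\<open>A ** B\<close> and \<open>A ** C\<close> are Hermitian and each absorbs
      the other from the right, so taking the adjoint of one product identifies them.\<close>
    have "A ** C = (A ** B) ** (A ** C)"
      by (metis BA matrix_mul_assoc matrix_mul_rid)
    then have "A ** C = cadj ((A ** C) ** (A ** B))"
      using C AB by (simp add: is_MP_inverse_def cadj_mult[of "A ** C"])
    also have "(A ** C) ** (A ** B) = A ** B"
      by (metis CA matrix_mul_assoc matrix_mul_rid)
    finally have "A ** C = A ** B"
      by (simp add: AB)
    then show "C = B"
      by (metis BA matrix_mul_assoc matrix_mul_lid)
  qed
  with mp have "MP_inverse A = B"
    unfolding MP_inverse_def by (rule the_equality)
  then show ?thesis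
    by (simp add: BA)
qed

text \<open>Every row of \<open>F\<close> is a combination of the rows of \<open>cadj A\<close>.
  These number \<open>CARD('r)\<close>, so rank \<open>CARD('r)\<close> forces them to be
  independent; a right inverse of \<open>cadj A\<close> is the adjoint of a left inverse of
  \<open>A\<close>.\<close>

lemma left_invertible_of_rank_gram:
  fixes A :: "complex^'r^'d" and F :: "complex^'d^'d"
  assumes F: "F = c *\<^sub>R (A ** cadj A)" and rank: "rank F = CARD('r)"
  shows "\<exists>L. L ** A = mat 1"
proof -
  define R where "R = cadj A"
  have row_F: "row i F = (\<Sum>l\<in>UNIV. (of_real c * A $ i $ l) *s row l R)" for i
    by (simp add: F R_def row_def vec_eq_iff matrix_matrix_mult_def sum_distrib_left mult.assoc
        scaleR_conv_of_real[where 'a = complex])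
  have "\<exists>B. R ** B = mat 1"
    unfolding matrix_right_invertible_independent_rows
  proof (intro allI impI, rule ccontr)
    fix a k
    assume sum0: "(\<Sum>i\<in>UNIV. a i *s row i R) = 0" and k: "a k \<noteq> 0"
    \<comment> \<open>In a dependence relation row \<open>k\<close> can be discarded, leaving fewer
      than \<open>CARD('r)\<close> vectors that span all rows of \<open>F\<close>.\<close>
    define W where "W = (\<lambda>i. row i R) ` (UNIV - {k})"
    have in_W: "row i R \<in> vec.span W" if "i \<noteq> k" for i
      using that by (intro vec.span_base) (auto simp: W_def)
    have "a k *s row k R = - (\<Sum>i\<in>UNIV - {k}. a i *s row i R)"
      using sum0 by (simp add: sum.remove[of UNIV k] eq_neg_iff_add_eq_0)
    also have "\<dots> \<in> vec.span W"
      using in_W by (intro vec.span_neg vec.span_sum vec.span_scale) auto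
    finally have "inverse (a k) *s (a k *s row k R) \<in> vec.span W"
      by (rule vec.span_scale)
    then have row_W: "row i R \<in> vec.span W" for i
      using k in_W[of i] by (cases "i = k") (auto simp: vector_smult_assoc)
    have "rows F \<subseteq> vec.span W"
      unfolding rows_def row_F by (auto intro!: vec.span_sum vec.span_scale row_W)
    then have "vec.dim (rows F) \<le> card W"
      by (rule vec.dim_le_card) (simp add: W_def)
    also have "\<dots> \<le> card (UNIV - {k} :: 'r set)"
      unfolding W_def by (rule card_image_le) simp
    also have "\<dots> < CARD('r)"
      by (rule psubset_card_mono) auto
    finally show False
      using rank by (simp add: row_rank_def_gen)
  qed
  then obtain B where "R ** B = mat 1" ..
  then have "cadj B ** A = mat 1"
    unfolding R_def by (metis cadj_cadj cadj_mat_1 cadj_mult)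
  then show ?thesis ..
qed

text \<open>Apply the matrix to the unit vector \<open>axis j 1\<close> and read off coordinate
  \<open>i\<close>.\<close>

lemma entry_le_spec_norm:
  fixes A :: "complex^'n^'m"
  shows "cmod (A $ i $ j) \<le> spec_norm A"
proof -
  have "linear ((*v) A)"
    by (rule linearI) (simp_all add: vec_eq_iff matrix_vector_mult_def scaleR_sum_right distrib_left sum.distrib)
  then have "bounded_linear ((*v) A)"
    by (simp add: linear_conv_bounded_linear)
  then have "norm (A *v axis j 1) \<le> spec_norm A * norm (axis j (1::complex))"
    unfolding spec_norm_def by (rule onorm)
  moreover have "(A *v axis j 1) $ i = A $ i $ j"
    by (simp add: matrix_vector_mult_def axis_def if_distrib cong: if_cong)
  ultimately show ?thesis
    using Finite_Cartesian_Product.norm_nth_le[of "A *v axis j 1" i] by (simp add: norm_axis_1)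
qed

lemma norm_vec_power2: "(norm (v :: complex^'n))\<^sup>2 = (\<Sum>i\<in>UNIV. (cmod (v $ i))\<^sup>2)"
  by (simp add: norm_vec_def L2_set_def sum_nonneg)

lemma norm_mat_power2: "(norm (A :: complex^'n^'m))\<^sup>2 = (\<Sum>i\<in>UNIV. \<Sum>j\<in>UNIV. (cmod (A $ i $ j))\<^sup>2)"
  by (simp add: norm_vec_def[of A] L2_set_def sum_nonneg norm_vec_power2)

section \<open>Fourier series of matrix functions\<close>

lemma L2_fun_square_integrable: "L2_fun g \<Longrightarrow> square_integrable circ g"
  unfolding L2_fun_def square_integrable_def integrable_circ using measurable_circ by auto

lemma H2_fun_fourier:
  assumes "H2_fun g"
    and c: "\<And>j. of_real (2 * pi) * c j = (\<integral>\<omega>. fchar (int j) \<omega> * g \<omega> \<partial>circ)"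
  shows "(\<lambda>N. l2norm circ (\<lambda>\<omega>. g \<omega> - (\<Sum>j<N. c j * fchar (- int j) \<omega>))) \<longlonglongrightarrow> 0"
proof (rule fourier_series_H2[OF _ _ c])
  show "square_integrable circ g"
    using assms(1) by (simp add: H2_fun_def L2_fun_square_integrable)
  show "(\<integral>\<omega>. fchar (-k) \<omega> * g \<omega> \<partial>circ) = 0" if "k > 0" for k
    using assms(1) that by (simp add: H2_fun_def integral_circ fchar_def)
qed

text \<open>With 2 pi multiplied out, this is the shape in which the scalar theorem expects its
  coefficients.\<close>

lemma fcoef_entry:
  "of_real (2 * pi) * fcoef g j $ a $ b = (\<integral>\<omega>. fchar (int j) \<omega> * g \<omega> $ a $ b \<partial>circ)"
  by (simp add: fcoef_def integral_circ fchar_def)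

text \<open>The body repeats the sum inside \<open>L2_fourier_series\<close> literally, so that
  unfolding it turns the norm estimates into that predicate.\<close>

definition fpartial :: "(nat \<Rightarrow> complex^'n^'m) \<Rightarrow> nat \<Rightarrow> real \<Rightarrow> complex^'n^'m" where
  "fpartial c N \<omega> = (\<Sum>j<N. cmscale (exp (- (\<i> * of_nat j * of_real \<omega>))) (c j))"

lemma fpartial_entry: "fpartial c N \<omega> $ a $ b = (\<Sum>j<N. c j $ a $ b * fchar (- int j) \<omega>)"
  by (simp add: fpartial_def cmscale_def fchar_def mult.commute)

lemma square_integrable_fpartial: "square_integrable circ (\<lambda>\<omega>. fpartial c N \<omega> $ a $ b)"
  unfolding fpartial_entry
  by (intro square_integrable_sum square_integrable_cmult square_integrable_fchar)

lemma H2_mat_square_integrable: "H2_mat g \<Longrightarrow> square_integrable circ (\<lambda>\<omega>. g \<omega> $ a $ b)"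
  by (simp add: H2_mat_def H2_fun_def L2_fun_square_integrable)

lemma H2_mat_fourier_entry:
  assumes "H2_mat g"
  shows "(\<lambda>N. l2norm circ (\<lambda>\<omega>. (g \<omega> - fpartial (fcoef g) N \<omega>) $ a $ b)) \<longlonglongrightarrow> 0"
proof -
  have "H2_fun (\<lambda>\<omega>. g \<omega> $ a $ b)"
    using assms by (simp add: H2_mat_def)
  from H2_fun_fourier[OF this fcoef_entry] show ?thesis
    by (simp add: fpartial_entry)
qed

lemma square_integrable_mat_diff:
  assumes "H2_mat g"
  shows "square_integrable circ (\<lambda>\<omega>. (g \<omega> - fpartial c N \<omega>) $ a $ b)"
  unfolding vector_minus_component
  by (intro square_integrable_diff H2_mat_square_integrable[OF assms] square_integrable_fpartial)

text \<open>The squared Frobenius norm is a finite sum over entries, so the scalar statements add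
  up.\<close>

lemma H2_mat_fourier_norm:
  assumes "H2_mat g"
  shows "integrable circ (\<lambda>\<omega>. (norm (g \<omega> - fpartial (fcoef g) N \<omega>))\<^sup>2)"
    and "(\<lambda>N. \<integral>\<omega>. (norm (g \<omega> - fpartial (fcoef g) N \<omega>))\<^sup>2 \<partial>circ) \<longlonglongrightarrow> 0"
proof -
  have int: "integrable circ (\<lambda>\<omega>. (cmod ((g \<omega> - fpartial (fcoef g) N \<omega>) $ a $ b))\<^sup>2)" for N a b
    by (rule square_integrableD[OF square_integrable_mat_diff[OF assms]])
  then show "integrable circ (\<lambda>\<omega>. (norm (g \<omega> - fpartial (fcoef g) N \<omega>))\<^sup>2)"
    unfolding norm_mat_power2 by (intro Bochner_Integration.integrable_sum)
  have "(\<lambda>N. \<Sum>a\<in>UNIV. \<Sum>b\<in>UNIV. \<integral>\<omega>. (cmod ((g \<omega> - fpartial (fcoef g) N \<omega>) $ a $ b))\<^sup>2 \<partial>circ) \<longlonglongrightarrow> 0"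
    using H2_mat_fourier_entry[OF assms] unfolding l2norm_tendsto_0_iff
    by (intro tendsto_null_sum)
  moreover have "(\<integral>\<omega>. (norm (g \<omega> - fpartial (fcoef g) N \<omega>))\<^sup>2 \<partial>circ)
      = (\<Sum>a\<in>UNIV. \<Sum>b\<in>UNIV. \<integral>\<omega>. (cmod ((g \<omega> - fpartial (fcoef g) N \<omega>) $ a $ b))\<^sup>2 \<partial>circ)" for N
    unfolding norm_mat_power2 using int
    by (subst Bochner_Integration.integral_sum, intro Bochner_Integration.integrable_sum, assumption)
      (subst Bochner_Integration.integral_sum, assumption, rule refl)
  ultimately show "(\<lambda>N. \<integral>\<omega>. (norm (g \<omega> - fpartial (fcoef g) N \<omega>))\<^sup>2 \<partial>circ) \<longlonglongrightarrow> 0"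
    by simp
qed

lemma H2_mat_L2_fourier_series:
  assumes "H2_mat g"
  shows "L2_fourier_series g (fcoef g)"
  using H2_mat_fourier_norm[OF assms]
  unfolding L2_fourier_series_def fpartial_def integrable_circ integral_circ by blast

section \<open>Closed spans\<close>

lemma L2_rv_iff: "L2_rv M Y \<longleftrightarrow> square_integrable M Y"
  by (simp add: L2_rv_def square_integrable_def)

lemma borel_measurable_vecI:
  fixes f :: "'a \<Rightarrow> 'b::euclidean_space^'n"
  assumes "\<And>i. (\<lambda>x. f x $ i) \<in> borel_measurable M"
  shows "f \<in> borel_measurable M"
proof (subst borel_measurable_euclidean_space, rule ballI)
  fix b :: "'b^'n" assume "b \<in> Basis"
  then obtain i u where "b = axis i u"
    by (auto simp: Basis_vec_def)
  then show "(\<lambda>x. f x \<bullet> b) \<in> borel_measurable M"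
    using assms[of i] by (simp add: inner_axis)
qed

lemma square_integrable_vecI:
  fixes f :: "'a \<Rightarrow> 'b::euclidean_space^'n"
  assumes "\<And>i. square_integrable M (\<lambda>x. f x $ i)"
  shows "square_integrable M f"
proof -
  have "f \<in> borel_measurable M"
    using assms by (intro borel_measurable_vecI square_integrable_measurable)
  moreover have "(norm (f x))\<^sup>2 = (\<Sum>i\<in>UNIV. (norm (f x $ i))\<^sup>2)" for x
    by (simp add: norm_vec_def L2_set_def sum_nonneg)
  ultimately show ?thesis
    using square_integrableD[OF assms] by (simp add: square_integrable_def)
qed

lemma l2norm_vec_power2:
  fixes f :: "'a \<Rightarrow> 'b::euclidean_space^'n"
  assumes "\<And>i. square_integrable M (\<lambda>x. f x $ i)"
  shows "(l2norm M f)\<^sup>2 = (\<Sum>i\<in>UNIV. (l2norm M (\<lambda>x. f x $ i))\<^sup>2)"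
proof -
  have "(norm (f x))\<^sup>2 = (\<Sum>i\<in>UNIV. (norm (f x $ i))\<^sup>2)" for x
    by (simp add: norm_vec_def L2_set_def sum_nonneg)
  then show ?thesis
    using square_integrableD[OF assms] by (simp add: l2norm_power2)
qed

lemma square_integrable_nth:
  fixes f :: "'a \<Rightarrow> complex^'n"
  assumes "square_integrable M f"
  shows "square_integrable M (\<lambda>x. f x $ i)"
proof (rule square_integrable_bound[OF assms, where C = 1])
  have "(\<lambda>v::complex^'n. v $ i) \<in> borel_measurable borel"
    by (intro borel_measurable_continuous_onI continuous_intros)
  then show "(\<lambda>x. f x $ i) \<in> borel_measurable M"
    by (rule measurable_compose[OF square_integrable_measurable[OF assms]])
qed (simp add: Finite_Cartesian_Product.norm_nth_le)

lemma norm_smult_vec: "norm (c *s (v :: complex^'n)) = cmod c * norm v"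
  by (simp add: norm_vec_def L2_set_def norm_mult power_mult_distrib real_sqrt_mult flip: sum_distrib_left)

lemma square_integrable_smult:
  fixes f :: "'a \<Rightarrow> complex^'n"
  assumes "square_integrable M f"
  shows "square_integrable M (\<lambda>x. c *s f x)"
proof (rule square_integrable_vecI)
  show "square_integrable M (\<lambda>x. (c *s f x) $ i)" for i
    unfolding vector_smult_component
    by (intro square_integrable_cmult square_integrable_nth assms)
qed

lemma l2norm_smult:
  fixes f :: "'a \<Rightarrow> complex^'n"
  shows "l2norm M (\<lambda>x. c *s f x) = cmod c * l2norm M f"
  by (simp add: l2norm_def norm_smult_vec power_mult_distrib real_sqrt_mult)

section \<open>Inner products and polarization\<close>

lemma square_integrable_mult_cnj:
  fixes f g :: "'a \<Rightarrow> complex"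
  assumes "square_integrable M f" "square_integrable M g"
  shows "integrable M (\<lambda>x. f x * cnj (g x))"
proof (rule Bochner_Integration.integrable_bound[OF square_integrable_norm_mult[OF assms]])
  have "cnj \<in> borel_measurable borel"
    by (intro borel_measurable_continuous_onI continuous_intros)
  then have "(\<lambda>x. cnj (g x)) \<in> borel_measurable M"
    by (rule measurable_compose[OF square_integrable_measurable[OF assms(2)]])
  then show "(\<lambda>x. f x * cnj (g x)) \<in> borel_measurable M"
    using square_integrable_measurable[OF assms(1)] by simp
qed (simp add: norm_mult)

lemma l2norm_lincomb:
  fixes u :: "'i \<Rightarrow> 'a \<Rightarrow> complex"
  assumes u: "\<And>p. square_integrable M (u p)"
  shows "complex_of_real ((l2norm M (\<lambda>x. \<Sum>p\<in>S. c p * u p x))\<^sup>2)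
    = (\<Sum>p\<in>S. \<Sum>q\<in>S. c p * cnj (c q) * (\<integral>x. u p x * cnj (u q x) \<partial>M))"
proof -
  define T where "T x = (\<Sum>p\<in>S. c p * u p x)" for x
  have sT: "square_integrable M T"
    unfolding T_def by (intro square_integrable_sum square_integrable_cmult u)
  have int: "integrable M (\<lambda>x. c p * cnj (c q) * (u p x * cnj (u q x)))" for p q
    using square_integrable_mult_cnj[OF u u] by simp
  have "complex_of_real ((l2norm M T)\<^sup>2) = (\<integral>x. complex_of_real ((cmod (T x))\<^sup>2) \<partial>M)"
    unfolding l2norm_power2 by (rule integral_of_real[OF square_integrableD[OF sT], symmetric])
  also have "\<dots> = (\<integral>x. (\<Sum>p\<in>S. \<Sum>q\<in>S. c p * cnj (c q) * (u p x * cnj (u q x))) \<partial>M)"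
  proof (intro Bochner_Integration.integral_cong refl)
    fix x
    have "complex_of_real ((cmod (T x))\<^sup>2) = T x * cnj (T x)"
      by (rule complex_norm_square)
    also have "\<dots> = (\<Sum>p\<in>S. \<Sum>q\<in>S. (c p * u p x) * cnj (c q * u q x))"
      by (simp only: T_def cnj_sum sum_product)
    finally show "complex_of_real ((cmod (T x))\<^sup>2) = (\<Sum>p\<in>S. \<Sum>q\<in>S. c p * cnj (c q) * (u p x * cnj (u q x)))"
      by (simp only: complex_cnj_mult mult_ac)
  qed
  also have "\<dots> = (\<Sum>p\<in>S. \<Sum>q\<in>S. \<integral>x. c p * cnj (c q) * (u p x * cnj (u q x)) \<partial>M)"
  proof -
    have "(\<integral>x. (\<Sum>p\<in>S. \<Sum>q\<in>S. c p * cnj (c q) * (u p x * cnj (u q x))) \<partial>M)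
        = (\<Sum>p\<in>S. \<integral>x. (\<Sum>q\<in>S. c p * cnj (c q) * (u p x * cnj (u q x))) \<partial>M)"
      by (intro Bochner_Integration.integral_sum Bochner_Integration.integrable_sum int)
    also have "\<dots> = (\<Sum>p\<in>S. \<Sum>q\<in>S. \<integral>x. c p * cnj (c q) * (u p x * cnj (u q x)) \<partial>M)"
      by (intro sum.cong refl Bochner_Integration.integral_sum int)
    finally show ?thesis .
  qed
  also have "\<dots> = (\<Sum>p\<in>S. \<Sum>q\<in>S. c p * cnj (c q) * (\<integral>x. u p x * cnj (u q x) \<partial>M))"
    by simp
  finally show ?thesis
    by (simp only: T_def[abs_def])
qed

text \<open>The isomorphism is first known to preserve norms only; this identity upgrades that to
  inner products, as the covariances of the noise demand.\<close>

lemma l2_polarization: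
  fixes f g :: "'a \<Rightarrow> complex"
  assumes f: "square_integrable M f" and g: "square_integrable M g"
  shows "4 * (\<integral>x. f x * cnj (g x) \<partial>M)
    = (\<Sum>u\<in>{1, -1, \<i>, -\<i>}. u * complex_of_real ((l2norm M (\<lambda>x. f x + u * g x))\<^sup>2))"
proof -
  have sq: "square_integrable M (\<lambda>x. f x + u * g x)" for u
    by (intro square_integrable_add square_integrable_cmult f g)
  have "(\<Sum>u\<in>{1, -1, \<i>, -\<i>}. u * complex_of_real ((cmod (y + u * z))\<^sup>2)) = 4 * (y * cnj z)" for y z
    by (simp add: complex_eq_iff cmod_power2) (simp add: power2_eq_square algebra_simps)
  then have "4 * (\<integral>x. f x * cnj (g x) \<partial>M)
      = (\<integral>x. (\<Sum>u\<in>{1, -1, \<i>, -\<i>}. u * complex_of_real ((cmod (f x + u * g x))\<^sup>2)) \<partial>M)"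
    by simp
  also have "\<dots> = (\<Sum>u\<in>{1, -1, \<i>, -\<i>}. \<integral>x. u * complex_of_real ((cmod (f x + u * g x))\<^sup>2) \<partial>M)"
  proof (rule Bochner_Integration.integral_sum)
    show "integrable M (\<lambda>x. u * complex_of_real ((cmod (f x + u * g x))\<^sup>2))" for u
      by (intro integrable_mult_right integrable_of_real square_integrableD sq)
  qed
  also have "\<dots> = (\<Sum>u\<in>{1, -1, \<i>, -\<i>}. u * complex_of_real ((l2norm M (\<lambda>x. f x + u * g x))\<^sup>2))"
  proof (rule sum.cong[OF refl])
    fix u
    show "(\<integral>x. u * complex_of_real ((cmod (f x + u * g x))\<^sup>2) \<partial>M)
        = u * complex_of_real ((l2norm M (\<lambda>x. f x + u * g x))\<^sup>2)"
      unfolding l2norm_power2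
      by (simp only: integral_mult_right_zero integral_of_real[OF square_integrableD[OF sq]])
  qed
  finally show ?thesis .
qed

text \<open>Coefficients are extended by 0 to the common index set, so two combinations over
  different supports can be merged.\<close>

lemma lincomb_union:
  fixes v :: "'i \<Rightarrow> complex"
  assumes "finite S" "finite S'"
  shows "(\<Sum>p\<in>S. c p * v p) + (\<Sum>p\<in>S'. c' p * v p)
    = (\<Sum>p\<in>S \<union> S'. ((if p \<in> S then c p else 0) + (if p \<in> S' then c' p else 0)) * v p)"
proof -
  have "(\<Sum>p\<in>S. c p * v p) = (\<Sum>p\<in>S \<union> S'. (if p \<in> S then c p else 0) * v p)"
    using assms by (intro sum.mono_neutral_cong_left) auto
  moreover have "(\<Sum>p\<in>S'. c' p * v p) = (\<Sum>p\<in>S \<union> S'. (if p \<in> S' then c' p else 0) * v p)"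
    using assms by (intro sum.mono_neutral_cong_left) auto
  ultimately show ?thesis
    by (simp only: distrib_right sum.distrib)
qed

section \<open>The past of a process as a closed subspace\<close>

definition lcomb :: "(int \<Rightarrow> 'a \<Rightarrow> complex^'k) \<Rightarrow> (int \<times> 'k) set \<Rightarrow> (int \<times> 'k \<Rightarrow> complex) \<Rightarrow> 'a \<Rightarrow> complex" where
  "lcomb X S c x = (\<Sum>p\<in>S. c p * X (fst p) x $ snd p)"

lemma lcomb_add:
  assumes "finite S" "finite S'"
  shows "lcomb X S c x + lcomb X S' c' x
    = lcomb X (S \<union> S') (\<lambda>p. (if p \<in> S then c p else 0) + (if p \<in> S' then c' p else 0)) x"
  unfolding lcomb_def by (rule lincomb_union[OF assms])

lemma lcomb_cmult: "a * lcomb X S c x = lcomb X S (\<lambda>p. a * c p) x"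
  by (simp add: lcomb_def sum_distrib_left mult.assoc)

text \<open>\<open>in_past\<close> bounds the squared distance; since the tolerance is arbitrary,
  replacing it by its square root passes to the seminorm, where the triangle inequality is
  available.\<close>

lemma in_past_iff:
  "in_past M X n Y \<longleftrightarrow> square_integrable M Y \<and>
    (\<forall>e>0. \<exists>S c. finite S \<and> (\<forall>p\<in>S. fst p \<le> n) \<and> l2norm M (\<lambda>x. Y x - lcomb X S c x) < e)"
  (is "_ \<longleftrightarrow> _ \<and> (\<forall>e>0. ?P e)")
proof -
  have "(\<forall>e>0. ?P e) \<longleftrightarrow> (\<forall>e>0. ?P (sqrt e))"
  proof (intro iffI allI impI)
    show "?P (sqrt e)" if "\<forall>e>0. ?P e" "0 < e" for e
      using that(1)[rule_format, of "sqrt e"] that(2) by simp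
    show "?P e" if "\<forall>e>0. ?P (sqrt e)" "0 < e" for e
      using that(1)[rule_format, of "e\<^sup>2"] that(2) by simp
  qed
  moreover have "l2norm M (\<lambda>x. Y x - lcomb X S c x) < sqrt e \<longleftrightarrow>
      (\<integral>x. (cmod (Y x - (\<Sum>p\<in>S. c p * X (fst p) x $ snd p)))\<^sup>2 \<partial>M) < e" for S c e
    by (simp add: l2norm_def lcomb_def)
  ultimately show ?thesis
    unfolding in_past_def L2_rv_iff by simp
qed

lemma in_past_square_integrable: "in_past M X n Y \<Longrightarrow> square_integrable M Y"
  by (simp add: in_past_iff)

lemma in_past_gen:
  assumes "square_integrable M (\<lambda>x. X t x $ l)" "t \<le> n"
  shows "in_past M X n (\<lambda>x. X t x $ l)"
  unfolding in_past_iff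
proof (intro conjI allI impI)
  fix e :: real assume "0 < e"
  have "l2norm M (\<lambda>x. X t x $ l - lcomb X {(t, l)} (\<lambda>_. 1) x) = 0"
    by (simp add: lcomb_def l2norm_def)
  then show "\<exists>S c. finite S \<and> (\<forall>p\<in>S. fst p \<le> n) \<and> l2norm M (\<lambda>x. X t x $ l - lcomb X S c x) < e"
    using \<open>0 < e\<close> assms(2) by (intro exI[of _ "{(t, l)}"] exI[of _ "\<lambda>_. 1"]) simp
qed (rule assms)

context
  fixes M :: "'a measure" and X :: "int \<Rightarrow> 'a \<Rightarrow> complex^'k"
  assumes X: "\<And>t l. square_integrable M (\<lambda>x. X t x $ l)"
begin

lemma square_integrable_lcomb: "square_integrable M (lcomb X S c)"
  unfolding lcomb_def by (intro square_integrable_sum square_integrable_cmult X)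

lemma in_past_add:
  assumes "in_past M X n Y" "in_past M X n Z"
  shows "in_past M X n (\<lambda>x. Y x + Z x)"
  unfolding in_past_iff
proof (intro conjI allI impI)
  have YZ: "square_integrable M Y" "square_integrable M Z"
    using assms by (auto simp: in_past_iff)
  then show "square_integrable M (\<lambda>x. Y x + Z x)"
    by (rule square_integrable_add)
  fix e :: real assume "0 < e"
  then have "0 < e / 2"
    by simp
  obtain S c where S: "finite S" "\<forall>p\<in>S. fst p \<le> n" "l2norm M (\<lambda>x. Y x - lcomb X S c x) < e / 2"
    using assms(1) \<open>0 < e / 2\<close> unfolding in_past_iff by blast
  obtain S' c' where S': "finite S'" "\<forall>p\<in>S'. fst p \<le> n" "l2norm M (\<lambda>x. Z x - lcomb X S' c' x) < e / 2"
    using assms(2) \<open>0 < e / 2\<close> unfolding in_past_iff by blast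
  define d where "d = (\<lambda>p. (if p \<in> S then c p else 0) + (if p \<in> S' then c' p else 0))"
  have "(\<lambda>x. Y x + Z x - lcomb X (S \<union> S') d x) = (\<lambda>x. (Y x - lcomb X S c x) + (Z x - lcomb X S' c' x))"
    unfolding d_def lcomb_add[OF S(1) S'(1), symmetric] by (simp add: algebra_simps)
  then have "l2norm M (\<lambda>x. Y x + Z x - lcomb X (S \<union> S') d x)
      \<le> l2norm M (\<lambda>x. Y x - lcomb X S c x) + l2norm M (\<lambda>x. Z x - lcomb X S' c' x)"
    by (simp only:) (intro l2norm_triangle square_integrable_diff YZ square_integrable_lcomb)
  also have "\<dots> < e"
    using S(3) S'(3) by simp
  finally show "\<exists>S c. finite S \<and> (\<forall>p\<in>S. fst p \<le> n) \<and> l2norm M (\<lambda>x. Y x + Z x - lcomb X S c x) < e"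
    using S S' by (intro exI[of _ "S \<union> S'"] exI[of _ d]) auto
qed

lemma in_past_cmult:
  assumes "in_past M X n Y"
  shows "in_past M X n (\<lambda>x. a * Y x)"
  unfolding in_past_iff
proof (intro conjI allI impI)
  show "square_integrable M (\<lambda>x. a * Y x)"
    using assms by (simp add: in_past_iff square_integrable_cmult)
  fix e :: real assume "0 < e"
  \<comment> \<open>Adding 1 covers the factor \<open>a = 0\<close>.\<close>
  then have "0 < e / (cmod a + 1)"
    by (simp add: add_nonneg_pos)
  then obtain S c where S: "finite S" "\<forall>p\<in>S. fst p \<le> n" "l2norm M (\<lambda>x. Y x - lcomb X S c x) < e / (cmod a + 1)"
    using assms unfolding in_past_iff by metis
  have "l2norm M (\<lambda>x. a * Y x - lcomb X S (\<lambda>p. a * c p) x) = cmod a * l2norm M (\<lambda>x. Y x - lcomb X S c x)"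
    unfolding lcomb_cmult[symmetric] right_diff_distrib[symmetric] by (rule l2norm_cmult)
  also have "\<dots> \<le> (cmod a + 1) * l2norm M (\<lambda>x. Y x - lcomb X S c x)"
    by (intro mult_right_mono) auto
  also have "\<dots> < e"
    using S(3) by (simp add: pos_less_divide_eq add_nonneg_pos mult.commute)
  finally show "\<exists>S c. finite S \<and> (\<forall>p\<in>S. fst p \<le> n) \<and> l2norm M (\<lambda>x. a * Y x - lcomb X S c x) < e"
    using S by blast
qed

lemma in_past_sum:
  assumes "\<And>i. i \<in> I \<Longrightarrow> in_past M X n (Y i)"
  shows "in_past M X n (\<lambda>x. \<Sum>i\<in>I. Y i x)"
proof -
  have "in_past M X n (\<lambda>x. 0)"
    unfolding in_past_iff
    by (auto intro!: exI[of _ "{}"] simp: lcomb_def l2norm_def)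
  then show ?thesis
    using assms
  proof (induction I rule: infinite_finite_induct)
    case (insert i I)
    have "in_past M X n (\<lambda>x. Y i x + (\<Sum>i\<in>I. Y i x))"
      using insert by (intro in_past_add insert.IH) simp_all
    then show ?case
      using insert.hyps by simp
  qed simp_all
qed

lemma in_past_closed:
  assumes Y: "square_integrable M Y"
    and Z: "\<And>e. 0 < e \<Longrightarrow> \<exists>Z. in_past M X n Z \<and> l2norm M (\<lambda>x. Y x - Z x) < e"
  shows "in_past M X n Y"
  unfolding in_past_iff
proof (intro conjI allI impI)
  fix e :: real assume "0 < e"
  then have e2: "0 < e / 2"
    by simp
  from Z[OF this] obtain Z where Z: "in_past M X n Z" "l2norm M (\<lambda>x. Y x - Z x) < e / 2"
    by blast
  then obtain S c where S: "finite S" "\<forall>p\<in>S. fst p \<le> n" "l2norm M (\<lambda>x. Z x - lcomb X S c x) < e / 2"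
    using e2 unfolding in_past_iff by metis
  have "l2norm M (\<lambda>x. Y x - lcomb X S c x) \<le> l2norm M (\<lambda>x. Y x - Z x) + l2norm M (\<lambda>x. Z x - lcomb X S c x)"
    using Z(1) by (intro l2norm_triangle_diff Y square_integrable_lcomb) (simp add: in_past_iff)
  then have "l2norm M (\<lambda>x. Y x - lcomb X S c x) < e"
    using S(3) Z(2) by linarith
  then show "\<exists>S c. finite S \<and> (\<forall>p\<in>S. fst p \<le> n) \<and> l2norm M (\<lambda>x. Y x - lcomb X S c x) < e"
    using S by blast
qed (rule Y)

text \<open>Inclusion of pasts need only be checked on generators. Used in both directions between
  \<open>X\<close> and the noise.\<close>

lemma in_past_trans:
  fixes W :: "int \<Rightarrow> 'a \<Rightarrow> complex^'m"
  assumes W: "\<And>t l. t \<le> n \<Longrightarrow> in_past M X n (\<lambda>x. W t x $ l)" and Y: "in_past M W n Y"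
  shows "in_past M X n Y"
proof (rule in_past_closed)
  show "square_integrable M Y"
    using Y by (simp add: in_past_iff)
  fix e :: real assume "0 < e"
  then obtain S c where S: "finite S" "\<forall>p\<in>S. fst p \<le> n" "l2norm M (\<lambda>x. Y x - lcomb W S c x) < e"
    using Y unfolding in_past_iff by metis
  have "in_past M X n (lcomb W S c)"
    unfolding lcomb_def using S(2) by (intro in_past_sum in_past_cmult W) auto
  then show "\<exists>Z. in_past M X n Z \<and> l2norm M (\<lambda>x. Y x - Z x) < e"
    using S(3) by blast
qed

end

section \<open>The Kolmogorov isomorphism\<close>

text \<open>The spectral density has been eliminated: since 2 pi f = \<phi> \<open>cadj\<close>
  \<phi>, the covariances of \<open>X\<close> are inner products of rows of \<phi> multiplied by
  characters, and in this form they define the isometry.\<close>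

locale spectral_factor = prob_space M for M :: "'a measure" +
  fixes X :: "int \<Rightarrow> 'a \<Rightarrow> complex^'d" and \<phi> :: "real \<Rightarrow> complex^'r^'d"
  assumes X_L2: "\<And>t i. square_integrable M (\<lambda>x. X t x $ i)"
    and X_mean: "\<And>t i. (\<integral>x. X t x $ i \<partial>M) = 0"
    and phi_L2: "\<And>i l. square_integrable circ (\<lambda>\<omega>. \<phi> \<omega> $ i $ l)"
    and covariance: "\<And>s t i j. of_real (2 * pi) * (\<integral>x. X s x $ i * cnj (X t x $ j) \<partial>M)
      = (\<Sum>l\<in>UNIV. \<integral>\<omega>. (fchar s \<omega> * \<phi> \<omega> $ i $ l) * cnj (fchar t \<omega> * \<phi> \<omega> $ j $ l) \<partial>circ)"
begin

text \<open>The spectral counterpart of \<open>lcomb\<close> with the same index set and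
  coefficients, as a row vector with one coordinate per noise component.\<close>

definition tpoly :: "(int \<times> 'd) set \<Rightarrow> (int \<times> 'd \<Rightarrow> complex) \<Rightarrow> real \<Rightarrow> complex^'r" where
  "tpoly S c \<omega> = (\<chi> l. \<Sum>p\<in>S. c p * (fchar (fst p) \<omega> * \<phi> \<omega> $ snd p $ l))"

text \<open>The graph of the Kolmogorov isomorphism \<open>X\<^sup>i\<^sub>t \<mapsto> e\<^sup>i\<^sup>t\<^sup>\<omega> \<phi>\<^sub>i\<close>, as the closure of its restriction to
  finite linear combinations.\<close>

definition spectral_pair :: "('a \<Rightarrow> complex) \<Rightarrow> (real \<Rightarrow> complex^'r) \<Rightarrow> bool" where
  "spectral_pair Y g \<longleftrightarrow> square_integrable M Y \<and> square_integrable circ g \<and>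
    (\<forall>e>0. \<exists>S c. finite S \<and> l2norm M (\<lambda>x. Y x - lcomb X S c x) < e \<and> l2norm circ (\<lambda>\<omega>. g \<omega> - tpoly S c \<omega>) < e)"

lemma fchar_phi_L2: "square_integrable circ (\<lambda>\<omega>. fchar t \<omega> * \<phi> \<omega> $ i $ l)"
  by (rule square_integrable_fchar_mult[OF phi_L2])

lemma tpoly_nth_L2: "square_integrable circ (\<lambda>\<omega>. tpoly S c \<omega> $ l)"
  unfolding tpoly_def by (simp add: square_integrable_sum square_integrable_cmult fchar_phi_L2)

lemma tpoly_L2: "square_integrable circ (tpoly S c)"
  by (intro square_integrable_vecI tpoly_nth_L2)

lemma lcomb_L2: "square_integrable M (lcomb X S c)"
  by (rule square_integrable_lcomb) (rule X_L2)

text \<open>Both squared norms are one and the same sesquilinear form in the coefficients, with Gram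
  matrices matched by \<open>covariance\<close>.\<close>

lemma isometry_lcomb: "sqrt (2 * pi) * l2norm M (lcomb X S c) = l2norm circ (tpoly S c)"
proof -
  have "complex_of_real ((l2norm circ (tpoly S c))\<^sup>2)
      = (\<Sum>l\<in>UNIV. complex_of_real ((l2norm circ (\<lambda>\<omega>. tpoly S c \<omega> $ l))\<^sup>2))"
    unfolding l2norm_vec_power2[OF tpoly_nth_L2] by (rule of_real_sum)
  also have "\<dots> = (\<Sum>l\<in>UNIV. \<Sum>p\<in>S. \<Sum>q\<in>S. c p * cnj (c q) *
      (\<integral>\<omega>. (fchar (fst p) \<omega> * \<phi> \<omega> $ snd p $ l) * cnj (fchar (fst q) \<omega> * \<phi> \<omega> $ snd q $ l) \<partial>circ))"
    unfolding tpoly_def vec_lambda_beta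
    by (intro sum.cong refl l2norm_lincomb fchar_phi_L2)
  also have "\<dots> = (\<Sum>p\<in>S. \<Sum>q\<in>S. \<Sum>l\<in>UNIV. c p * cnj (c q) *
      (\<integral>\<omega>. (fchar (fst p) \<omega> * \<phi> \<omega> $ snd p $ l) * cnj (fchar (fst q) \<omega> * \<phi> \<omega> $ snd q $ l) \<partial>circ))"
    by (subst sum.swap, intro sum.cong refl, rule sum.swap)
  also have "\<dots> = (\<Sum>p\<in>S. \<Sum>q\<in>S. c p * cnj (c q) *
      (of_real (2 * pi) * (\<integral>x. X (fst p) x $ snd p * cnj (X (fst q) x $ snd q) \<partial>M)))"
    unfolding covariance sum_distrib_left ..
  also have "\<dots> = of_real (2 * pi) * (\<Sum>p\<in>S. \<Sum>q\<in>S. c p * cnj (c q) *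
      (\<integral>x. X (fst p) x $ snd p * cnj (X (fst q) x $ snd q) \<partial>M))"
    unfolding sum_distrib_left by (intro sum.cong refl) (simp only: mult_ac)
  also have "\<dots> = of_real (2 * pi * (l2norm M (lcomb X S c))\<^sup>2)"
    unfolding of_real_mult lcomb_def[abs_def] by (subst l2norm_lincomb[OF X_L2]) (rule refl)
  finally have "(l2norm circ (tpoly S c))\<^sup>2 = 2 * pi * (l2norm M (lcomb X S c))\<^sup>2"
    by (simp only: of_real_eq_iff)
  also have "\<dots> = (sqrt (2 * pi) * l2norm M (lcomb X S c))\<^sup>2"
    by (simp add: power_mult_distrib)
  finally show ?thesis
    by (simp add: power2_eq_iff_nonneg)
qed

section \<open>Linearity and closedness of the isomorphism\<close>

lemma spectral_pair_L2:
  assumes "spectral_pair Y g"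
  shows "square_integrable M Y" "square_integrable circ g"
  using assms by (auto simp: spectral_pair_def)

lemma spectral_pair_isometry:
  assumes "spectral_pair Y g"
  shows "sqrt (2 * pi) * l2norm M Y = l2norm circ g"
proof -
  note L2 = spectral_pair_L2[OF assms]
  have "\<bar>sqrt (2 * pi) * l2norm M Y - l2norm circ g\<bar> \<le> 0"
  proof (rule field_le_epsilon)
    fix e :: real assume "0 < e"
    \<comment> \<open>Two approximation errors add up, and the one on the probability side is scaled
      by \<open>sqrt (2 * pi)\<close>.\<close>
    define e' where "e' = e / (sqrt (2 * pi) + 1)"
    have "0 < e'"
      using \<open>0 < e\<close> by (simp add: e'_def add_nonneg_pos)
    then obtain S c where S: "l2norm M (\<lambda>x. Y x - lcomb X S c x) < e'" "l2norm circ (\<lambda>\<omega>. g \<omega> - tpoly S c \<omega>) < e'"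
      using assms unfolding spectral_pair_def by blast
    have 1: "\<bar>l2norm M Y - l2norm M (lcomb X S c)\<bar> \<le> e'"
      using l2norm_diff_le[OF L2(1) lcomb_L2, of S c] S(1) by linarith
    have 2: "\<bar>l2norm circ g - l2norm circ (tpoly S c)\<bar> \<le> e'"
      using l2norm_diff_le[OF L2(2) tpoly_L2, of S c] S(2) by linarith
    have "\<bar>sqrt (2 * pi) * l2norm M Y - sqrt (2 * pi) * l2norm M (lcomb X S c)\<bar> \<le> sqrt (2 * pi) * e'"
      unfolding right_diff_distrib[symmetric] abs_mult using 1 by (simp add: mult_left_mono)
    then have "\<bar>sqrt (2 * pi) * l2norm M Y - l2norm circ g\<bar> \<le> sqrt (2 * pi) * e' + e'"
      using 2 unfolding isometry_lcomb by linarith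
    also have "\<dots> = (sqrt (2 * pi) + 1) * e'"
      by (simp add: distrib_right)
    also have "\<dots> = e"
      unfolding e'_def using add_nonneg_pos[of "sqrt (2 * pi)" 1] by simp
    finally show "\<bar>sqrt (2 * pi) * l2norm M Y - l2norm circ g\<bar> \<le> 0 + e"
      by simp
  qed
  then show ?thesis
    by simp
qed

lemma spectral_pair_gen: "spectral_pair (\<lambda>x. X t x $ i) (\<lambda>\<omega>. fchar t \<omega> *s row i (\<phi> \<omega>))"
  unfolding spectral_pair_def
proof (intro conjI allI impI)
  have t: "(\<lambda>\<omega>. fchar t \<omega> *s row i (\<phi> \<omega>)) = tpoly {(t, i)} (\<lambda>_. 1)"
    by (rule ext) (simp add: tpoly_def vec_eq_iff row_def)
  show "square_integrable circ (\<lambda>\<omega>. fchar t \<omega> *s row i (\<phi> \<omega>))"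
    unfolding t by (rule tpoly_L2)
  fix e :: real assume "0 < e"
  moreover have "l2norm M (\<lambda>x. X t x $ i - lcomb X {(t, i)} (\<lambda>_. 1) x) = 0"
    by (simp add: lcomb_def l2norm_def)
  moreover have "l2norm circ (\<lambda>\<omega>. fchar t \<omega> *s row i (\<phi> \<omega>) - tpoly {(t, i)} (\<lambda>_. 1) \<omega>) = 0"
    unfolding fun_cong[OF t] by (simp add: l2norm_def)
  ultimately show "\<exists>S c. finite S \<and> l2norm M (\<lambda>x. X t x $ i - lcomb X S c x) < e \<and>
      l2norm circ (\<lambda>\<omega>. fchar t \<omega> *s row i (\<phi> \<omega>) - tpoly S c \<omega>) < e"
    by (intro exI[of _ "{(t, i)}"] exI[of _ "\<lambda>_. 1"]) simp
qed (rule X_L2)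

lemma spectral_pair_add:
  assumes "spectral_pair Y g" "spectral_pair Z h"
  shows "spectral_pair (\<lambda>x. Y x + Z x) (\<lambda>\<omega>. g \<omega> + h \<omega>)"
  unfolding spectral_pair_def
proof (intro conjI allI impI)
  note L2 = spectral_pair_L2[OF assms(1)] spectral_pair_L2[OF assms(2)]
  show "square_integrable M (\<lambda>x. Y x + Z x)" "square_integrable circ (\<lambda>\<omega>. g \<omega> + h \<omega>)"
    by (intro square_integrable_add L2)+
  fix e :: real assume "0 < e"
  then have e2: "0 < e / 2"
    by simp
  obtain S c where S: "finite S" "l2norm M (\<lambda>x. Y x - lcomb X S c x) < e / 2"
      "l2norm circ (\<lambda>\<omega>. g \<omega> - tpoly S c \<omega>) < e / 2"
    using assms(1) e2 unfolding spectral_pair_def by blast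
  obtain S' c' where S': "finite S'" "l2norm M (\<lambda>x. Z x - lcomb X S' c' x) < e / 2"
      "l2norm circ (\<lambda>\<omega>. h \<omega> - tpoly S' c' \<omega>) < e / 2"
    using assms(2) e2 unfolding spectral_pair_def by blast
  define d where "d = (\<lambda>p. (if p \<in> S then c p else 0) + (if p \<in> S' then c' p else 0))"
  have 1: "Y x + Z x - lcomb X (S \<union> S') d x = (Y x - lcomb X S c x) + (Z x - lcomb X S' c' x)" for x
    unfolding d_def lcomb_add[OF S(1) S'(1), symmetric] by simp
  have "tpoly S c \<omega> + tpoly S' c' \<omega> = tpoly (S \<union> S') d \<omega>" for \<omega>
    unfolding tpoly_def vec_eq_iff vector_add_component vec_lambda_beta d_def
    by (intro allI lincomb_union[OF S(1) S'(1)])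
  then have 2: "g \<omega> + h \<omega> - tpoly (S \<union> S') d \<omega> = (g \<omega> - tpoly S c \<omega>) + (h \<omega> - tpoly S' c' \<omega>)" for \<omega>
    by (simp add: algebra_simps)
  have "l2norm M (\<lambda>x. Y x + Z x - lcomb X (S \<union> S') d x)
      \<le> l2norm M (\<lambda>x. Y x - lcomb X S c x) + l2norm M (\<lambda>x. Z x - lcomb X S' c' x)"
    unfolding 1 by (intro l2norm_triangle square_integrable_diff L2 lcomb_L2)
  moreover have "l2norm circ (\<lambda>\<omega>. g \<omega> + h \<omega> - tpoly (S \<union> S') d \<omega>)
      \<le> l2norm circ (\<lambda>\<omega>. g \<omega> - tpoly S c \<omega>) + l2norm circ (\<lambda>\<omega>. h \<omega> - tpoly S' c' \<omega>)"
    unfolding 2 by (intro l2norm_triangle square_integrable_diff L2 tpoly_L2)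
  ultimately show "\<exists>S c. finite S \<and> l2norm M (\<lambda>x. Y x + Z x - lcomb X S c x) < e
      \<and> l2norm circ (\<lambda>\<omega>. g \<omega> + h \<omega> - tpoly S c \<omega>) < e"
    using S S' by (intro exI[of _ "S \<union> S'"] exI[of _ d]) auto
qed

lemma spectral_pair_smult:
  assumes "spectral_pair Y g"
  shows "spectral_pair (\<lambda>x. a * Y x) (\<lambda>\<omega>. a *s g \<omega>)"
  unfolding spectral_pair_def
proof (intro conjI allI impI)
  note L2 = spectral_pair_L2[OF assms]
  show "square_integrable M (\<lambda>x. a * Y x)" "square_integrable circ (\<lambda>\<omega>. a *s g \<omega>)"
    by (intro square_integrable_cmult square_integrable_smult L2)+
  fix e :: real assume "0 < e"
  define K where "K = cmod a + 1"
  have K: "0 < K" "cmod a \<le> K"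
    by (auto simp: K_def add_nonneg_pos)
  then have "0 < e / K"
    using \<open>0 < e\<close> by simp
  then obtain S c where S: "finite S" "l2norm M (\<lambda>x. Y x - lcomb X S c x) < e / K"
      "l2norm circ (\<lambda>\<omega>. g \<omega> - tpoly S c \<omega>) < e / K"
    using assms unfolding spectral_pair_def by blast
  have le: "cmod a * z < e" if "z < e / K" "0 \<le> z" for z
  proof -
    have "cmod a * z \<le> K * z"
      using K that by (intro mult_right_mono) auto
    then show ?thesis
      using that K by (simp add: pos_less_divide_eq mult.commute)
  qed
  have "a *s tpoly S c \<omega> = tpoly S (\<lambda>p. a * c p) \<omega>" for \<omega>
    by (simp add: tpoly_def vec_eq_iff sum_distrib_left mult.assoc)
  then have t: "a *s g \<omega> - tpoly S (\<lambda>p. a * c p) \<omega> = a *s (g \<omega> - tpoly S c \<omega>)" for \<omega>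
    by (simp add: vector_ssub_ldistrib)
  have "l2norm M (\<lambda>x. a * Y x - lcomb X S (\<lambda>p. a * c p) x) < e"
    unfolding lcomb_cmult[symmetric] right_diff_distrib[symmetric] l2norm_cmult using S(2) by (intro le) auto
  moreover have "l2norm circ (\<lambda>\<omega>. a *s g \<omega> - tpoly S (\<lambda>p. a * c p) \<omega>) < e"
    unfolding t l2norm_smult using S(3) by (intro le) auto
  ultimately show "\<exists>S c. finite S \<and> l2norm M (\<lambda>x. a * Y x - lcomb X S c x) < e
      \<and> l2norm circ (\<lambda>\<omega>. a *s g \<omega> - tpoly S c \<omega>) < e"
    using S(1) by blast
qed

lemma spectral_pair_diff:
  assumes "spectral_pair Y g" "spectral_pair Z h"
  shows "spectral_pair (\<lambda>x. Y x - Z x) (\<lambda>\<omega>. g \<omega> - h \<omega>)"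
proof -
  have "(-1) *s v = - v" for v :: "complex^'r"
    by (simp add: vec_eq_iff)
  then show ?thesis
    using spectral_pair_add[OF assms(1) spectral_pair_smult[OF assms(2), of "-1"]] by simp
qed

lemma spectral_pair_sum:
  assumes "\<And>i. i \<in> I \<Longrightarrow> spectral_pair (Y i) (g i)"
  shows "spectral_pair (\<lambda>x. \<Sum>i\<in>I. Y i x) (\<lambda>\<omega>. \<Sum>i\<in>I. g i \<omega>)"
proof -
  \<comment> \<open>The zero pair arises as a generator minus itself; time and component are
    arbitrary.\<close>
  have "spectral_pair (\<lambda>x. 0) (\<lambda>\<omega>. 0)"
    using spectral_pair_diff[OF spectral_pair_gen[of 0 undefined] spectral_pair_gen[of 0 undefined]] by simp
  then show ?thesis
    using assms
  proof (induction I rule: infinite_finite_induct)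
    case (insert i I)
    have "spectral_pair (\<lambda>x. Y i x + (\<Sum>i\<in>I. Y i x)) (\<lambda>\<omega>. g i \<omega> + (\<Sum>i\<in>I. g i \<omega>))"
      using insert by (intro spectral_pair_add insert.IH) simp_all
    then show ?case
      using insert.hyps by simp
  qed simp_all
qed

text \<open>This is where random variables come into being: convergence in the spectral domain makes
  the preimages Cauchy by the isometry, and completeness of the probability space's L^2 provides
  their limit.\<close>

lemma spectral_pair_limit:
  assumes Yg: "\<And>n. spectral_pair (Y n) (g n)" and h: "square_integrable circ h"
    and lim: "(\<lambda>n. l2norm circ (\<lambda>\<omega>. h \<omega> - g n \<omega>)) \<longlonglongrightarrow> 0"
  obtains Z where "spectral_pair Z h" "(\<lambda>n. l2norm M (\<lambda>x. Z x - Y n x)) \<longlonglongrightarrow> 0"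
proof -
  note L2 = spectral_pair_L2[OF Yg]
  obtain Z where Z: "square_integrable M Z" "(\<lambda>n. l2norm M (\<lambda>x. Z x - Y n x)) \<longlonglongrightarrow> 0"
  proof (rule l2_complete[of Y, OF L2(1)])
    fix e :: real assume "0 < e"
    \<comment> \<open>Half for each of the two distances through \<open>h\<close>;
      \<open>sqrt (2 * pi)\<close> cancels against the isometry constant.\<close>
    obtain N where N: "\<And>n. n \<ge> N \<Longrightarrow> l2norm circ (\<lambda>\<omega>. h \<omega> - g n \<omega>) < sqrt (2 * pi) * e / 2"
      using LIMSEQ_D[OF lim, of "sqrt (2 * pi) * e / 2"] \<open>0 < e\<close> by auto
    have "l2norm M (\<lambda>x. Y m x - Y n x) < e" if mn: "m \<ge> N" "n \<ge> N" for m n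
    proof -
      have "sqrt (2 * pi) * l2norm M (\<lambda>x. Y m x - Y n x) = l2norm circ (\<lambda>\<omega>. g m \<omega> - g n \<omega>)"
        by (intro spectral_pair_isometry spectral_pair_diff Yg)
      also have "\<dots> \<le> l2norm circ (\<lambda>\<omega>. g m \<omega> - h \<omega>) + l2norm circ (\<lambda>\<omega>. h \<omega> - g n \<omega>)"
        by (intro l2norm_triangle_diff L2 h)
      also have "\<dots> < sqrt (2 * pi) * e"
        using N[OF mn(1)] N[OF mn(2)] by (simp add: l2norm_commute[of circ "g m"])
      finally show ?thesis
        by simp
    qed
    then show "\<exists>N. \<forall>m\<ge>N. \<forall>n\<ge>N. l2norm M (\<lambda>x. Y m x - Y n x) < e"
      by blast
  qed
  have "spectral_pair Z h"
    unfolding spectral_pair_def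
  proof (intro conjI allI impI Z h)
    fix e :: real assume "0 < e"
    then have e2: "0 < e / 2"
      by simp
    have "\<forall>\<^sub>F n in sequentially. l2norm M (\<lambda>x. Z x - Y n x) < e / 2 \<and> l2norm circ (\<lambda>\<omega>. h \<omega> - g n \<omega>) < e / 2"
      using order_tendstoD(2)[OF Z(2) e2] order_tendstoD(2)[OF lim e2] by (rule eventually_conj)
    then obtain n where n: "l2norm M (\<lambda>x. Z x - Y n x) < e / 2" "l2norm circ (\<lambda>\<omega>. h \<omega> - g n \<omega>) < e / 2"
      using eventually_happens'[OF sequentially_bot] by blast
    obtain S c where S: "finite S" "l2norm M (\<lambda>x. Y n x - lcomb X S c x) < e / 2"
        "l2norm circ (\<lambda>\<omega>. g n \<omega> - tpoly S c \<omega>) < e / 2"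
      using Yg[of n] e2 unfolding spectral_pair_def by blast
    have "l2norm M (\<lambda>x. Z x - lcomb X S c x) < e"
      using l2norm_triangle_diff[OF Z(1) L2(1)[of n] lcomb_L2[of S c]] n(1) S(2) by linarith
    moreover have "l2norm circ (\<lambda>\<omega>. h \<omega> - tpoly S c \<omega>) < e"
      using l2norm_triangle_diff[OF h L2(2)[of n] tpoly_L2[of S c]] n(2) S(3) by linarith
    ultimately show "\<exists>S c. finite S \<and> l2norm M (\<lambda>x. Z x - lcomb X S c x) < e
        \<and> l2norm circ (\<lambda>\<omega>. h \<omega> - tpoly S c \<omega>) < e"
      using S(1) by blast
  qed
  then show ?thesis
    using Z(2) by (rule that)
qed

section \<open>Means and covariances through the isomorphism\<close>

lemma integral_norm_le_l2norm:
  assumes "square_integrable M Y"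
  shows "cmod (\<integral>x. Y x \<partial>M) \<le> l2norm M Y"
  using order_trans[OF integral_norm_bound square_integrable_imp_integrable_norm(2)[OF assms]]
  by (simp add: prob_space)

text \<open>On a probability space the mean is bounded by the L^2 seminorm, and it vanishes on all
  linear combinations of \<open>X\<close>.\<close>

lemma spectral_pair_mean:
  assumes "spectral_pair Y g"
  shows "(\<integral>x. Y x \<partial>M) = 0"
proof -
  note L2 = spectral_pair_L2[OF assms]
  have int: "integrable M (\<lambda>x. X t x $ i)" for t i
    by (rule square_integrable_imp_integrable_norm(1)[OF X_L2])
  have "cmod (\<integral>x. Y x \<partial>M) \<le> 0"
  proof (rule field_le_epsilon)
    fix e :: real assume "0 < e"
    then obtain S c where S: "l2norm M (\<lambda>x. Y x - lcomb X S c x) < e"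
      using assms unfolding spectral_pair_def by blast
    have "(\<integral>x. lcomb X S c x \<partial>M) = 0"
      unfolding lcomb_def using int by (simp add: X_mean)
    then have "(\<integral>x. Y x \<partial>M) = (\<integral>x. Y x - lcomb X S c x \<partial>M)"
      by (simp add: square_integrable_imp_integrable_norm(1)[OF L2(1)]
          square_integrable_imp_integrable_norm(1)[OF lcomb_L2])
    then show "cmod (\<integral>x. Y x \<partial>M) \<le> 0 + e"
      using integral_norm_le_l2norm[OF square_integrable_diff[OF L2(1) lcomb_L2], of S c] S by simp
  qed
  then show ?thesis
    by simp
qed

text \<open>Polarize both sides: each of the four norms involved belongs to the pair of
  \<open>Y + u Z\<close> and \<open>g + u h\<close>.\<close>

lemma spectral_pair_inner:
  assumes Y: "spectral_pair Y g" and Z: "spectral_pair Z h"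
  shows "of_real (2 * pi) * (\<integral>x. Y x * cnj (Z x) \<partial>M) = (\<Sum>l\<in>UNIV. \<integral>\<omega>. g \<omega> $ l * cnj (h \<omega> $ l) \<partial>circ)"
proof -
  note L2 = spectral_pair_L2[OF Y] spectral_pair_L2[OF Z]
  have norm: "of_real (2 * pi) * complex_of_real ((l2norm M (\<lambda>x. Y x + u * Z x))\<^sup>2)
      = (\<Sum>l\<in>UNIV. complex_of_real ((l2norm circ (\<lambda>\<omega>. g \<omega> $ l + u * h \<omega> $ l))\<^sup>2))" for u
  proof -
    have "spectral_pair (\<lambda>x. Y x + u * Z x) (\<lambda>\<omega>. g \<omega> + u *s h \<omega>)"
      by (intro spectral_pair_add spectral_pair_smult Y Z)
    from spectral_pair_isometry[OF this, symmetric]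
    have "2 * pi * (l2norm M (\<lambda>x. Y x + u * Z x))\<^sup>2 = (l2norm circ (\<lambda>\<omega>. g \<omega> + u *s h \<omega>))\<^sup>2"
      by (simp add: power_mult_distrib)
    also have "\<dots> = (\<Sum>l\<in>UNIV. (l2norm circ (\<lambda>\<omega>. g \<omega> $ l + u * h \<omega> $ l))\<^sup>2)"
      using l2norm_vec_power2[of circ "\<lambda>\<omega>. g \<omega> + u *s h \<omega>"] L2
      by (simp add: square_integrable_add square_integrable_cmult square_integrable_nth)
    finally show ?thesis
      unfolding of_real_mult[symmetric] of_real_sum[symmetric] by (rule arg_cong)
  qed
  have "4 * (of_real (2 * pi) * (\<integral>x. Y x * cnj (Z x) \<partial>M))
      = (\<Sum>u\<in>{1, -1, \<i>, -\<i>}. u * (of_real (2 * pi) * complex_of_real ((l2norm M (\<lambda>x. Y x + u * Z x))\<^sup>2)))"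
    using arg_cong[OF l2_polarization[OF L2(1) L2(3)], of "\<lambda>z. of_real (2 * pi) * z"]
    by (simp only: sum_distrib_left mult_ac)
  also have "\<dots> = (\<Sum>l\<in>UNIV. \<Sum>u\<in>{1, -1, \<i>, -\<i>}. u * complex_of_real ((l2norm circ (\<lambda>\<omega>. g \<omega> $ l + u * h \<omega> $ l))\<^sup>2))"
    unfolding norm sum_distrib_left by (rule sum.swap)
  also have "\<dots> = (\<Sum>l\<in>UNIV. 4 * (\<integral>\<omega>. g \<omega> $ l * cnj (h \<omega> $ l) \<partial>circ))"
    by (intro sum.cong refl l2_polarization[symmetric] square_integrable_nth L2)
  also have "\<dots> = 4 * (\<Sum>l\<in>UNIV. \<integral>\<omega>. g \<omega> $ l * cnj (h \<omega> $ l) \<partial>circ)"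
    by (simp only: sum_distrib_left)
  finally show ?thesis
    by (simp add: mult.assoc)
qed

end

section \<open>Regularity and series representations\<close>

lemma cmod_integral_mult_cnj_le:
  fixes f g :: "'a \<Rightarrow> complex"
  assumes "square_integrable M f" "square_integrable M g"
  shows "cmod (\<integral>x. f x * cnj (g x) \<partial>M) \<le> l2norm M f * l2norm M g"
proof -
  have "cmod (\<integral>x. f x * cnj (g x) \<partial>M) \<le> (\<integral>x. cmod (f x) * cmod (g x) \<partial>M)"
    using integral_norm_bound[of M "\<lambda>x. f x * cnj (g x)"] by (simp add: norm_mult)
  also have "\<dots> \<le> l2norm M f * l2norm M g"
    by (rule integral_norm_mult_le[OF assms])
  finally show ?thesis .
qed

lemma le_mult_epsilon_0:
  fixes a b :: real
  assumes "\<And>e. 0 < e \<Longrightarrow> a \<le> b * e" "0 \<le> b"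
  shows "a \<le> 0"
proof (rule field_le_epsilon)
  fix e :: real assume "0 < e"
  have "a \<le> b * (e / (b + 1))"
    using assms \<open>0 < e\<close> by (intro assms) simp
  also have "\<dots> \<le> 0 + e"
    using assms(2) \<open>0 < e\<close> by (simp add: field_simps)
  finally show "a \<le> 0 + e" .
qed

lemma l2norm_eq_0_AE:
  assumes "square_integrable M Y" "l2norm M Y = 0"
  shows "AE x in M. Y x = 0"
proof -
  have "(\<integral>x. (norm (Y x))\<^sup>2 \<partial>M) = 0"
    using assms(2) by (simp flip: l2norm_power2)
  then have "AE x in M. (norm (Y x))\<^sup>2 = 0"
    using integral_nonneg_eq_0_iff_AE[OF square_integrableD[OF assms(1)]] by simp
  then show ?thesis
    by simp
qed

text \<open>A variable in every past is orthogonal to each \<xi> \<open>s\<close>, because it is a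
  limit of combinations from strictly earlier times; lying also in the closed span of the noise, it
  is orthogonal to itself.\<close>

lemma fundamental_process_regular:
  assumes "fundamental_process M X \<xi>"
  shows "regular_process M X"
  unfolding regular_process_def
proof (intro allI impI)
  fix Y assume "\<forall>n. in_past M X n Y"
  then have past: "in_past M \<xi> n Y" for n
    using assms by (simp add: fundamental_process_def)
  have Y: "square_integrable M Y"
    using past by (rule in_past_square_integrable)
  have \<xi>: "square_integrable M (\<lambda>x. \<xi> t x $ i)" for t i
    using assms by (simp add: fundamental_process_def orthonormal_white_noise_def L2_rvec_def L2_rv_iff)
  have orth: "(\<integral>x. \<xi> s x $ i * cnj (\<xi> t x $ j) \<partial>M) = (if s = t \<and> i = j then 1 else 0)" for s t i j
    using assms by (simp add: fundamental_process_def orthonormal_white_noise_def)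
  have lc: "square_integrable M (lcomb \<xi> S c)" for S c
    by (intro square_integrable_lcomb \<xi>)
  have perp: "(\<integral>x. Y x * cnj (\<xi> s x $ j) \<partial>M) = 0" for s j
  proof -
    have "cmod (\<integral>x. Y x * cnj (\<xi> s x $ j) \<partial>M) \<le> 0"
    proof (rule le_mult_epsilon_0)
      fix e :: real assume "0 < e"
      \<comment> \<open>Stopping at \<open>s - 1\<close> keeps time \<open>s\<close> out of the
        combination, so all its inner products with \<xi> \<open>s\<close> vanish.\<close>
      then obtain S c where S: "finite S" "\<forall>p\<in>S. fst p \<le> s - 1" "l2norm M (\<lambda>x. Y x - lcomb \<xi> S c x) < e"
        using past[of "s - 1"] unfolding in_past_iff by blast
      have int: "integrable M (\<lambda>x. \<xi> t x $ i * cnj (\<xi> s x $ j))" for t i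
        by (intro square_integrable_mult_cnj \<xi>)
      have "(\<integral>x. lcomb \<xi> S c x * cnj (\<xi> s x $ j) \<partial>M)
          = (\<integral>x. (\<Sum>p\<in>S. c p * (\<xi> (fst p) x $ snd p * cnj (\<xi> s x $ j))) \<partial>M)"
        by (simp add: lcomb_def sum_distrib_right mult.assoc)
      also have "\<dots> = (\<Sum>p\<in>S. c p * (\<integral>x. \<xi> (fst p) x $ snd p * cnj (\<xi> s x $ j) \<partial>M))"
        using int by simp
      also have "\<dots> = 0"
        using S(2) by (intro sum.neutral) (auto simp: orth)
      finally have "(\<integral>x. Y x * cnj (\<xi> s x $ j) \<partial>M) = (\<integral>x. (Y x - lcomb \<xi> S c x) * cnj (\<xi> s x $ j) \<partial>M)"
        unfolding left_diff_distrib
        by (subst Bochner_Integration.integral_diff) (auto intro!: square_integrable_mult_cnj Y lc \<xi>)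
      then have "cmod (\<integral>x. Y x * cnj (\<xi> s x $ j) \<partial>M)
          \<le> l2norm M (\<lambda>x. Y x - lcomb \<xi> S c x) * l2norm M (\<lambda>x. \<xi> s x $ j)"
        using cmod_integral_mult_cnj_le[OF square_integrable_diff[OF Y lc] \<xi>] by simp
      also have "\<dots> \<le> e * l2norm M (\<lambda>x. \<xi> s x $ j)"
        using S(3) by (intro mult_right_mono) auto
      finally show "cmod (\<integral>x. Y x * cnj (\<xi> s x $ j) \<partial>M) \<le> l2norm M (\<lambda>x. \<xi> s x $ j) * e"
        by (simp add: mult.commute)
    qed simp
    then show ?thesis
      by simp
  qed
  \<comment> \<open>Subtracting a combination of the noise leaves the inner product of
    \<open>Y\<close> with itself unchanged, but makes the second factor arbitrarily small.\<close>
  have "(l2norm M Y)\<^sup>2 \<le> 0"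
  proof (rule le_mult_epsilon_0)
    fix e :: real assume "0 < e"
    then obtain S c where S: "l2norm M (\<lambda>x. Y x - lcomb \<xi> S c x) < e"
      using past[of 0] unfolding in_past_iff by blast
    have int: "integrable M (\<lambda>x. Y x * cnj (\<xi> s x $ j))" for s j
      by (intro square_integrable_mult_cnj \<xi> Y)
    have "(\<integral>x. Y x * cnj (lcomb \<xi> S c x) \<partial>M)
        = (\<integral>x. (\<Sum>p\<in>S. cnj (c p) * (Y x * cnj (\<xi> (fst p) x $ snd p))) \<partial>M)"
      by (simp add: lcomb_def sum_distrib_left mult_ac)
    also have "\<dots> = 0"
      using int by (simp add: perp)
    finally have "(\<integral>x. Y x * cnj (Y x) \<partial>M) = (\<integral>x. Y x * cnj (Y x - lcomb \<xi> S c x) \<partial>M)"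
      unfolding complex_cnj_diff right_diff_distrib
      by (subst Bochner_Integration.integral_diff) (auto intro!: square_integrable_mult_cnj Y lc)
    moreover have "(\<integral>x. Y x * cnj (Y x) \<partial>M) = of_real ((l2norm M Y)\<^sup>2)"
      unfolding complex_norm_square[symmetric] l2norm_power2
      by (rule integral_of_real[OF square_integrableD[OF Y]])
    ultimately have "(l2norm M Y)\<^sup>2 = cmod (\<integral>x. Y x * cnj (Y x - lcomb \<xi> S c x) \<partial>M)"
      by (metis norm_of_real abs_power2)
    also have "\<dots> \<le> l2norm M Y * l2norm M (\<lambda>x. Y x - lcomb \<xi> S c x)"
      by (intro cmod_integral_mult_cnj_le square_integrable_diff Y lc)
    also have "\<dots> \<le> l2norm M Y * e"
      using S by (intro mult_left_mono) auto
    finally show "(l2norm M Y)\<^sup>2 \<le> l2norm M Y * e" .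
  qed simp
  then have "l2norm M Y = 0"
    by simp
  then show "AE x in M. Y x = 0"
    by (rule l2norm_eq_0_AE[OF Y])
qed

lemma L2_convergesI:
  fixes Y :: "'a \<Rightarrow> complex^'k"
  assumes L2: "\<And>N i. square_integrable M (\<lambda>x. (Y x - S N x) $ i)"
    and lim: "\<And>i. (\<lambda>N. l2norm M (\<lambda>x. (Y x - S N x) $ i)) \<longlonglongrightarrow> 0"
  shows "L2_converges M S Y"
  unfolding L2_converges_def
proof
  show "\<forall>N. integrable M (\<lambda>x. (norm (Y x - S N x))\<^sup>2)"
    using square_integrableD[OF square_integrable_vecI[OF L2]] by blast
  have "(\<lambda>N. \<Sum>i\<in>UNIV. (l2norm M (\<lambda>x. (Y x - S N x) $ i))\<^sup>2) \<longlonglongrightarrow> (\<Sum>i\<in>(UNIV :: 'k set). 0\<^sup>2)"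
    by (intro tendsto_sum tendsto_power lim)
  then show "(\<lambda>N. \<integral>x. (norm (Y x - S N x))\<^sup>2 \<partial>M) \<longlonglongrightarrow> 0"
    by (simp add: l2norm_vec_power2[OF L2] flip: l2norm_power2)
qed

lemma matrix_vector_nth: "((A :: complex^'n^'m) *v v) $ i = (\<Sum>a\<in>UNIV. A $ i $ a * v $ a)"
  by (simp add: matrix_vector_mult_def)

lemma in_past_of_series:
  fixes V :: "int \<Rightarrow> 'a \<Rightarrow> complex^'k" and W :: "'a \<Rightarrow> complex^'m"
  assumes V: "\<And>t l. square_integrable M (\<lambda>x. V t x $ l)" and W: "square_integrable M (\<lambda>x. W x $ i)"
    and lim: "(\<lambda>N. l2norm M (\<lambda>x. (W x - (\<Sum>k<N. c k *v V (t - int k) x)) $ i)) \<longlonglongrightarrow> 0"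
    and "t \<le> n"
  shows "in_past M V n (\<lambda>x. W x $ i)"
proof (rule in_past_closed[OF V W])
  fix e :: real assume "0 < e"
  from order_tendstoD(2)[OF lim this] obtain N
    where N: "l2norm M (\<lambda>x. (W x - (\<Sum>k<N. c k *v V (t - int k) x)) $ i) < e"
    using eventually_happens'[OF sequentially_bot] by blast
  have "in_past M V n (\<lambda>x. \<Sum>k<N. \<Sum>a\<in>UNIV. c k $ i $ a * V (t - int k) x $ a)"
    using \<open>t \<le> n\<close> by (intro in_past_sum in_past_cmult in_past_gen V) simp_all
  then have "in_past M V n (\<lambda>x. (\<Sum>k<N. c k *v V (t - int k) x) $ i)"
    by (simp add: matrix_vector_nth)
  then show "\<exists>Z. in_past M V n Z \<and> l2norm M (\<lambda>x. W x $ i - Z x) < e"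
    using N by (intro exI[of _ "\<lambda>x. (\<Sum>k<N. c k *v V (t - int k) x) $ i"]) simp
qed

section \<open>The fundamental white noise\<close>

lemma row_mat_1: "row i (mat 1 :: complex^'n^'n) = axis i 1"
  by (auto simp: row_def mat_def axis_def vec_eq_iff)

text \<open>A crude constant suffices, as it does not depend on \<open>D\<close>; the entrywise
  bound and two comparisons of Euclidean with sum norms produce the three cardinalities.\<close>

lemma norm_matrix_mult_le:
  fixes D :: "complex^'d^'r" and P :: "complex^'s^'d"
  assumes "\<And>a l. cmod (P $ a $ l) \<le> B"
  shows "norm (D ** P) \<le> (real CARD('r) * real CARD('s) * real CARD('d) * B) * norm D"
proof -
  have entry: "cmod ((D ** P) $ i $ l) \<le> real CARD('d) * (norm D * B)" for i l
  proof -
    have "cmod ((D ** P) $ i $ l) \<le> (\<Sum>a\<in>UNIV. cmod (D $ i $ a) * cmod (P $ a $ l))"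
      unfolding matrix_matrix_mult_def vec_lambda_beta norm_mult[symmetric] by (rule norm_sum)
    also have "\<dots> \<le> (\<Sum>a\<in>(UNIV :: 'd set). norm D * B)"
    proof (intro sum_mono mult_mono assms)
      show "cmod (D $ i $ a) \<le> norm D" for a
        using Finite_Cartesian_Product.norm_nth_le[of "D $ i" a] Finite_Cartesian_Product.norm_nth_le[of D i]
        by linarith
    qed auto
    finally show ?thesis
      by simp
  qed
  have "norm (D ** P) \<le> (\<Sum>i\<in>UNIV. norm ((D ** P) $ i))"
    unfolding norm_vec_def[of "D ** P"] by (rule L2_set_le_sum) simp
  also have "\<dots> \<le> (\<Sum>i\<in>UNIV. \<Sum>l\<in>UNIV. cmod ((D ** P) $ i $ l))"
  proof (rule sum_mono)
    show "norm ((D ** P) $ i) \<le> (\<Sum>l\<in>UNIV. cmod ((D ** P) $ i $ l))" for i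
      unfolding norm_vec_def[of "(D ** P) $ i"] by (rule L2_set_le_sum) simp
  qed
  also have "\<dots> \<le> (\<Sum>i\<in>(UNIV :: 'r set). \<Sum>l\<in>(UNIV :: 's set). real CARD('d) * (norm D * B))"
    by (intro sum_mono entry)
  finally show ?thesis
    by (simp add: mult_ac)
qed

lemma norm_row_le: "norm (row i (A :: complex^'n^'m)) \<le> norm A"
  using Finite_Cartesian_Product.norm_nth_le[of A i] by (simp add: row_def vec_lambda_eta)

lemma fchar_diff: "fchar (j - k) \<omega> = fchar j \<omega> * fchar (- k) \<omega>"
  using fchar_add[of j "- k"] by simp

text \<open>The Moore--Penrose inverse is represented here by the identity
  \<open>left_inverse\<close>, and the bound on the spectral density by the entrywise bound
  \<open>B\<close>. Both hold almost everywhere, like the factorization they come from.\<close>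

locale fundamental_factor = spectral_factor M X \<phi> for M :: "'a measure"
    and X :: "int \<Rightarrow> 'a \<Rightarrow> complex^'d" and \<phi> :: "real \<Rightarrow> complex^'r^'d" +
  fixes \<psi> :: "real \<Rightarrow> complex^'d^'r" and B :: real
  assumes phi_H2: "H2_mat \<phi>" and psi_H2: "H2_mat \<psi>"
    and left_inverse: "AE \<omega> in circ. \<psi> \<omega> ** \<phi> \<omega> = mat 1"
    and phi_bound: "AE \<omega> in circ. \<forall>a l. cmod (\<phi> \<omega> $ a $ l) \<le> B"
begin

abbreviation psi_N :: "nat \<Rightarrow> real \<Rightarrow> complex^'d^'r" where
  "psi_N \<equiv> fpartial (fcoef \<psi>)"

abbreviation phi_N :: "nat \<Rightarrow> real \<Rightarrow> complex^'r^'d" where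
  "phi_N \<equiv> fpartial (fcoef \<phi>)"

lemma psi_error_L2: "square_integrable circ (\<lambda>\<omega>. \<psi> \<omega> - psi_N N \<omega>)"
  by (intro square_integrable_vecI square_integrable_mat_diff psi_H2)

lemma psi_error_tendsto: "(\<lambda>N. l2norm circ (\<lambda>\<omega>. \<psi> \<omega> - psi_N N \<omega>)) \<longlonglongrightarrow> 0"
  unfolding l2norm_tendsto_0_iff by (rule H2_mat_fourier_norm(2)[OF psi_H2])

lemma phi_error_L2: "square_integrable circ (\<lambda>\<omega>. \<phi> \<omega> - phi_N N \<omega>)"
  by (intro square_integrable_vecI square_integrable_mat_diff phi_H2)

lemma phi_error_tendsto: "(\<lambda>N. l2norm circ (\<lambda>\<omega>. \<phi> \<omega> - phi_N N \<omega>)) \<longlonglongrightarrow> 0"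
  unfolding l2norm_tendsto_0_iff by (rule H2_mat_fourier_norm(2)[OF phi_H2])

lemma matrix_mult_phi_measurable:
  assumes "\<And>i a. (\<lambda>\<omega>. D \<omega> $ i $ a) \<in> borel_measurable circ"
  shows "(\<lambda>\<omega>. D \<omega> ** \<phi> \<omega>) \<in> borel_measurable circ"
  by (intro borel_measurable_vecI)
    (simp add: matrix_matrix_mult_def borel_measurable_sum borel_measurable_times assms
      square_integrable_measurable[OF phi_L2])

text \<open>The constant of \<open>norm_matrix_mult_le\<close> for a right factor with
  \<open>CARD('r)\<close> columns; the absolute value makes it visibly nonnegative.\<close>

definition error_const :: real where
  "error_const = real CARD('r) * real CARD('r) * real CARD('d) * \<bar>B\<bar>"

lemma error_const_nonneg: "0 \<le> error_const"
  by (simp add: error_const_def)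

lemma error_phi_bound:
  "AE \<omega> in circ. norm ((\<psi> \<omega> - psi_N N \<omega>) ** \<phi> \<omega>) \<le> error_const * norm (\<psi> \<omega> - psi_N N \<omega>)"
  using phi_bound
proof eventually_elim
  case (elim \<omega>)
  then have "cmod (\<phi> \<omega> $ a $ l) \<le> \<bar>B\<bar>" for a l
    by (metis abs_ge_self order_trans)
  then show ?case
    unfolding error_const_def by (rule norm_matrix_mult_le)
qed

lemma error_phi_measurable: "(\<lambda>\<omega>. (\<psi> \<omega> - psi_N N \<omega>) ** \<phi> \<omega>) \<in> borel_measurable circ"
  by (intro matrix_mult_phi_measurable square_integrable_measurable square_integrable_mat_diff psi_H2)

lemma error_phi_L2: "square_integrable circ (\<lambda>\<omega>. (\<psi> \<omega> - psi_N N \<omega>) ** \<phi> \<omega>)"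
  by (rule square_integrable_bound[OF psi_error_L2 error_phi_measurable error_phi_bound])

text \<open>The decisive use of the bound on \<phi>: the L^2 convergence of the Fourier series of
  \<psi> survives multiplication by \<phi>.\<close>

lemma error_phi_tendsto: "(\<lambda>N. l2norm circ (\<lambda>\<omega>. (\<psi> \<omega> - psi_N N \<omega>) ** \<phi> \<omega>)) \<longlonglongrightarrow> 0"
proof (rule tendsto_sandwich[OF _ _ tendsto_const])
  show "(\<lambda>N. error_const * l2norm circ (\<lambda>\<omega>. \<psi> \<omega> - psi_N N \<omega>)) \<longlonglongrightarrow> 0"
    using tendsto_mult_left[OF psi_error_tendsto, of error_const] by simp
  show "\<forall>\<^sub>F N in sequentially. l2norm circ (\<lambda>\<omega>. (\<psi> \<omega> - psi_N N \<omega>) ** \<phi> \<omega>)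
      \<le> error_const * l2norm circ (\<lambda>\<omega>. \<psi> \<omega> - psi_N N \<omega>)"
    by (intro always_eventually allI l2norm_bound[OF psi_error_L2 error_phi_measurable error_const_nonneg error_phi_bound])
qed simp

text \<open>The lag \<open>k\<close> becomes the character \<open>- k\<close>, so the coefficients
  of the filter assemble into the partial sum of \<psi>, acting on \<phi> from the left.\<close>

lemma spectral_pair_series:
  "spectral_pair (\<lambda>x. (\<Sum>k<N. fcoef \<psi> k *v X (t - int k) x) $ i)
    (\<lambda>\<omega>. fchar t \<omega> *s row i (psi_N N \<omega> ** \<phi> \<omega>))"
proof -
  have "spectral_pair (\<lambda>x. \<Sum>k<N. \<Sum>a\<in>UNIV. fcoef \<psi> k $ i $ a * X (t - int k) x $ a)
      (\<lambda>\<omega>. \<Sum>k<N. \<Sum>a\<in>UNIV. fcoef \<psi> k $ i $ a *s (fchar (t - int k) \<omega> *s row a (\<phi> \<omega>)))"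
    by (intro spectral_pair_sum spectral_pair_smult spectral_pair_gen)
  moreover have "(\<Sum>k<N. \<Sum>a\<in>UNIV. fcoef \<psi> k $ i $ a *s (fchar (t - int k) \<omega> *s row a (\<phi> \<omega>)))
      = fchar t \<omega> *s row i (psi_N N \<omega> ** \<phi> \<omega>)" for \<omega>
  proof -
    have "(\<Sum>k<N. \<Sum>a\<in>UNIV. fcoef \<psi> k $ i $ a * (fchar (t - int k) \<omega> * \<phi> \<omega> $ a $ l))
        = fchar t \<omega> * (\<Sum>a\<in>UNIV. psi_N N \<omega> $ i $ a * \<phi> \<omega> $ a $ l)" for l
      unfolding fpartial_entry sum_distrib_left sum_distrib_right fchar_diff
      by (subst sum.swap) (simp only: mult_ac)
    then show ?thesis
      by (simp add: vec_eq_iff row_def matrix_matrix_mult_def mult.assoc)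
  qed
  ultimately show ?thesis
    by (simp add: matrix_vector_nth)
qed

lemma axis_L2: "square_integrable circ (\<lambda>\<omega>. fchar t \<omega> *s axis i 1 :: complex^'r)"
proof (rule square_integrable_vecI)
  show "square_integrable circ (\<lambda>\<omega>. (fchar t \<omega> *s axis i 1 :: complex^'r) $ l)" for l
    using square_integrable_cmult[OF square_integrable_fchar, of "axis i 1 $ l" t]
    by (simp add: mult.commute)
qed

text \<open>Almost everywhere \<open>\<psi> \<omega> ** \<phi> \<omega>\<close> is the identity, so
  the difference is a row of the product error up to a factor of modulus 1.\<close>

lemma noise_limit:
  "(\<lambda>N. l2norm circ (\<lambda>\<omega>. fchar t \<omega> *s axis i 1 - fchar t \<omega> *s row i (psi_N N \<omega> ** \<phi> \<omega>))) \<longlonglongrightarrow> 0"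
proof (rule tendsto_sandwich[OF _ _ tendsto_const error_phi_tendsto])
  show "\<forall>\<^sub>F N in sequentially.
      l2norm circ (\<lambda>\<omega>. fchar t \<omega> *s axis i 1 - fchar t \<omega> *s row i (psi_N N \<omega> ** \<phi> \<omega>))
      \<le> l2norm circ (\<lambda>\<omega>. (\<psi> \<omega> - psi_N N \<omega>) ** \<phi> \<omega>)"
  proof (intro always_eventually allI)
    fix N
    have "l2norm circ (\<lambda>\<omega>. fchar t \<omega> *s axis i 1 - fchar t \<omega> *s row i (psi_N N \<omega> ** \<phi> \<omega>))
        \<le> 1 * l2norm circ (\<lambda>\<omega>. (\<psi> \<omega> - psi_N N \<omega>) ** \<phi> \<omega>)"
    proof (rule l2norm_bound[OF error_phi_L2])
      show "(\<lambda>\<omega>. fchar t \<omega> *s axis i 1 - fchar t \<omega> *s row i (psi_N N \<omega> ** \<phi> \<omega>)) \<in> borel_measurable circ"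
        by (intro square_integrable_measurable square_integrable_diff axis_L2
            spectral_pair_L2(2)[OF spectral_pair_series])
      show "AE \<omega> in circ. norm (fchar t \<omega> *s axis i 1 - fchar t \<omega> *s row i (psi_N N \<omega> ** \<phi> \<omega>))
          \<le> 1 * norm ((\<psi> \<omega> - psi_N N \<omega>) ** \<phi> \<omega>)"
        using left_inverse
      proof eventually_elim
        case (elim \<omega>)
        have "(\<psi> \<omega> - psi_N N \<omega>) ** \<phi> \<omega> = mat 1 - psi_N N \<omega> ** \<phi> \<omega>"
          unfolding elim[symmetric]
          by (simp add: vec_eq_iff matrix_matrix_mult_def left_diff_distrib sum_subtractf)
        then have "row i ((\<psi> \<omega> - psi_N N \<omega>) ** \<phi> \<omega>) = axis i 1 - row i (psi_N N \<omega> ** \<phi> \<omega>)"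
          unfolding row_mat_1[symmetric] by (simp add: row_def vec_eq_iff)
        then have "fchar t \<omega> *s axis i 1 - fchar t \<omega> *s row i (psi_N N \<omega> ** \<phi> \<omega>)
            = fchar t \<omega> *s row i ((\<psi> \<omega> - psi_N N \<omega>) ** \<phi> \<omega>)"
          by (simp add: vector_ssub_ldistrib)
        then show ?case
          using norm_row_le[of i "(\<psi> \<omega> - psi_N N \<omega>) ** \<phi> \<omega>"] by (simp add: norm_smult_vec)
      qed
    qed simp
    then show "l2norm circ (\<lambda>\<omega>. fchar t \<omega> *s axis i 1 - fchar t \<omega> *s row i (psi_N N \<omega> ** \<phi> \<omega>))
        \<le> l2norm circ (\<lambda>\<omega>. (\<psi> \<omega> - psi_N N \<omega>) ** \<phi> \<omega>)"
      by simp
  qed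
qed simp

lemma noise_exists:
  obtains \<xi> :: "int \<Rightarrow> 'a \<Rightarrow> complex^'r"
  where "\<And>t i. spectral_pair (\<lambda>x. \<xi> t x $ i) (\<lambda>\<omega>. fchar t \<omega> *s axis i 1)"
    and "\<And>t i. (\<lambda>N. l2norm M (\<lambda>x. (\<xi> t x - (\<Sum>k<N. fcoef \<psi> k *v X (t - int k) x)) $ i)) \<longlonglongrightarrow> 0"
proof -
  \<comment> \<open>\<open>spectral_pair_limit\<close> delivers one scalar variable at a time, so
    times and components are gathered into a vector process by choice.\<close>
  define P where "P t i Z \<longleftrightarrow> spectral_pair Z (\<lambda>\<omega>. fchar t \<omega> *s axis i 1) \<and>
      (\<lambda>N. l2norm M (\<lambda>x. Z x - (\<Sum>k<N. fcoef \<psi> k *v X (t - int k) x) $ i)) \<longlonglongrightarrow> 0" for t i Z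
  have "\<exists>Z. P t i Z" for t i
    unfolding P_def by (rule spectral_pair_limit[OF spectral_pair_series axis_L2 noise_limit]) blast
  then have "P t i (SOME Z. P t i Z)" for t i
    by (rule someI_ex)
  then obtain Z where "\<And>t i. P t i (Z t i)"
    by (rule that[of "\<lambda>t i. SOME Z. P t i Z"])
  then have Z: "spectral_pair (Z t i) (\<lambda>\<omega>. fchar t \<omega> *s axis i 1)"
      "(\<lambda>N. l2norm M (\<lambda>x. Z t i x - (\<Sum>k<N. fcoef \<psi> k *v X (t - int k) x) $ i)) \<longlonglongrightarrow> 0" for t i
    unfolding P_def by blast+
  show ?thesis
    by (rule that[of "\<lambda>t x. \<chi> i. Z t i x"]) (use Z in simp_all)
qed

section \<open>White noise, Wold series and equality of pasts\<close>

context
  fixes \<xi> :: "int \<Rightarrow> 'a \<Rightarrow> complex^'r"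
  assumes \<xi>: "\<And>t i. spectral_pair (\<lambda>x. \<xi> t x $ i) (\<lambda>\<omega>. fchar t \<omega> *s axis i 1)"
    and \<xi>_lim: "\<And>t i. (\<lambda>N. l2norm M (\<lambda>x. (\<xi> t x - (\<Sum>k<N. fcoef \<psi> k *v X (t - int k) x)) $ i)) \<longlonglongrightarrow> 0"
begin

lemma noise_L2: "square_integrable M (\<lambda>x. \<xi> t x $ i)"
  by (rule spectral_pair_L2(1)[OF \<xi>])

text \<open>On the spectral side the noise consists of characters times unit vectors; their inner
  products are 2 pi or 0, and 2 pi is the factor of the isometry.\<close>

lemma noise_orthonormal: "orthonormal_white_noise M \<xi>"
  unfolding orthonormal_white_noise_def L2_rvec_def L2_rv_iff
proof (intro conjI allI)
  show "square_integrable M (\<lambda>x. \<xi> t x $ i)" for t i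
    by (rule noise_L2)
  show "(\<integral>x. \<xi> t x $ l \<partial>M) = 0" for t l
    by (rule spectral_pair_mean[OF \<xi>])
  show "(\<integral>x. \<xi> s x $ i * cnj (\<xi> t x $ j) \<partial>M) = (if s = t \<and> i = j then 1 else 0)" for s t i j
  proof -
    have "of_real (2 * pi) * (\<integral>x. \<xi> s x $ i * cnj (\<xi> t x $ j) \<partial>M)
        = (\<Sum>l\<in>UNIV. \<integral>\<omega>. (fchar s \<omega> *s axis i 1) $ l * cnj ((fchar t \<omega> *s axis j 1) $ l) \<partial>circ)"
      by (rule spectral_pair_inner[OF \<xi> \<xi>])
    also have "\<dots> = (\<Sum>l\<in>UNIV. if l = i then (if i = j then (\<integral>\<omega>. fchar (s - t) \<omega> \<partial>circ) else 0) else 0)"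
      by (intro sum.cong refl) (auto simp: axis_def simp flip: fchar_diff)
    also have "\<dots> = (if i = j then (\<integral>\<omega>. fchar (s - t) \<omega> \<partial>circ) else 0)"
      by simp
    also have "\<dots> = of_real (2 * pi) * (if s = t \<and> i = j then 1 else 0)"
      by (simp add: integral_fchar)
    finally show ?thesis
      unfolding mult_cancel_left by auto
  qed
qed

lemma noise_series: "L2_converges M (\<lambda>N x. \<Sum>k<N. fcoef \<psi> k *v X (t - int k) x) (\<xi> t)"
proof (rule L2_convergesI)
  show "square_integrable M (\<lambda>x. (\<xi> t x - (\<Sum>k<N. fcoef \<psi> k *v X (t - int k) x)) $ i)" for N i
    unfolding vector_minus_component
    by (intro square_integrable_diff noise_L2 spectral_pair_L2(1)[OF spectral_pair_series])
qed (rule \<xi>_lim)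

text \<open>Since \<xi> corresponds to characters times unit vectors, the filter with coefficients
  of \<phi> reproduces the partial sum of \<phi> itself, and the Fourier remainder appears without a
  further matrix factor.\<close>

lemma wold_error:
  "spectral_pair (\<lambda>x. (X t x - (\<Sum>j<N. fcoef \<phi> j *v \<xi> (t - int j) x)) $ i)
    (\<lambda>\<omega>. fchar t \<omega> *s row i (\<phi> \<omega> - phi_N N \<omega>))"
proof -
  have "spectral_pair (\<lambda>x. X t x $ i - (\<Sum>j<N. \<Sum>a\<in>UNIV. fcoef \<phi> j $ i $ a * \<xi> (t - int j) x $ a))
      (\<lambda>\<omega>. fchar t \<omega> *s row i (\<phi> \<omega>)
        - (\<Sum>j<N. \<Sum>a\<in>UNIV. fcoef \<phi> j $ i $ a *s (fchar (t - int j) \<omega> *s axis a 1)))"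
    by (intro spectral_pair_diff spectral_pair_sum spectral_pair_smult spectral_pair_gen \<xi>)
  moreover have "fchar t \<omega> *s row i (\<phi> \<omega>)
        - (\<Sum>j<N. \<Sum>a\<in>UNIV. fcoef \<phi> j $ i $ a *s (fchar (t - int j) \<omega> *s axis a 1))
      = fchar t \<omega> *s row i (\<phi> \<omega> - phi_N N \<omega>)" for \<omega>
  proof -
    have "(\<Sum>j<N. \<Sum>a\<in>UNIV. fcoef \<phi> j $ i $ a * (fchar (t - int j) \<omega> * (axis a 1 :: complex^'r) $ l))
        = fchar t \<omega> * phi_N N \<omega> $ i $ l" for l
    proof -
      have "(\<Sum>a\<in>UNIV. fcoef \<phi> j $ i $ a * (fchar (t - int j) \<omega> * (axis a 1 :: complex^'r) $ l))
          = fcoef \<phi> j $ i $ l * fchar (t - int j) \<omega>" for j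
        by (simp add: axis_def if_distrib cong: if_cong)
      then show ?thesis
        unfolding fpartial_entry sum_distrib_left fchar_diff by (simp add: mult_ac)
    qed
    then show ?thesis
      by (simp add: vec_eq_iff row_def right_diff_distrib mult.assoc)
  qed
  ultimately show ?thesis
    by (simp add: matrix_vector_nth)
qed

lemma wold_tendsto:
  "(\<lambda>N. l2norm M (\<lambda>x. (X t x - (\<Sum>j<N. fcoef \<phi> j *v \<xi> (t - int j) x)) $ i)) \<longlonglongrightarrow> 0"
proof (rule tendsto_sandwich[OF _ _ tendsto_const])
  show "(\<lambda>N. l2norm circ (\<lambda>\<omega>. \<phi> \<omega> - phi_N N \<omega>) / sqrt (2 * pi)) \<longlonglongrightarrow> 0"
    using tendsto_divide[OF phi_error_tendsto tendsto_const[of "sqrt (2 * pi)"]] by simp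
  show "\<forall>\<^sub>F N in sequentially. l2norm M (\<lambda>x. (X t x - (\<Sum>j<N. fcoef \<phi> j *v \<xi> (t - int j) x)) $ i)
      \<le> l2norm circ (\<lambda>\<omega>. \<phi> \<omega> - phi_N N \<omega>) / sqrt (2 * pi)"
  proof (intro always_eventually allI)
    fix N
    have "sqrt (2 * pi) * l2norm M (\<lambda>x. (X t x - (\<Sum>j<N. fcoef \<phi> j *v \<xi> (t - int j) x)) $ i)
        = l2norm circ (\<lambda>\<omega>. fchar t \<omega> *s row i (\<phi> \<omega> - phi_N N \<omega>))"
      by (rule spectral_pair_isometry[OF wold_error])
    also have "\<dots> \<le> 1 * l2norm circ (\<lambda>\<omega>. \<phi> \<omega> - phi_N N \<omega>)"
    proof (rule l2norm_bound[OF phi_error_L2])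
      show "(\<lambda>\<omega>. fchar t \<omega> *s row i (\<phi> \<omega> - phi_N N \<omega>)) \<in> borel_measurable circ"
        by (rule square_integrable_measurable[OF spectral_pair_L2(2)[OF wold_error]])
    qed (simp_all add: norm_smult_vec norm_row_le)
    finally show "l2norm M (\<lambda>x. (X t x - (\<Sum>j<N. fcoef \<phi> j *v \<xi> (t - int j) x)) $ i)
        \<le> l2norm circ (\<lambda>\<omega>. \<phi> \<omega> - phi_N N \<omega>) / sqrt (2 * pi)"
      by (simp add: pos_le_divide_eq mult.commute)
  qed
qed simp

lemma wold_series: "L2_converges M (\<lambda>N x. \<Sum>j<N. fcoef \<phi> j *v \<xi> (t - int j) x) (X t)"
  by (rule L2_convergesI[OF spectral_pair_L2(1)[OF wold_error] wold_tendsto])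

text \<open>Both series run over lags \<open>k \<ge> 0\<close> only, so every component up to time
  \<open>n\<close> of either process lies in the past \<open>n\<close> of the other.\<close>

lemma noise_fundamental: "fundamental_process M X \<xi>"
  unfolding fundamental_process_def
proof (intro conjI allI noise_orthonormal iffI)
  fix n Y
  show "in_past M X n Y" if "in_past M \<xi> n Y"
    by (rule in_past_trans[OF X_L2 in_past_of_series[OF X_L2 noise_L2 \<xi>_lim] that])
  show "in_past M \<xi> n Y" if "in_past M X n Y"
    by (rule in_past_trans[OF noise_L2 in_past_of_series[OF noise_L2 X_L2 wold_tendsto] that])
qed

end

end

section \<open>Stochastic integrals\<close>

lemma trace_gram: "trace (A ** cadj A) = complex_of_real ((norm (A :: complex^'n^'m))\<^sup>2)"
  unfolding norm_mat_power2 of_real_sum complex_norm_square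
  by (simp add: trace_def matrix_matrix_mult_def cadj_def)

text \<open>Turns the integrand in \<open>stoch_int\<close> into a Frobenius norm: the seminorm of
  the spectral measure at \<open>D\<close> is the L^2 norm of \<open>D ** P\<close>.\<close>

lemma trace_quadratic_form:
  fixes D :: "complex^'d^'r" and P :: "complex^'s^'d"
  shows "Re (trace (D ** (c *\<^sub>R (P ** cadj P)) ** cadj D)) = c * (norm (D ** P))\<^sup>2"
proof -
  have "D ** (c *\<^sub>R (P ** cadj P)) ** cadj D = c *\<^sub>R ((D ** P) ** cadj (D ** P))"
  proof -
    have "D ** (c *\<^sub>R Q) = c *\<^sub>R (D ** Q)" for Q :: "complex^'d^'d"
      by (simp add: vec_eq_iff matrix_matrix_mult_def scaleR_sum_right)
    moreover have "(c *\<^sub>R Q) ** cadj D = c *\<^sub>R (Q ** cadj D)" for Q :: "complex^'d^'r"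
      by (simp add: vec_eq_iff matrix_matrix_mult_def scaleR_sum_right)
    ultimately show ?thesis
      by (simp add: cadj_mult matrix_mul_assoc)
  qed
  then have "trace (D ** (c *\<^sub>R (P ** cadj P)) ** cadj D) = c *\<^sub>R trace ((D ** P) ** cadj (D ** P))"
    by (simp add: trace_def scaleR_sum_right)
  then show ?thesis
    by (simp add: trace_gram)
qed

lemma cnj_measurable: "f \<in> borel_measurable M \<Longrightarrow> (\<lambda>x. cnj (f x)) \<in> borel_measurable M"
  by (rule borel_measurable_continuous_on[where f = cnj]) (intro continuous_intros)

text \<open>The factorization holds only almost everywhere, so measurability of the integrand is
  derived from that of \<open>f\<close> and \<open>D\<close> before the integrals are
  compared.\<close>

lemma quadratic_form_integral:
  fixes D :: "real \<Rightarrow> complex^'d^'r" and f :: "real \<Rightarrow> complex^'d^'d" and \<phi> :: "real \<Rightarrow> complex^'s^'d"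
  assumes f: "\<And>i j. (\<lambda>\<omega>. f \<omega> $ i $ j) \<in> borel_measurable circ"
    and D: "\<And>i j. (\<lambda>\<omega>. D \<omega> $ i $ j) \<in> borel_measurable circ"
    and fact: "AE \<omega> in circ. f \<omega> = (1 / (2 * pi)) *\<^sub>R (\<phi> \<omega> ** cadj (\<phi> \<omega>))"
    and L2: "square_integrable circ (\<lambda>\<omega>. D \<omega> ** \<phi> \<omega>)"
  shows "integrable circ (\<lambda>\<omega>. Re (trace (D \<omega> ** f \<omega> ** cadj (D \<omega>))))"
    and "(\<integral>\<omega>. Re (trace (D \<omega> ** f \<omega> ** cadj (D \<omega>))) \<partial>circ) = (l2norm circ (\<lambda>\<omega>. D \<omega> ** \<phi> \<omega>))\<^sup>2 / (2 * pi)"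
proof -
  have meas: "(\<lambda>\<omega>. Re (trace (D \<omega> ** f \<omega> ** cadj (D \<omega>)))) \<in> borel_measurable circ"
    unfolding trace_def matrix_matrix_mult_def cadj_def vec_lambda_beta
    by (rule measurable_compose[OF _ borel_measurable_Re])
      (intro borel_measurable_sum borel_measurable_times f D cnj_measurable)
  have AE: "AE \<omega> in circ. Re (trace (D \<omega> ** f \<omega> ** cadj (D \<omega>))) = 1 / (2 * pi) * (norm (D \<omega> ** \<phi> \<omega>))\<^sup>2"
    using fact by eventually_elim (simp only: trace_quadratic_form)
  have int: "integrable circ (\<lambda>\<omega>. 1 / (2 * pi) * (norm (D \<omega> ** \<phi> \<omega>))\<^sup>2)"
    using square_integrableD[OF L2] by (rule integrable_mult_right)
  then show "integrable circ (\<lambda>\<omega>. Re (trace (D \<omega> ** f \<omega> ** cadj (D \<omega>))))"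
    using integrable_cong_AE[OF meas _ AE] by blast
  have "(\<integral>\<omega>. Re (trace (D \<omega> ** f \<omega> ** cadj (D \<omega>))) \<partial>circ)
      = (\<integral>\<omega>. 1 / (2 * pi) * (norm (D \<omega> ** \<phi> \<omega>))\<^sup>2 \<partial>circ)"
    by (rule integral_cong_AE[OF meas borel_measurable_integrable[OF int] AE])
  then show "(\<integral>\<omega>. Re (trace (D \<omega> ** f \<omega> ** cadj (D \<omega>))) \<partial>circ) = (l2norm circ (\<lambda>\<omega>. D \<omega> ** \<phi> \<omega>))\<^sup>2 / (2 * pi)"
    by (simp add: l2norm_power2)
qed

lemma cmscale_mult: "cmscale c A ** B = cmscale c (A ** B)"
  by (simp add: cmscale_def matrix_matrix_mult_def vec_eq_iff sum_distrib_left mult.assoc)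

lemma norm_cmscale: "cmod c = 1 \<Longrightarrow> norm (cmscale c A) = norm A"
proof -
  assume "cmod c = 1"
  then have "(norm (cmscale c A))\<^sup>2 = (norm A)\<^sup>2"
    unfolding norm_mat_power2 by (simp add: cmscale_def norm_mult)
  then show ?thesis
    by (simp add: power2_eq_iff_nonneg)
qed

lemma cmscale_diff: "cmscale c A - cmscale c B = cmscale c (A - B)"
  by (simp add: cmscale_def vec_eq_iff right_diff_distrib)

text \<open>\<open>stoch_int\<close> indexes its polynomials by times \<open>s\<close>, the series
  by lags \<open>k\<close>; the change of variable is \<open>s = t - k\<close>, inverted by
  \<open>nat (t - s)\<close>.\<close>

lemma shifted_sum:
  fixes F :: "int \<Rightarrow> nat \<Rightarrow> 'b::comm_monoid_add"
  shows "(\<Sum>s\<in>(\<lambda>k. t - int k) ` {..<N}. F s (nat (t - s))) = (\<Sum>k<N. F (t - int k) k)"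
  by (subst sum.reindex) (auto simp: inj_on_def)

lemma shifted_fpartial:
  "(\<Sum>s\<in>(\<lambda>k. t - int k) ` {..<N}. cmscale (fchar s \<omega>) (c (nat (t - s))))
    = cmscale (fchar t \<omega>) (fpartial c N \<omega>)"
proof -
  have "(\<Sum>s\<in>(\<lambda>k. t - int k) ` {..<N}. cmscale (fchar s \<omega>) (c (nat (t - s))))
      = (\<Sum>k<N. cmscale (fchar (t - int k) \<omega>) (c k))"
    by (rule shifted_sum[where F = "\<lambda>s k. cmscale (fchar s \<omega>) (c k)"])
  also have "\<dots> = cmscale (fchar t \<omega>) (fpartial c N \<omega>)"
    unfolding vec_eq_iff cmscale_def fchar_diff
    by (simp add: fpartial_entry sum_distrib_left mult_ac)
  finally show ?thesis .
qed

text \<open>One trigonometric polynomial serves both demands of the definition: the character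
  \<open>t\<close> times a partial sum of \<psi> is close in the spectral seminorm by
  \<open>error_phi_tendsto\<close>, and its image is a partial sum of the series for
  \<open>Y\<close>.\<close>

lemma (in fundamental_factor) stoch_int_noise:
  assumes f: "\<And>i j. (\<lambda>\<omega>. f \<omega> $ i $ j) \<in> borel_measurable circ"
    and fact: "AE \<omega> in circ. f \<omega> = (1 / (2 * pi)) *\<^sub>R (\<phi> \<omega> ** cadj (\<phi> \<omega>))"
    and Y: "L2_rvec M Y"
    and conv: "L2_converges M (\<lambda>N x. \<Sum>k<N. fcoef \<psi> k *v X (t - int k) x) Y"
  shows "stoch_int M X f (\<lambda>\<omega>. cmscale (exp (\<i> * of_int t * of_real \<omega>)) (\<psi> \<omega>)) Y"
  unfolding stoch_int_def fchar_def[symmetric] integrable_circ[symmetric] integral_circ[symmetric]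
proof (intro conjI allI impI Y)
  have psi_meas: "(\<lambda>\<omega>. \<psi> \<omega> $ i $ j) \<in> borel_measurable circ" for i j
    by (rule square_integrable_measurable[OF H2_mat_square_integrable[OF psi_H2]])
  have scale_meas: "(\<lambda>\<omega>. cmscale (fchar t \<omega>) (D \<omega>) $ i $ j) \<in> borel_measurable circ"
    if "\<And>i j. (\<lambda>\<omega>. D \<omega> $ i $ j) \<in> borel_measurable circ" for D :: "real \<Rightarrow> complex^'d^'r" and i j
    using that by (simp add: cmscale_def)
  have scale_L2: "square_integrable circ (\<lambda>\<omega>. cmscale (fchar t \<omega>) (D \<omega>) ** \<phi> \<omega>)"
    and scale_norm: "l2norm circ (\<lambda>\<omega>. cmscale (fchar t \<omega>) (D \<omega>) ** \<phi> \<omega>) = l2norm circ (\<lambda>\<omega>. D \<omega> ** \<phi> \<omega>)"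
    if "\<And>i j. (\<lambda>\<omega>. D \<omega> $ i $ j) \<in> borel_measurable circ" "square_integrable circ (\<lambda>\<omega>. D \<omega> ** \<phi> \<omega>)"
    for D :: "real \<Rightarrow> complex^'d^'r"
    subgoal
    proof (rule square_integrable_bound[OF that(2), where C = 1])
      show "(\<lambda>\<omega>. cmscale (fchar t \<omega>) (D \<omega>) ** \<phi> \<omega>) \<in> borel_measurable circ"
        by (intro matrix_mult_phi_measurable scale_meas that)
    qed (simp add: cmscale_mult norm_cmscale)
    subgoal
      by (simp add: l2norm_def cmscale_mult norm_cmscale)
    done
  \<comment> \<open>The product is almost everywhere the constant identity matrix, which is square
    integrable on a finite measure.\<close>
  have "square_integrable circ (\<lambda>\<omega>. \<psi> \<omega> ** \<phi> \<omega>)"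
  proof (rule square_integrable_bound[where f = "\<lambda>\<omega>. mat 1 :: complex^'r^'r" and C = 1])
    show "square_integrable circ (\<lambda>\<omega>. mat 1 :: complex^'r^'r)"
      by (simp add: square_integrable_def)
    show "AE \<omega> in circ. norm (\<psi> \<omega> ** \<phi> \<omega>) \<le> 1 * norm (mat 1 :: complex^'r^'r)"
      using left_inverse by eventually_elim simp
  qed (intro matrix_mult_phi_measurable psi_meas)
  then show "integrable circ (\<lambda>\<omega>. Re (trace (cmscale (fchar t \<omega>) (\<psi> \<omega>) ** f \<omega> ** cadj (cmscale (fchar t \<omega>) (\<psi> \<omega>)))))"
    by (intro quadratic_form_integral(1)[OF f _ fact] scale_meas scale_L2 psi_meas)
  fix e :: real assume "0 < e"
  have "(\<lambda>N. (l2norm circ (\<lambda>\<omega>. (\<psi> \<omega> - psi_N N \<omega>) ** \<phi> \<omega>))\<^sup>2 / (2 * pi)) \<longlonglongrightarrow> 0\<^sup>2 / (2 * pi)"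
    by (intro tendsto_intros error_phi_tendsto) simp
  then have "\<forall>\<^sub>F N in sequentially. (l2norm circ (\<lambda>\<omega>. (\<psi> \<omega> - psi_N N \<omega>) ** \<phi> \<omega>))\<^sup>2 / (2 * pi) < e"
    using \<open>0 < e\<close> by (intro order_tendstoD(2)) auto
  moreover have "\<forall>\<^sub>F N in sequentially. (\<integral>x. (norm (Y x - (\<Sum>k<N. fcoef \<psi> k *v X (t - int k) x)))\<^sup>2 \<partial>M) < e"
    using conv \<open>0 < e\<close> unfolding L2_converges_def by (intro order_tendstoD(2)) auto
  ultimately have "\<forall>\<^sub>F N in sequentially. (l2norm circ (\<lambda>\<omega>. (\<psi> \<omega> - psi_N N \<omega>) ** \<phi> \<omega>))\<^sup>2 / (2 * pi) < e \<and>
      (\<integral>x. (norm (Y x - (\<Sum>k<N. fcoef \<psi> k *v X (t - int k) x)))\<^sup>2 \<partial>M) < e"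
    by (rule eventually_conj)
  then obtain N where N: "(l2norm circ (\<lambda>\<omega>. (\<psi> \<omega> - psi_N N \<omega>) ** \<phi> \<omega>))\<^sup>2 / (2 * pi) < e"
      "(\<integral>x. (norm (Y x - (\<Sum>k<N. fcoef \<psi> k *v X (t - int k) x)))\<^sup>2 \<partial>M) < e"
    using eventually_happens'[OF sequentially_bot] by blast
  \<comment> \<open>The times \<open>t - k\<close> occurring in the partial sum, with the
    coefficient at time \<open>s\<close> found at lag \<open>t - s\<close>.\<close>
  define S where "S = (\<lambda>k. t - int k) ` {..<N}"
  define A where "A s = fcoef \<psi> (nat (t - s))" for s
  have D: "cmscale (fchar t \<omega>) (\<psi> \<omega>) - (\<Sum>s\<in>S. cmscale (fchar s \<omega>) (A s))
      = cmscale (fchar t \<omega>) (\<psi> \<omega> - psi_N N \<omega>)" for \<omega>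
    unfolding S_def A_def cmscale_diff[symmetric] by (simp only: shifted_fpartial)
  have XS: "(\<Sum>s\<in>S. A s *v X s x) = (\<Sum>k<N. fcoef \<psi> k *v X (t - int k) x)" for x
    unfolding S_def A_def by (rule shifted_sum[where F = "\<lambda>s k. fcoef \<psi> k *v X s x"])
  have error_meas: "(\<lambda>\<omega>. (\<psi> \<omega> - psi_N N \<omega>) $ i $ j) \<in> borel_measurable circ" for i j
    by (intro square_integrable_measurable square_integrable_mat_diff psi_H2)
  note quad = quadratic_form_integral[OF f scale_meas[OF error_meas] fact scale_L2[OF error_meas error_phi_L2]]
  show "\<exists>S A. finite S \<and>
      integrable circ (\<lambda>\<omega>. let D = cmscale (fchar t \<omega>) (\<psi> \<omega>) - (\<Sum>s\<in>S. cmscale (fchar s \<omega>) (A s))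
        in Re (trace (D ** f \<omega> ** cadj D))) \<and>
      (\<integral>\<omega>. (let D = cmscale (fchar t \<omega>) (\<psi> \<omega>) - (\<Sum>s\<in>S. cmscale (fchar s \<omega>) (A s))
        in Re (trace (D ** f \<omega> ** cadj D))) \<partial>circ) < e \<and>
      integrable M (\<lambda>x. (norm (Y x - (\<Sum>s\<in>S. A s *v X s x)))\<^sup>2) \<and>
      (\<integral>x. (norm (Y x - (\<Sum>s\<in>S. A s *v X s x)))\<^sup>2 \<partial>M) < e"
  proof (intro exI[of _ S] exI[of _ A] conjI)
    show "finite S"
      by (simp add: S_def)
    show "integrable circ (\<lambda>\<omega>. let D = cmscale (fchar t \<omega>) (\<psi> \<omega>) - (\<Sum>s\<in>S. cmscale (fchar s \<omega>) (A s))
        in Re (trace (D ** f \<omega> ** cadj D)))"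
      unfolding D Let_def by (rule quad(1))
    show "(\<integral>\<omega>. (let D = cmscale (fchar t \<omega>) (\<psi> \<omega>) - (\<Sum>s\<in>S. cmscale (fchar s \<omega>) (A s))
        in Re (trace (D ** f \<omega> ** cadj D))) \<partial>circ) < e"
      unfolding D Let_def quad(2) scale_norm[OF error_meas error_phi_L2] by (rule N(1))
    show "integrable M (\<lambda>x. (norm (Y x - (\<Sum>s\<in>S. A s *v X s x)))\<^sup>2)"
      unfolding XS using conv by (simp add: L2_converges_def)
    show "(\<integral>x. (norm (Y x - (\<Sum>s\<in>S. A s *v X s x)))\<^sup>2 \<partial>M) < e"
      unfolding XS by (rule N(2))
  qed
qed

section \<open>From the spectral hypotheses to the isometry\<close>

lemma covariance_factorization:
  fixes f :: "real \<Rightarrow> complex^'d^'d" and \<phi> :: "real \<Rightarrow> complex^'r^'d"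
  assumes f: "\<And>i j. (\<lambda>\<omega>. f \<omega> $ i $ j) \<in> borel_measurable circ"
    and fact: "AE \<omega> in circ. f \<omega> = (1 / (2 * pi)) *\<^sub>R (\<phi> \<omega> ** cadj (\<phi> \<omega>))"
    and phi: "\<And>i l. square_integrable circ (\<lambda>\<omega>. \<phi> \<omega> $ i $ l)"
  shows "of_real (2 * pi) * (\<integral>\<omega>. fchar (s - t) \<omega> * f \<omega> $ i $ j \<partial>circ)
    = (\<Sum>l\<in>UNIV. \<integral>\<omega>. (fchar s \<omega> * \<phi> \<omega> $ i $ l) * cnj (fchar t \<omega> * \<phi> \<omega> $ j $ l) \<partial>circ)"
proof -
  have fphi: "square_integrable circ (\<lambda>\<omega>. fchar t \<omega> * \<phi> \<omega> $ i $ l)" for t i l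
    by (rule square_integrable_fchar_mult[OF phi])
  have int: "integrable circ (\<lambda>\<omega>. (fchar s \<omega> * \<phi> \<omega> $ i $ l) * cnj (fchar t \<omega> * \<phi> \<omega> $ j $ l))" for l
    by (rule square_integrable_mult_cnj[OF fphi fphi])
  have "of_real (2 * pi) * (\<integral>\<omega>. fchar (s - t) \<omega> * f \<omega> $ i $ j \<partial>circ)
      = (\<integral>\<omega>. of_real (2 * pi) * (fchar (s - t) \<omega> * f \<omega> $ i $ j) \<partial>circ)"
    by simp
  also have "\<dots> = (\<integral>\<omega>. (\<Sum>l\<in>UNIV. (fchar s \<omega> * \<phi> \<omega> $ i $ l) * cnj (fchar t \<omega> * \<phi> \<omega> $ j $ l)) \<partial>circ)"
  proof (rule integral_cong_AE)
    show "(\<lambda>\<omega>. of_real (2 * pi) * (fchar (s - t) \<omega> * f \<omega> $ i $ j)) \<in> borel_measurable circ"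
      using f[of i j] by measurable
    show "(\<lambda>\<omega>. \<Sum>l\<in>UNIV. (fchar s \<omega> * \<phi> \<omega> $ i $ l) * cnj (fchar t \<omega> * \<phi> \<omega> $ j $ l)) \<in> borel_measurable circ"
      by (intro borel_measurable_sum borel_measurable_integrable int)
    show "AE \<omega> in circ. of_real (2 * pi) * (fchar (s - t) \<omega> * f \<omega> $ i $ j)
        = (\<Sum>l\<in>UNIV. (fchar s \<omega> * \<phi> \<omega> $ i $ l) * cnj (fchar t \<omega> * \<phi> \<omega> $ j $ l))"
      using fact
    proof eventually_elim
      case (elim \<omega>)
      have "of_real (2 * pi) * f \<omega> $ i $ j = (\<Sum>l\<in>UNIV. \<phi> \<omega> $ i $ l * cnj (\<phi> \<omega> $ j $ l))"
        unfolding elim by (simp add: matrix_matrix_mult_def cadj_def scaleR_conv_of_real[where 'a = complex])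
      then have "of_real (2 * pi) * (fchar (s - t) \<omega> * f \<omega> $ i $ j)
          = fchar (s - t) \<omega> * (\<Sum>l\<in>UNIV. \<phi> \<omega> $ i $ l * cnj (\<phi> \<omega> $ j $ l))"
        by (simp only: mult.left_commute)
      then show ?case
        by (simp add: fchar_diff sum_distrib_left mult_ac)
    qed
  qed
  also have "\<dots> = (\<Sum>l\<in>UNIV. \<integral>\<omega>. (fchar s \<omega> * \<phi> \<omega> $ i $ l) * cnj (fchar t \<omega> * \<phi> \<omega> $ j $ l) \<partial>circ)"
    by (rule Bochner_Integration.integral_sum[OF int])
  finally show ?thesis .
qed

text \<open>A diagonal entry of \<open>F\<close> is the squared length of a row of \<open>P\<close>
  divided by 2 pi, and no entry exceeds the spectral norm; this explains the constant.\<close>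

lemma factor_entry_bound:
  fixes F :: "complex^'d^'d" and P :: "complex^'r^'d"
  assumes "F = (1 / (2 * pi)) *\<^sub>R (P ** cadj P)" "spec_norm F \<le> Mb"
  shows "cmod (P $ a $ l) \<le> sqrt (2 * pi * Mb)"
proof -
  have "F $ a $ a = of_real (1 / (2 * pi)) * (\<Sum>l\<in>UNIV. P $ a $ l * cnj (P $ a $ l))"
    unfolding assms(1) by (simp add: matrix_matrix_mult_def cadj_def scaleR_conv_of_real[where 'a = complex])
  also have "\<dots> = of_real ((\<Sum>l\<in>UNIV. (cmod (P $ a $ l))\<^sup>2) / (2 * pi))"
    unfolding complex_norm_square[symmetric] by simp
  finally have "cmod (F $ a $ a) = \<bar>(\<Sum>l\<in>UNIV. (cmod (P $ a $ l))\<^sup>2) / (2 * pi)\<bar>"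
    by (simp only: norm_of_real)
  also have "\<dots> = (\<Sum>l\<in>UNIV. (cmod (P $ a $ l))\<^sup>2) / (2 * pi)"
    by (simp add: sum_nonneg)
  finally have "cmod (F $ a $ a) = (\<Sum>l\<in>UNIV. (cmod (P $ a $ l))\<^sup>2) / (2 * pi)" .
  then have "(\<Sum>l\<in>UNIV. (cmod (P $ a $ l))\<^sup>2) / (2 * pi) \<le> Mb"
    using entry_le_spec_norm[of F a a] assms(2) by linarith
  then have "(\<Sum>l\<in>UNIV. (cmod (P $ a $ l))\<^sup>2) \<le> 2 * pi * Mb"
    by (simp add: pos_divide_le_eq mult.commute)
  moreover have "(cmod (P $ a $ l))\<^sup>2 \<le> (\<Sum>l\<in>UNIV. (cmod (P $ a $ l))\<^sup>2)"
    by (rule member_le_sum) auto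
  ultimately show ?thesis
    by (intro real_le_rsqrt) linarith
qed

theorem theorem2p3:
  fixes M :: "'a measure"
    and X :: "int \<Rightarrow> 'a \<Rightarrow> complex^'d"
    and f :: "real \<Rightarrow> complex^'d^'d"
    and \<phi> :: "real \<Rightarrow> complex^'r^'d"
    and Mb :: real
  assumes P: "prob_space M"
    and L2: "\<forall>t. L2_rvec M (X t)"
    and mean0: "\<forall>t l. (\<integral>x. X t x $ l \<partial>M) = 0"
    and f_meas: "\<forall>i j. (\<lambda>\<omega>. f \<omega> $ i $ j) \<in> borel_measurable lborel"
    and f_int: "\<forall>i j. set_integrable lborel {-pi..pi} (\<lambda>\<omega>. f \<omega> $ i $ j)"
    and cov: "\<forall>t h i j. (\<integral>x. X (t + h) x $ i * cnj (X t x $ j) \<partial>M)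
                 = (LINT \<omega>:{-pi..pi}|lborel. exp (\<i> * of_int h * of_real \<omega>) * f \<omega> $ i $ j)"
    and r_le_d: "CARD('r) \<le> CARD('d)"
    and rank_f: "\<forall>\<omega>\<in>{-pi..pi}. rank (f \<omega>) = CARD('r)"
    and bounded: "\<forall>\<omega>\<in>{-pi..pi}. spec_norm (f \<omega>) \<le> Mb"
    and fact: "AE \<omega> in lborel. \<omega> \<in> {-pi..pi} \<longrightarrow>
                 f \<omega> = (1 / (2 * pi)) *\<^sub>R (\<phi> \<omega> ** cadj (\<phi> \<omega>))"
    and phi_H2: "H2_mat \<phi>"
    and psi_H2: "H2_mat (\<lambda>\<omega>. MP_inverse (\<phi> \<omega>))"
  shows "regular_process M X \<and>
         L2_fourier_series (\<lambda>\<omega>. MP_inverse (\<phi> \<omega>)) (fcoef (\<lambda>\<omega>. MP_inverse (\<phi> \<omega>))) \<and>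
         L2_fourier_series \<phi> (fcoef \<phi>) \<and>
         (\<exists>\<xi> :: int \<Rightarrow> 'a \<Rightarrow> complex^'r.
            fundamental_process M X \<xi> \<and>
            (\<forall>t. stoch_int M X f
                   (\<lambda>\<omega>. cmscale (exp (\<i> * of_int t * of_real \<omega>)) (MP_inverse (\<phi> \<omega>))) (\<xi> t)) \<and>
            (\<forall>t. L2_converges M
                   (\<lambda>N x. \<Sum>k<N. fcoef (\<lambda>\<omega>. MP_inverse (\<phi> \<omega>)) k *v X (t - int k) x) (\<xi> t)) \<and>
            (\<forall>t. L2_converges M
                   (\<lambda>N x. \<Sum>j<N. fcoef \<phi> j *v \<xi> (t - int j) x) (X t)))"
proof -
  define \<psi> where "\<psi> = (\<lambda>\<omega>. MP_inverse (\<phi> \<omega>))"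
  have f_circ: "(\<lambda>\<omega>. f \<omega> $ i $ j) \<in> borel_measurable circ" for i j
    using f_meas by (intro measurable_circ) simp
  have fact_circ: "AE \<omega> in circ. f \<omega> = (1 / (2 * pi)) *\<^sub>R (\<phi> \<omega> ** cadj (\<phi> \<omega>))"
    using fact by (simp only: AE_circ)
  have phi_L2: "square_integrable circ (\<lambda>\<omega>. \<phi> \<omega> $ i $ l)" for i l
    by (rule H2_mat_square_integrable[OF phi_H2])
  interpret prob_space M
    by (rule P)
  interpret fundamental_factor M X \<phi> \<psi> "sqrt (2 * pi * Mb)"
  proof unfold_locales
    show "square_integrable M (\<lambda>x. X t x $ i)" for t i
      using L2 by (simp add: L2_rvec_def L2_rv_iff)
    show "(\<integral>x. X t x $ i \<partial>M) = 0" for t i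
      using mean0 by simp
    show "of_real (2 * pi) * (\<integral>x. X s x $ i * cnj (X t x $ j) \<partial>M)
        = (\<Sum>l\<in>UNIV. \<integral>\<omega>. (fchar s \<omega> * \<phi> \<omega> $ i $ l) * cnj (fchar t \<omega> * \<phi> \<omega> $ j $ l) \<partial>circ)" for s t i j
    proof -
      have "(\<integral>x. X s x $ i * cnj (X t x $ j) \<partial>M) = (\<integral>\<omega>. fchar (s - t) \<omega> * f \<omega> $ i $ j \<partial>circ)"
        using cov[rule_format, of t "s - t" i j] by (simp add: integral_circ fchar_def)
      then show ?thesis
        by (simp only: covariance_factorization[OF f_circ fact_circ phi_L2])
    qed
    show "AE \<omega> in circ. \<psi> \<omega> ** \<phi> \<omega> = mat 1"
      \<comment> \<open>\<open>AE_space\<close> restores membership in the interval, on which the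
        rank hypothesis holds at every point.\<close>
      using fact_circ AE_space
    proof eventually_elim
      case (elim \<omega>)
      from elim(2) have "rank (f \<omega>) = CARD('r)"
        using rank_f by simp
      with elim(1) have "\<exists>L. L ** \<phi> \<omega> = mat 1"
        by (rule left_invertible_of_rank_gram)
      then show ?case
        unfolding \<psi>_def using MP_inverse_left_inverse by blast
    qed
    show "AE \<omega> in circ. \<forall>a l. cmod (\<phi> \<omega> $ a $ l) \<le> sqrt (2 * pi * Mb)"
      using fact_circ AE_space
    proof eventually_elim
      case (elim \<omega>)
      from elim(2) have "spec_norm (f \<omega>) \<le> Mb"
        using bounded by simp
      with elim(1) show ?case
        by (blast intro: factor_entry_bound)
    qed
    show "H2_mat \<psi>"
      unfolding \<psi>_def by (rule psi_H2)
  qed (rule phi_L2 phi_H2)+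
  obtain \<xi> where \<xi>: "\<And>t i. spectral_pair (\<lambda>x. \<xi> t x $ i) (\<lambda>\<omega>. fchar t \<omega> *s axis i 1)"
      "\<And>t i. (\<lambda>N. l2norm M (\<lambda>x. (\<xi> t x - (\<Sum>k<N. fcoef \<psi> k *v X (t - int k) x)) $ i)) \<longlonglongrightarrow> 0"
    by (rule noise_exists) blast
  have fund: "fundamental_process M X \<xi>"
    by (rule noise_fundamental[OF \<xi>])
  have series: "L2_converges M (\<lambda>N x. \<Sum>k<N. fcoef \<psi> k *v X (t - int k) x) (\<xi> t)" for t
    by (rule noise_series[OF \<xi>])
  have "stoch_int M X f (\<lambda>\<omega>. cmscale (exp (\<i> * of_int t * of_real \<omega>)) (\<psi> \<omega>)) (\<xi> t)" for t
  proof (rule stoch_int_noise[OF f_circ fact_circ _ series])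
    show "L2_rvec M (\<xi> t)"
      using fund by (simp add: fundamental_process_def orthonormal_white_noise_def)
  qed
  then show ?thesis
    using fundamental_process_regular[OF fund] H2_mat_L2_fourier_series[OF psi_H2]
      H2_mat_L2_fourier_series[OF phi_H2] fund series wold_series[OF \<xi>]
    unfolding \<psi>_def by blast
qed

end
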